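(* Suppose that $|\eta|\le K$, $\mathbb{E}\eta=0$, and $0<\varepsilon\le\gamma$. For any $p\ge2$ there is a constant $C_p>0$ such that for all $t\in(0,1)$ and $N\in\mathbb{N}$, $$\|X^N_t-X_t\|_p\le C_p\,\frac{\sqrt{\varepsilon}}{\sqrt N}\,e^{K^2\beta_t/(2\varepsilon\sigma_t)}\Big(\mathbb{E}\,e^{(p-1)(p|\eta|^2+\mathbb{E}|\eta|^2)/(2\varepsilon\sigma_t)}\Big)^{1/p}.$$
   Context: $\sigma,\beta:[0,1]\to[0,1]$ are $C^1$ with $\beta'_t>0$ on $(0,1)$, $\beta_0=0$, $\beta_1=1$, $\sigma_t+\beta_t=1$; $\varepsilon,\gamma>0$ and $\ell_t=\varepsilon\beta_t+\gamma\sigma_t$. $\eta$ is an $\mathbb{R}^d$-valued random variable, $\eta_1,\dots,\eta_N$ are $N$ independent copies of $\eta$, and $\mathcal{C}_t(x,y)=e^{-|x-\beta_ty|^2/(2\ell_t\sigma_t)}$. $X$ and $X^N$ solve, with the same $d$-dimensional Brownian motion $W$ and the same initial value $\xi_0\sim N(0,\gamma\mathbb{I}_d)$, with $(\xi_0,W)$ independent of $(\eta_1,\dots,\eta_N)$ and $\xi_0$ independent of $W$, $$\mathrm{d}X_t=b_t(X_t)\,\mathrm{d}t+\sqrt{\varepsilon\beta'_t}\,\mathrm{d}W_t,\qquad \mathrm{d}X^N_t=b^N_t(X^N_t)\,\mathrm{d}t+\sqrt{\varepsilon\beta'_t}\,\mathrm{d}W_t,\qquad X_0=X_0^N=\xi_0,$$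 where $$b_t(x)=\frac{\sigma'_t\,\mathbb{E}[(x-\eta)\mathcal{C}_t(x,\eta)]}{\sigma_t\,\mathbb{E}\,\mathcal{C}_t(x,\eta)},\qquad b^N_t(x)=\frac{\sigma'_t\sum_{i=1}^N(x-\eta_i)\mathcal{C}_t(x,\eta_i)}{\sigma_t\sum_{i=1}^N\mathcal{C}_t(x,\eta_i)}.$$ $\|\cdot\|_p$ is the $L^p(\mathbb{P})$ norm. *)

theory Defs
  imports "HOL-Probability.Probability"
begin

section \<open>Isotropic Gaussians and Brownian motion\<close>

definition gaussian_density :: "real \<Rightarrow> 'a::euclidean_space \<Rightarrow> real" where
  "gaussian_density v x = exp (- (norm x)\<^sup>2 / (2 * v)) / sqrt (2 * pi * v) ^ DIM('a)"

text \<open>For \<open>v > 0\<close>: \<open>Z\<close> has law \<open>N(0, v I)\<close>.\<close>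
definition isotropic_gaussian :: "'w measure \<Rightarrow> real \<Rightarrow> ('w \<Rightarrow> 'a::euclidean_space) \<Rightarrow> bool" where
  "isotropic_gaussian M v Z \<longleftrightarrow> distributed M lborel Z (\<lambda>x. ennreal (gaussian_density v x))"

definition brownian_motion ::
  "'w measure \<Rightarrow> (real \<Rightarrow> 'w \<Rightarrow> 'a::euclidean_space) \<Rightarrow> bool" where
  "brownian_motion M W \<longleftrightarrow>
     (\<forall>t\<ge>0. W t \<in> borel_measurable M) \<and>
     (AE \<omega> in M. W 0 \<omega> = 0) \<and>
     (\<forall>s t. 0 \<le> s \<and> s < t \<longrightarrow> isotropic_gaussian M (t - s) (\<lambda>\<omega>. W t \<omega> - W s \<omega>)) \<and>
     (\<forall>(n::nat) \<tau>. 0 \<le> \<tau> 0 \<and> (\<forall>i<n. \<tau> i \<le> \<tau> (Suc i)) \<longrightarrow>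
        prob_space.indep_vars M (\<lambda>_. borel) (\<lambda>i \<omega>. W (\<tau> (Suc i)) \<omega> - W (\<tau> i) \<omega>) {..<n}) \<and>
     (AE \<omega> in M. continuous_on {0..} (\<lambda>t. W t \<omega>))"

text \<open>\<open>W\<close> as a random element of the path space, with the product sigma-algebra.\<close>
definition path :: "(real \<Rightarrow> 'w \<Rightarrow> 'a) \<Rightarrow> 'w \<Rightarrow> real \<Rightarrow> 'a" where
  "path W \<omega> = (\<lambda>t\<in>{0..}. W t \<omega>)"

abbreviation path_space :: "(real \<Rightarrow> 'a::topological_space) measure" where
  "path_space \<equiv> PiM {0..} (\<lambda>_. borel)"


text \<open>Independence of two random elements; unlike \<open>indep_var\<close>, the value spaces may have
  different types.\<close>
definition independent ::
  "'w measure \<Rightarrow> 'b measure \<Rightarrow> ('w \<Rightarrow> 'b) \<Rightarrow> 'c measure \<Rightarrow> ('w \<Rightarrow> 'c) \<Rightarrow> bool" where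
  "independent M S Y T Z \<longleftrightarrow>
     Y \<in> measurable M S \<and> Z \<in> measurable M T \<and>
     prob_space.indep_set M {Y -` A \<inter> space M | A. A \<in> sets S} {Z -` B \<inter> space M | B. B \<in> sets T}"


section \<open>Stochastic integrals of deterministic integrands\<close>

text \<open>A list of triples \<open>(c, a, b)\<close> encodes the step function that is the sum of the
  \<open>c * indicator {a<..b}\<close>. The intervals may overlap; the elementary integral is linear, so
  this is harmless.\<close>
definition step_fun :: "(real \<times> real \<times> real) list \<Rightarrow> real \<Rightarrow> real" where
  "step_fun cs s = (\<Sum>(c, a, b)\<leftarrow>cs. c * indicator {a<..b} s)"

definition step_integral ::
  "(real \<Rightarrow> 'w \<Rightarrow> 'a::euclidean_space) \<Rightarrow> (real \<times> real \<times> real) list \<Rightarrow> 'w \<Rightarrow> 'a" where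
  "step_integral W cs \<omega> = (\<Sum>(c, a, b)\<leftarrow>cs. c *\<^sub>R (W b \<omega> - W a \<omega>))"

text \<open>\<open>J\<close> is (a version of) the Ito integral of the deterministic function \<open>g\<close> against \<open>W\<close>
  over \<open>[0, t]\<close>: the limit in mean square of the elementary integrals of step functions that
  converge to \<open>g\<close> in \<open>L\<^sup>2[0, t]\<close>. By the Ito isometry \<open>J\<close> is unique almost surely.\<close>
definition wiener_integral ::
  "'w measure \<Rightarrow> (real \<Rightarrow> 'w \<Rightarrow> 'a::euclidean_space) \<Rightarrow> (real \<Rightarrow> real) \<Rightarrow> real \<Rightarrow> ('w \<Rightarrow> 'a) \<Rightarrow> bool"
where
  "wiener_integral M W g t J \<longleftrightarrow>
     J \<in> borel_measurable M \<and>
     (\<exists>cs :: nat \<Rightarrow> (real \<times> real \<times> real) list.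
        (\<forall>n. \<forall>(c, a, b)\<in>set (cs n). 0 \<le> a \<and> a \<le> b \<and> b \<le> t) \<and>
        (\<lambda>n. \<integral>\<^sup>+s\<in>{0..t}. ennreal ((step_fun (cs n) s - g s)\<^sup>2) \<partial>lborel) \<longlonglongrightarrow> 0 \<and>
        (\<lambda>n. \<integral>\<^sup>+\<omega>. ennreal ((norm (step_integral W (cs n) \<omega> - J \<omega>))\<^sup>2) \<partial>M) \<longlonglongrightarrow> 0)"

text \<open>\<open>X\<close> solves \<open>dX\<^sub>t = f\<^sub>t(X\<^sub>t) dt + g\<^sub>t dW\<^sub>t\<close>, \<open>X\<^sub>0 = \<xi>\<close> on \<open>[0, 1)\<close>, where the drift \<open>f t \<omega> x\<close> may
  be random. The endpoint is left out because the drifts below are singular at time 1. As \<open>g\<close> is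
  deterministic, no filtration is needed to give meaning to the equation.\<close>
definition sde_solution ::
  "'w measure \<Rightarrow> (real \<Rightarrow> 'w \<Rightarrow> 'a::euclidean_space) \<Rightarrow> ('w \<Rightarrow> 'a) \<Rightarrow>
   (real \<Rightarrow> 'w \<Rightarrow> 'a \<Rightarrow> 'a) \<Rightarrow> (real \<Rightarrow> real) \<Rightarrow> (real \<Rightarrow> 'w \<Rightarrow> 'a) \<Rightarrow> bool"
where
  "sde_solution M W \<xi> f g X \<longleftrightarrow>
     (\<forall>t\<in>{0..<1}. X t \<in> borel_measurable M) \<and>
     (\<exists>I. (\<forall>t\<in>{0..<1}. wiener_integral M W g t (I t)) \<and>
        (AE \<omega> in M.
           continuous_on {0..<1} (\<lambda>t. X t \<omega>) \<and>
           (\<forall>t\<in>{0..<1}.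
              set_integrable lborel {0..t} (\<lambda>s. f s \<omega> (X s \<omega>)) \<and>
              X t \<omega> = \<xi> \<omega> + (LBINT s:{0..t}. f s \<omega> (X s \<omega>)) + I t \<omega>)))"


section \<open>The two diffusions\<close>

locale schedule =
  fixes \<beta> \<beta>' \<sigma> \<sigma>' :: "real \<Rightarrow> real" and \<epsilon> \<gamma> :: real
  assumes \<beta>_range: "\<And>t. t \<in> {0..1} \<Longrightarrow> \<beta> t \<in> {0..1}"
    and \<sigma>_range: "\<And>t. t \<in> {0..1} \<Longrightarrow> \<sigma> t \<in> {0..1}"
    and \<beta>_deriv: "\<And>t. t \<in> {0..1} \<Longrightarrow> (\<beta> has_real_derivative \<beta>' t) (at t within {0..1})"
    and \<sigma>_deriv: "\<And>t. t \<in> {0..1} \<Longrightarrow> (\<sigma> has_real_derivative \<sigma>' t) (at t within {0..1})"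
    and \<beta>'_cont: "continuous_on {0..1} \<beta>'"
    and \<sigma>'_cont: "continuous_on {0..1} \<sigma>'"
    and \<beta>'_pos: "\<And>t. t \<in> {0<..<1} \<Longrightarrow> \<beta>' t > 0"
    and \<beta>_0: "\<beta> 0 = 0" and \<beta>_1: "\<beta> 1 = 1"
    and sum_1: "\<And>t. t \<in> {0..1} \<Longrightarrow> \<sigma> t + \<beta> t = 1"
    and \<epsilon>_pos: "\<epsilon> > 0" and \<gamma>_pos: "\<gamma> > 0"
begin

definition ell :: "real \<Rightarrow> real" where
  "ell t = \<epsilon> * \<beta> t + \<gamma> * \<sigma> t"

definition kern :: "real \<Rightarrow> 'a::euclidean_space \<Rightarrow> 'a \<Rightarrow> real" where
  "kern t x y = exp (- (norm (x - \<beta> t *\<^sub>R y))\<^sup>2 / (2 * ell t * \<sigma> t))"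

definition drift :: "'p measure \<Rightarrow> ('p \<Rightarrow> 'a::euclidean_space) \<Rightarrow> real \<Rightarrow> 'a \<Rightarrow> 'a" where
  "drift P \<eta> t x =
     (\<sigma>' t / (\<sigma> t * (LINT \<omega>|P. kern t x (\<eta> \<omega>)))) *\<^sub>R
     (LINT \<omega>|P. kern t x (\<eta> \<omega>) *\<^sub>R (x - \<eta> \<omega>))"

definition empirical_drift :: "nat \<Rightarrow> (nat \<Rightarrow> 'a::euclidean_space) \<Rightarrow> real \<Rightarrow> 'a \<Rightarrow> 'a" where
  "empirical_drift N y t x =
     (\<sigma>' t / (\<sigma> t * (\<Sum>i=1..N. kern t x (y i)))) *\<^sub>R
     (\<Sum>i=1..N. kern t x (y i) *\<^sub>R (x - y i))"

end

text \<open>\<open>\<eta>\<close> lives on \<open>P\<close>; its \<open>N\<close> independent copies \<open>\<eta>s 1, \<dots>, \<eta>s N\<close>, the Brownian motion and the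
  two diffusions live on \<open>M\<close>. Only the law of \<open>\<eta>\<close> enters, so \<open>P\<close> may but need not equal \<open>M\<close>.\<close>
locale coupled_diffusions =
  schedule \<beta> \<beta>' \<sigma> \<sigma>' \<epsilon> \<gamma> + P: prob_space P + prob_space M
  for P :: "'p measure" and \<eta> :: "'p \<Rightarrow> 'a::euclidean_space"
    and \<beta> \<beta>' \<sigma> \<sigma>' :: "real \<Rightarrow> real" and \<epsilon> \<gamma> :: real
    and M :: "'w measure" and N :: nat and \<eta>s :: "nat \<Rightarrow> 'w \<Rightarrow> 'a"
    and W :: "real \<Rightarrow> 'w \<Rightarrow> 'a" and \<xi> :: "'w \<Rightarrow> 'a" and X XN :: "real \<Rightarrow> 'w \<Rightarrow> 'a" +
  assumes \<eta>_rv: "\<eta> \<in> borel_measurable P"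
    and N_pos: "N \<ge> 1"
    and copies_indep: "indep_vars (\<lambda>_. borel) \<eta>s {1..N}"
    and copies_law: "\<And>i. i \<in> {1..N} \<Longrightarrow> distr M borel (\<eta>s i) = distr P borel \<eta>"
    and W_bm: "brownian_motion M W"
    and \<xi>_law: "isotropic_gaussian M \<gamma> \<xi>"
    and \<xi>_W_indep: "independent M borel \<xi> path_space (path W)"
    and noise_copies_indep:
      "independent M (borel \<Otimes>\<^sub>M path_space) (\<lambda>\<omega>. (\<xi> \<omega>, path W \<omega>))
                     (PiM {1..N} (\<lambda>_. borel)) (\<lambda>\<omega>. \<lambda>i\<in>{1..N}. \<eta>s i \<omega>)"
    and X_sde: "sde_solution M W \<xi> (\<lambda>t \<omega> x. drift P \<eta> t x) (\<lambda>t. sqrt (\<epsilon> * \<beta>' t)) X"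
    and XN_sde: "sde_solution M W \<xi> (\<lambda>t \<omega> x. empirical_drift N (\<lambda>i. \<eta>s i \<omega>) t x)
                   (\<lambda>t. sqrt (\<epsilon> * \<beta>' t)) XN"


section \<open>Norms in Lp\<close>

definition in_Lp :: "'w measure \<Rightarrow> real \<Rightarrow> ('w \<Rightarrow> 'a::euclidean_space) \<Rightarrow> bool" where
  "in_Lp M p Z \<longleftrightarrow> Z \<in> borel_measurable M \<and> integrable M (\<lambda>\<omega>. norm (Z \<omega>) powr p)"

text \<open>Meaningful only if \<open>in_Lp M p Z\<close>: the Bochner integral of a non-integrable function is 0.\<close>
definition Lp_norm :: "'w measure \<Rightarrow> real \<Rightarrow> ('w \<Rightarrow> 'a::euclidean_space) \<Rightarrow> real" where
  "Lp_norm M p Z = (LINT \<omega>|M. norm (Z \<omega>) powr p) powr (1 / p)"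

end

theory Submission
  imports Defs
begin

text \<open>
  In the time \<open>s = \<beta>\<^sub>t / \<sigma>\<^sub>t\<close>, the \<^emph>\<open>odds\<close>, the process \<open>Y = X / \<sigma>\<close> solves \<open>dY = m\<^sub>s(Y) ds + dJ\<close>. Here
  \<open>m\<close> is the mean of the law of \<open>\<eta>\<close> tilted by the kernel, that is, the conditional mean of
  \<open>\<eta>\<close> given the interpolant, and \<open>J\<close> is a Gaussian noise that does not depend on the state
  (\<open>variation_of_constants\<close>). The process \<open>Y\<^sup>N = X\<^sup>N / \<sigma>\<close> solves the same equation with the
  tilted mean \<open>m\<^sup>N\<close> of the sample, so the noise cancels in the difference, which satisfies an ordinary
  differential equation path by path.

  The derivative of a tilted mean is a tilted covariance. If \<open>|\<eta>| \<le> k\<close>, this makes \<open>m\<^sup>N\<^sub>s\<close> Lipschitz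
  in \<open>y\<close> with constant at most \<open>k\<^sup>2 / \<epsilon>\<close> (\<open>wmean_tilt_lipschitz\<close>, \<open>slope_le\<close>), and Gronwall's
  lemma gives
  \[ |Y^N_s - Y_s| \le e^{k^2 s / \epsilon} \int_0^s |m^N_u(Y_u) - m_u(Y_u)| \, du. \]

  The integrand is evaluated along \<open>Y\<close>, which is a function of the initial value and of the Brownian
  path alone, as the limit of its Euler scheme (\<open>noise_determined_X\<close>). So it is independent of the
  sample, and \<open>Y\<^sub>u\<close> may be treated as a fixed point \<open>y\<close>. There \<open>m\<^sup>N - m\<close> is a ratio of averages
  of independent variables; Hoeffding's lemma bounds its \<open>L\<^sup>p\<close> norm
  by a multiple of \<open>1 / \<surd>N\<close> times the essential supremum of the density of the conditional law of \<open>\<eta>\<close> with respect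
  to its law (\<open>emp_mean_moment\<close>). By compactness, almost every point has a small ball around it with
  mass bounded below, so this density grows only like \<open>e\<^sup>r\<^sup>|\<^sup>y\<^sup>|\<close> with a rate that can be made
  small (\<open>kern_density\<close>). The Gaussian exponential moments of \<open>\<xi>\<^sub>0 + J\<close> turn this into a
  factor \<open>e\<^sup>\<kappa>\<^sup>s\<^sup>/\<^sup>\<epsilon>\<close> with \<open>\<kappa>\<close> as small as one likes (\<open>fluct_moment\<close>). In total the error is at most a
  constant times \<open>N\<^sup>-\<^sup>1\<^sup>/\<^sup>2 exp ((k\<^sup>2 + \<kappa>) s / \<epsilon>)\<close>.

  It remains to compare exponents. The constant may depend on the law of \<open>\<eta>\<close>; take for \<open>k\<close> the
  essential supremum of \<open>|\<eta>|\<close>. The exponential moment on the right-hand side sees values of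
  \<open>|\<eta>|\<close> arbitrarily close to \<open>k\<close>, and as \<open>1 / \<sigma>\<^sub>t = 1 + s\<close> and \<open>p - 1 \<ge> 1\<close> it contributes at
  least \<open>exp (k\<^sup>2 s / (2 \<epsilon>))\<close>, which together with the explicit factor makes up the Gronwall factor.
  The term \<open>E|\<eta>|\<^sup>2\<close> comes on top. It is positive unless \<open>\<eta>\<close> vanishes, in which case the two
  diffusions coincide, and it pays for \<open>\<kappa>\<close>, for the approximation of \<open>k\<close> and for the factor
  \<open>\<surd>\<epsilon>\<close> (\<open>exponential_moment_lower_bound\<close>).
\<close>

section \<open>Riemann sums, Euler's scheme and integral inequalities\<close>

definition mesh :: "real \<Rightarrow> nat \<Rightarrow> nat \<Rightarrow> real" where
  "mesh T n k = T * real k / real n"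

lemma mesh_0 [simp]: "mesh T n 0 = 0" and mesh_n: "n > 0 \<Longrightarrow> mesh T n n = T"
  by (auto simp: mesh_def)

lemma mesh_mono: "0 \<le> T \<Longrightarrow> i \<le> j \<Longrightarrow> mesh T n i \<le> mesh T n j"
  by (auto simp: mesh_def intro!: divide_right_mono mult_left_mono)

lemma mesh_in: "0 \<le> T \<Longrightarrow> n > 0 \<Longrightarrow> k \<le> n \<Longrightarrow> mesh T n k \<in> {0..T}"
  using mesh_mono[of T 0 k n] mesh_mono[of T k n n] by (simp add: mesh_n)

lemma mesh_Suc_diff: "n > 0 \<Longrightarrow> mesh T n (Suc k) - mesh T n k = T / real n"
  by (simp add: mesh_def field_simps)

text \<open>Uniform continuity makes the oscillation of a continuous function over the cells of a fine
  mesh uniformly small.\<close>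
lemma eventually_mesh_oscillation:
  fixes f :: "real \<Rightarrow> 'b::metric_space"
  assumes T: "0 \<le> T" and f: "continuous_on {0..T} f" and e: "e > 0"
  shows "\<forall>\<^sub>F n in sequentially. n > 0 \<and> (\<forall>k<n. \<forall>r\<in>{mesh T n k..mesh T n (Suc k)}.
           \<forall>r'\<in>{mesh T n k..mesh T n (Suc k)}. dist (f r) (f r') \<le> e)"
proof -
  have "uniformly_continuous_on {0..T} f"
    using f by (intro compact_uniformly_continuous) auto
  then obtain d where d: "d > 0"
    "\<And>x x'. x \<in> {0..T} \<Longrightarrow> x' \<in> {0..T} \<Longrightarrow> dist x x' < d \<Longrightarrow> dist (f x) (f x') < e"
    using e unfolding uniformly_continuous_on_def by metis
  have "(\<lambda>n. T / real n) \<longlonglongrightarrow> 0" by (rule lim_const_over_n)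
  hence "\<forall>\<^sub>F n in sequentially. T / real n < d"
    using d(1) order_tendstoD(2) by blast
  moreover have "\<forall>\<^sub>F n in sequentially. n > (0::nat)" by (rule eventually_gt_at_top)
  ultimately show ?thesis
  proof eventually_elim
    case (elim n)
    have "dist (f r) (f r') \<le> e" if k: "k < n" and r: "r \<in> {mesh T n k..mesh T n (Suc k)}"
      and r': "r' \<in> {mesh T n k..mesh T n (Suc k)}" for k r r'
    proof -
      have "{mesh T n k..mesh T n (Suc k)} \<subseteq> {0..T}"
        using mesh_in[OF T elim(2), of k] mesh_in[OF T elim(2), of "Suc k"] k by auto
      hence rr: "r \<in> {0..T}" "r' \<in> {0..T}" using r r' by auto
      have "dist r r' \<le> T / real n"
        using r r' mesh_Suc_diff[OF elim(2), of T k] by (auto simp: dist_real_def abs_le_iff)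
      thus ?thesis using d(2)[OF rr] elim by fastforce
    qed
    thus ?case using elim by auto
  qed
qed

lemma integral_mesh_cells:
  fixes f :: "real \<Rightarrow> 'b::euclidean_space"
  assumes T: "0 \<le> T" and n: "n > 0" and f: "continuous_on {0..T} f" and k: "k \<le> n"
  shows "integral {0..mesh T n k} f = (\<Sum>i<k. integral {mesh T n i..mesh T n (Suc i)} f)"
  using k
proof (induction k)
  case (Suc k)
  have "continuous_on {0..mesh T n (Suc k)} f"
    using mesh_in[OF T n Suc.prems] by (intro continuous_on_subset[OF f]) auto
  hence "integral {0..mesh T n k} f + integral {mesh T n k..mesh T n (Suc k)} f
      = integral {0..mesh T n (Suc k)} f"
    using mesh_in[OF T n, of k] mesh_mono[OF T, of k "Suc k" n] Suc.prems
    by (intro Henstock_Kurzweil_Integration.integral_combine integrable_continuous_real) auto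
  thus ?case using Suc by simp
qed simp

lemma shrunk_tolerance: "e > 0 \<Longrightarrow> S \<ge> 0 \<Longrightarrow> S * (e / (2 * (S + 1))) < (e::real)"
proof -
  assume e: "e > 0" and S: "S \<ge> 0"
  have "S * (e / (2 * (S + 1))) = (S / (2 * (S + 1))) * e" by simp
  also have "\<dots> < 1 * e" using e S by (intro mult_strict_right_mono) (auto simp: divide_simps)
  finally show ?thesis by simp
qed

lemma powr_tangent:
  fixes x c p :: real
  assumes "p > 1" "x \<ge> 0" "c \<ge> 0"
  shows "p * (x * c powr (p - 1)) \<le> x powr p + (p - 1) * c powr p"
proof -
  have q: "p / (p - 1) > 1" "1 / p + 1 / (p / (p - 1)) = 1" using assms by (auto simp: field_simps)
  have "x * c powr (p - 1) \<le> x powr p / p + (c powr (p - 1)) powr (p / (p - 1)) / (p / (p - 1))"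
    by (rule Youngs_inequality) (use assms q in auto)
  also have "(c powr (p - 1)) powr (p / (p - 1)) = c powr p" using assms by (simp add: powr_powr)
  finally show ?thesis using assms by (simp add: field_simps)
qed

text \<open>A clock \<open>g\<close> in whose time differential equations are integrated.\<close>
locale smooth_clock =
  fixes T :: real and g g' :: "real \<Rightarrow> real"
  assumes T_nonneg: "0 \<le> T"
    and deriv: "\<And>t. t \<in> {0..T} \<Longrightarrow> (g has_real_derivative g' t) (at t within {0..T})"
    and cont': "continuous_on {0..T} g'"
    and nonneg': "\<And>t. t \<in> {0..T} \<Longrightarrow> g' t \<ge> 0"
begin

lemma integral_clock:
  assumes "0 \<le> a" "a \<le> b" "b \<le> T"
  shows "(g' has_integral (g b - g a)) {a..b}"
proof (rule fundamental_theorem_of_calculus)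
  fix x assume "x \<in> {a..b}"
  thus "(g has_vector_derivative g' x) (at x within {a..b})"
    using assms deriv[of x] unfolding has_real_derivative_iff_has_vector_derivative
    by (auto intro: has_vector_derivative_within_subset)
qed fact

lemma clock_mono: "0 \<le> a \<Longrightarrow> a \<le> b \<Longrightarrow> b \<le> T \<Longrightarrow> g a \<le> g b"
  using has_integral_nonneg[OF integral_clock, of a b] nonneg' by fastforce

text \<open>The error committed by freezing a continuous integrand on one cell.\<close>
lemma cell_error:
  fixes f :: "real \<Rightarrow> 'b::euclidean_space"
  assumes ab: "0 \<le> a" "a \<le> b" "b \<le> T" and f: "continuous_on {a..b} f"
    and e: "\<And>r. r \<in> {a..b} \<Longrightarrow> norm (f r - c) \<le> e"
  shows "norm (integral {a..b} (\<lambda>r. g' r *\<^sub>R f r) - (g b - g a) *\<^sub>R c) \<le> (g b - g a) * e"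
proof -
  have sub: "{a..b} \<subseteq> {0..T}" using ab by auto
  have g'c: "continuous_on {a..b} g'" by (rule continuous_on_subset[OF cont' sub])
  have 1: "((\<lambda>r. g' r *\<^sub>R c) has_integral (g b - g a) *\<^sub>R c) {a..b}"
    by (rule has_integral_scaleR_left[OF integral_clock[OF ab]])
  have 2: "((\<lambda>r. g' r *\<^sub>R f r) has_integral integral {a..b} (\<lambda>r. g' r *\<^sub>R f r)) {a..b}"
    by (intro integrable_integral integrable_continuous_real continuous_intros g'c f)
  have 3: "((\<lambda>r. g' r *\<^sub>R f r - g' r *\<^sub>R c) has_integral
      (integral {a..b} (\<lambda>r. g' r *\<^sub>R f r) - (g b - g a) *\<^sub>R c)) {a..b}"
    by (rule has_integral_diff[OF 2 1])
  have 4: "((\<lambda>r. g' r * e) has_integral (g b - g a) * e) {a..b}"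
    by (rule has_integral_mult_left[OF integral_clock[OF ab]])
  have "norm (integral {a..b} (\<lambda>r. g' r *\<^sub>R f r - g' r *\<^sub>R c)) \<le> integral {a..b} (\<lambda>r. g' r * e)"
  proof (rule integral_norm_bound_integral)
    show "norm (g' r *\<^sub>R f r - g' r *\<^sub>R c) \<le> g' r * e" if "r \<in> {a..b}" for r
      using e[OF that] nonneg'[of r] that sub
      by (auto simp: scaleR_diff_right[symmetric] intro!: mult_left_mono)
  qed (use 3 4 in auto)
  thus ?thesis using integral_unique[OF 3] integral_unique[OF 4] by metis
qed

lemma riemann_sum_tendsto:
  fixes f :: "real \<Rightarrow> 'b::euclidean_space"
  assumes f: "continuous_on {0..T} f"
    and tag: "\<And>n k. k < n \<Longrightarrow> c n k \<in> {mesh T n k..mesh T n (Suc k)}"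
  shows "(\<lambda>n. \<Sum>k<n. (g (mesh T n (Suc k)) - g (mesh T n k)) *\<^sub>R f (c n k))
           \<longlonglongrightarrow> integral {0..T} (\<lambda>r. g' r *\<^sub>R f r)"
proof (rule LIMSEQ_I)
  fix e :: real assume e: "e > 0"
  define d where "d = e / (2 * (g T - g 0 + 1))"
  have gT: "g 0 \<le> g T" using clock_mono[of 0 T] T_nonneg by simp
  have d: "d > 0" using e gT by (simp add: d_def)
  from eventually_mesh_oscillation[OF T_nonneg f d] obtain n0 where n0:
    "\<And>n. n \<ge> n0 \<Longrightarrow> n > 0 \<and> (\<forall>k<n. \<forall>r\<in>{mesh T n k..mesh T n (Suc k)}.
           \<forall>r'\<in>{mesh T n k..mesh T n (Suc k)}. dist (f r) (f r') \<le> d)"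
    unfolding eventually_sequentially by blast
  show "\<exists>no. \<forall>n\<ge>no. norm ((\<Sum>k<n. (g (mesh T n (Suc k)) - g (mesh T n k)) *\<^sub>R f (c n k)) -
            integral {0..T} (\<lambda>r. g' r *\<^sub>R f r)) < e"
  proof (intro exI allI impI)
    fix n assume "n \<ge> n0"
    note n = n0[OF this]
    let ?m = "mesh T n"
    have "norm (integral {0..T} (\<lambda>r. g' r *\<^sub>R f r) - (\<Sum>k<n. (g (?m (Suc k)) - g (?m k)) *\<^sub>R f (c n k)))
      = norm (\<Sum>k<n. integral {?m k..?m (Suc k)} (\<lambda>r. g' r *\<^sub>R f r) - (g (?m (Suc k)) - g (?m k)) *\<^sub>R f (c n k))"
      using integral_mesh_cells[OF T_nonneg, of n "\<lambda>r. g' r *\<^sub>R f r" n] n f cont'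
      by (simp add: sum_subtractf mesh_n continuous_on_scaleR)
    also have "\<dots> \<le> (\<Sum>k<n. (g (?m (Suc k)) - g (?m k)) * d)"
    proof (rule sum_norm_le)
      fix k assume "k \<in> {..<n}"
      hence k: "k < n" by simp
      have m: "?m k \<in> {0..T}" "?m (Suc k) \<in> {0..T}" "?m k \<le> ?m (Suc k)"
        using mesh_in[OF T_nonneg, of n] mesh_mono[OF T_nonneg, of k "Suc k"] k n by auto
      show "norm (integral {?m k..?m (Suc k)} (\<lambda>r. g' r *\<^sub>R f r) - (g (?m (Suc k)) - g (?m k)) *\<^sub>R f (c n k))
          \<le> (g (?m (Suc k)) - g (?m k)) * d"
        using m n k tag[OF k]
        by (intro cell_error continuous_on_subset[OF f]) (auto simp: dist_norm)
    qed
    also have "\<dots> = (g T - g 0) * d"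
      using n sum_lessThan_telescope[of "\<lambda>k. g (?m k)" n]
      by (simp add: sum_distrib_right[symmetric] mesh_n)
    also have "\<dots> < e"
      unfolding d_def using shrunk_tolerance[OF e, of "g T - g 0"] gT by simp
    finally show "norm ((\<Sum>k<n. (g (?m (Suc k)) - g (?m k)) *\<^sub>R f (c n k)) -
            integral {0..T} (\<lambda>r. g' r *\<^sub>R f r)) < e"
      by (simp add: norm_minus_commute)
  qed
qed

text \<open>Explicit Euler scheme for \<open>dD = \<phi>\<^sub>r(D) dg\<^sub>r\<close>, started at 0.\<close>
fun euler :: "(real \<Rightarrow> 'b \<Rightarrow> 'b::euclidean_space) \<Rightarrow> nat \<Rightarrow> nat \<Rightarrow> 'b" where
  "euler \<phi> n 0 = 0"
| "euler \<phi> n (Suc k) = euler \<phi> n k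
     + (g (mesh T n (Suc k)) - g (mesh T n k)) *\<^sub>R \<phi> (mesh T n k) (euler \<phi> n k)"

text \<open>For a Lipschitz right-hand side the global error is at most the oscillation of the exact
  right-hand side over a cell, times \<open>(g T - g 0) exp (L (g T - g 0))\<close>.\<close>
lemma euler_tendsto:
  fixes \<phi> :: "real \<Rightarrow> 'b \<Rightarrow> 'b::euclidean_space" and D :: "real \<Rightarrow> 'b"
  assumes D: "\<And>t. t \<in> {0..T} \<Longrightarrow> D t = integral {0..t} (\<lambda>r. g' r *\<^sub>R \<phi> r (D r))"
    and cont: "continuous_on {0..T} (\<lambda>r. \<phi> r (D r))"
    and lip: "\<And>r x y. r \<in> {0..T} \<Longrightarrow> norm (\<phi> r x - \<phi> r y) \<le> L * norm (x - y)" and L: "L \<ge> 0"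
  shows "(\<lambda>n. euler \<phi> n n) \<longlonglongrightarrow> D T"
proof (rule LIMSEQ_I)
  fix e :: real assume e: "e > 0"
  have gT: "g 0 \<le> g T" using clock_mono[of 0 T] T_nonneg by simp
  define S where "S = (g T - g 0) * exp (L * (g T - g 0))"
  define d where "d = e / (2 * (S + 1))"
  have S: "S \<ge> 0" using gT by (simp add: S_def)
  have d: "d > 0" using e S by (simp add: d_def)
  from eventually_mesh_oscillation[OF T_nonneg cont d] obtain n0 where n0:
    "\<And>n. n \<ge> n0 \<Longrightarrow> n > 0 \<and> (\<forall>k<n. \<forall>r\<in>{mesh T n k..mesh T n (Suc k)}.
           \<forall>r'\<in>{mesh T n k..mesh T n (Suc k)}. dist (\<phi> r (D r)) (\<phi> r' (D r')) \<le> d)"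
    unfolding eventually_sequentially by blast
  show "\<exists>no. \<forall>n\<ge>no. norm (euler \<phi> n n - D T) < e"
  proof (intro exI allI impI)
    fix n assume "n \<ge> n0"
    note n = n0[OF this]
    let ?m = "mesh T n"
    have "norm (D (?m k) - euler \<phi> n k) \<le> d * (g (?m k) - g 0) * exp (L * (g (?m k) - g 0))" if "k \<le> n" for k
      using that
    proof (induction k)
      case 0
      have "D 0 = 0" using D[of 0] T_nonneg by simp
      thus ?case by simp
    next
      case (Suc k)
      have k: "k < n" using Suc by simp
      have m: "?m k \<in> {0..T}" "?m (Suc k) \<in> {0..T}" "?m k \<le> ?m (Suc k)"
        using mesh_in[OF T_nonneg, of n] mesh_mono[OF T_nonneg, of k "Suc k"] k n by auto
      define h where "h = g (?m (Suc k)) - g (?m k)"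
      define G where "G = g (?m k) - g 0"
      have h: "h \<ge> 0" using clock_mono m by (auto simp: h_def)
      have G: "G \<ge> 0" using clock_mono[of 0 "?m k"] m by (auto simp: G_def)
      have ci: "continuous_on {0..T} (\<lambda>r. g' r *\<^sub>R \<phi> r (D r))"
        by (intro continuous_intros cont' cont)
      have "D (?m (Suc k)) = D (?m k) + integral {?m k..?m (Suc k)} (\<lambda>r. g' r *\<^sub>R \<phi> r (D r))"
        using integral_mesh_cells[OF T_nonneg _ ci, of n "Suc k"]
          integral_mesh_cells[OF T_nonneg _ ci, of n k] n k D[OF m(1)] D[OF m(2)] by simp
      hence "D (?m (Suc k)) - euler \<phi> n (Suc k) = (D (?m k) - euler \<phi> n k)
         + (integral {?m k..?m (Suc k)} (\<lambda>r. g' r *\<^sub>R \<phi> r (D r)) - h *\<^sub>R \<phi> (?m k) (D (?m k)))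
         + h *\<^sub>R (\<phi> (?m k) (D (?m k)) - \<phi> (?m k) (euler \<phi> n k))"
        by (simp add: h_def algebra_simps)
      also have "norm \<dots> \<le> norm (D (?m k) - euler \<phi> n k) + h * d
          + h * (L * norm (D (?m k) - euler \<phi> n k))"
      proof (intro norm_triangle_le add_mono order_refl)
        show "norm (integral {?m k..?m (Suc k)} (\<lambda>r. g' r *\<^sub>R \<phi> r (D r)) - h *\<^sub>R \<phi> (?m k) (D (?m k))) \<le> h * d"
          unfolding h_def using m n k
          by (intro cell_error continuous_on_subset[OF cont]) (auto simp: dist_norm)
        show "norm (h *\<^sub>R (\<phi> (?m k) (D (?m k)) - \<phi> (?m k) (euler \<phi> n k))) \<le> h * (L * norm (D (?m k) - euler \<phi> n k))"
          using lip[OF m(1)] h by (simp add: mult_left_mono)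
      qed
      also have "\<dots> = norm (D (?m k) - euler \<phi> n k) * (1 + L * h) + d * h" by (simp add: algebra_simps)
      also have "\<dots> \<le> (d * G * exp (L * G)) * exp (L * h) + d * h * exp (L * (G + h))"
      proof (rule add_mono, rule mult_mono)
        show "norm (D (?m k) - euler \<phi> n k) \<le> d * G * exp (L * G)"
          using Suc by (simp add: G_def)
        show "1 + L * h \<le> exp (L * h)" by (rule exp_ge_add_one_self)
        show "d * h \<le> d * h * exp (L * (G + h))"
          using mult_left_mono[of 1 "exp (L * (G + h))" "d * h"] d h L G by simp
      qed (use d G L h in auto)
      also have "\<dots> = d * (g (?m (Suc k)) - g 0) * exp (L * (g (?m (Suc k)) - g 0))"
        by (simp add: h_def G_def algebra_simps flip: exp_add)
      finally show ?case .
    qed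
    from this[of n] have "norm (D T - euler \<phi> n n) \<le> d * S"
      using n by (simp add: mesh_n S_def mult_ac)
    also have "\<dots> < e" unfolding d_def using shrunk_tolerance[OF e S] by (simp add: mult.commute)
    finally show "norm (euler \<phi> n n - D T) < e" by (simp add: norm_minus_commute)
  qed
qed

text \<open>With \<open>b\<^sub>t = \<integral>\<^sub>0\<^sup>t a dg\<close> and \<open>c = \<integral>\<^sub>0\<^sup>T F dg\<close> the hypothesis says \<open>a \<le> L b + c\<close>, so that
  \<open>(L b + c) exp (- L g)\<close> is nonincreasing.\<close>
lemma gronwall:
  fixes a F :: "real \<Rightarrow> real"
  assumes a: "continuous_on {0..T} a" and F: "continuous_on {0..T} F" "\<And>r. r \<in> {0..T} \<Longrightarrow> F r \<ge> 0"
    and bd: "\<And>t. t \<in> {0..T} \<Longrightarrow> a t \<le> integral {0..t} (\<lambda>r. g' r * (L * a r + F r))"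
    and L: "L \<ge> 0" and g0: "g 0 = 0"
  shows "a T \<le> exp (L * g T) * integral {0..T} (\<lambda>r. g' r * F r)"
proof -
  define c where "c = integral {0..T} (\<lambda>r. g' r * F r)"
  define b where "b t = integral {0..t} (\<lambda>r. g' r * a r)" for t
  have ic: "continuous_on {0..T} (\<lambda>r. g' r * a r)" "continuous_on {0..T} (\<lambda>r. g' r * F r)"
    by (intro continuous_intros cont' a F)+
  have le: "a t \<le> L * b t + c" if t: "t \<in> {0..T}" for t
  proof -
    have sub: "{0..t} \<subseteq> {0..T}" using t by auto
    note ii = integrable_continuous_real[OF continuous_on_subset[OF ic(1) sub]]
      integrable_continuous_real[OF continuous_on_subset[OF ic(2) sub]]
    have "a t \<le> integral {0..t} (\<lambda>r. L * (g' r * a r) + g' r * F r)"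
      using bd[OF t] by (simp add: algebra_simps)
    also have "\<dots> = L * b t + integral {0..t} (\<lambda>r. g' r * F r)"
      unfolding b_def using ii by (subst integral_add) (auto intro: integrable_on_mult_right)
    also have "integral {0..t} (\<lambda>r. g' r * F r) \<le> c"
      unfolding c_def using sub F nonneg' 
      by (intro integral_subset_le ii integrable_continuous_real ic) auto
    finally show ?thesis by simp
  qed
  have b': "(b has_real_derivative g' t * a t) (at t within {0..T})" if "t \<in> {0..T}" for t
    unfolding b_def has_real_derivative_iff_has_vector_derivative
    by (rule integral_has_vector_derivative[OF ic(1) that])
  define \<phi> where "\<phi> t = (L * b t + c) * exp (- L * g t)" for t
  have \<phi>': "(\<phi> has_real_derivative (L * (g' t * a t) - (L * g' t) * (L * b t + c)) * exp (- L * g t)) (at t within {0..T})"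
    if "t \<in> {0..T}" for t
    unfolding \<phi>_def
    by (rule derivative_eq_intros b'[OF that] deriv[OF that] refl)+ (simp add: algebra_simps)
  have "\<phi> T \<le> \<phi> 0"
  proof (cases "T = 0")
    case False
    show ?thesis
    proof (rule DERIV_nonpos_imp_decreasing_open[where f = \<phi> and a = 0 and b = T])
      show "continuous_on {0..T} \<phi>"
        using \<phi>' DERIV_continuous continuous_on_eq_continuous_within by blast
      fix x assume x: "0 < x" "x < T"
      have "(\<phi> has_real_derivative (L * (g' x * a x) - (L * g' x) * (L * b x + c)) * exp (- L * g x)) (at x)"
        using \<phi>'[of x] x at_within_Icc_at[of 0 x T] by simp
      moreover have "L * (g' x * a x) - (L * g' x) * (L * b x + c) \<le> 0"
        using mult_left_mono[OF le[of x], of "L * g' x"] nonneg'[of x] L x by (simp add: mult_ac)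
      ultimately show "\<exists>y. (\<phi> has_real_derivative y) (at x) \<and> y \<le> 0"
        by (meson exp_ge_zero mult_nonpos_nonneg)
    qed (use T_nonneg False in auto)
  qed simp
  hence "(L * b T + c) * exp (- L * g T) \<le> c" by (simp add: \<phi>_def b_def g0)
  hence "L * b T + c \<le> exp (L * g T) * c" by (simp add: exp_minus field_simps)
  thus ?thesis using le[of T] T_nonneg by (simp add: c_def)
qed

text \<open>Jensen's inequality for the measure \<open>dg\<close> on \<open>[0, T]\<close>, from the tangent to \<open>x\<^sup>p\<close> at the mean
  value \<open>c\<close>.\<close>
lemma integral_clock_powr_le:
  fixes F :: "real \<Rightarrow> real"
  assumes F: "continuous_on {0..T} F" "\<And>r. r \<in> {0..T} \<Longrightarrow> F r \<ge> 0" and p: "p > 1" and g0: "g 0 = 0" and gT: "g T > 0"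
  shows "integral {0..T} (\<lambda>r. g' r * F r) powr p \<le> g T powr (p - 1) * integral {0..T} (\<lambda>r. g' r * F r powr p)"
proof -
  define A where "A = integral {0..T} (\<lambda>r. g' r * F r)"
  define c where "c = A / g T"
  have Fp: "continuous_on {0..T} (\<lambda>r. F r powr p)"
    using F p by (intro continuous_on_powr' continuous_intros) auto
  have iA: "((\<lambda>r. g' r * F r) has_integral A) {0..T}"
    unfolding A_def by (intro integrable_integral integrable_continuous_real continuous_intros cont' F)
  have A: "A \<ge> 0" using iA by (rule has_integral_nonneg) (use F nonneg' in auto)
  hence c: "c \<ge> 0" using gT by (simp add: c_def)
  have i1: "((\<lambda>r. g' r * F r powr p) has_integral integral {0..T} (\<lambda>r. g' r * F r powr p)) {0..T}"
    by (intro integrable_integral integrable_continuous_real continuous_on_mult cont' Fp)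
  have i0: "(g' has_integral g T) {0..T}" using integral_clock[of 0 T] T_nonneg g0 by simp
  have "(p * c powr (p - 1)) * A - ((p - 1) * c powr p) * g T \<le> integral {0..T} (\<lambda>r. g' r * F r powr p)"
  proof (rule has_integral_le[OF _ i1])
    show "((\<lambda>r. (p * c powr (p - 1)) * (g' r * F r) - ((p - 1) * c powr p) * g' r) has_integral
        (p * c powr (p - 1)) * A - ((p - 1) * c powr p) * g T) {0..T}"
      by (intro has_integral_diff has_integral_mult_right iA i0)
    fix r assume r: "r \<in> {0..T}"
    have "p * (F r * c powr (p - 1)) - (p - 1) * c powr p \<le> F r powr p"
      using powr_tangent[OF p F(2)[OF r] c] by simp
    from mult_left_mono[OF this nonneg'[OF r]]
    show "(p * c powr (p - 1)) * (g' r * F r) - ((p - 1) * c powr p) * g' r \<le> g' r * F r powr p"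
      by (simp add: algebra_simps)
  qed
  moreover have "A = c * g T" using gT by (simp add: c_def)
  moreover have "c powr (p - 1) * c = c powr p" using c powr_mult_base[of c "p - 1"] by (simp add: mult.commute)
  moreover have "(p * c powr (p - 1)) * (c * g T) = p * (c powr (p - 1) * c) * g T" by (simp only: mult_ac)
  ultimately have "p * c powr p * g T - (p - 1) * c powr p * g T \<le> integral {0..T} (\<lambda>r. g' r * F r powr p)"
    by simp
  hence "c powr p * g T \<le> integral {0..T} (\<lambda>r. g' r * F r powr p)" by (simp add: left_diff_distrib)
  hence "g T powr (p - 1) * (c powr p * g T) \<le> g T powr (p - 1) * integral {0..T} (\<lambda>r. g' r * F r powr p)"
    by (intro mult_left_mono) auto
  moreover have "g T powr (p - 1) * (c powr p * g T) = A powr p"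
  proof -
    have "g T powr (p - 1) * g T = g T powr p" using gT powr_mult_base[of "g T" "p - 1"] by (simp add: mult.commute)
    thus ?thesis using c gT by (simp add: \<open>A = c * g T\<close> powr_mult mult_ac)
  qed
  ultimately show ?thesis by (simp add: A_def)
qed

end

section \<open>The schedule and the odds clock\<close>

context schedule
begin

lemma \<sigma>_eq: "t \<in> {0..1} \<Longrightarrow> \<sigma> t = 1 - \<beta> t"
  using sum_1[of t] by simp

lemma \<beta>_cont: "continuous_on {0..1} \<beta>" and \<sigma>_cont: "continuous_on {0..1} \<sigma>"
  using \<beta>_deriv \<sigma>_deriv DERIV_continuous continuous_on_eq_continuous_within by blast+

lemma \<sigma>'_eq: 
  assumes "t \<in> {0..1}" shows "\<sigma>' t = - \<beta>' t"
proof (rule vector_derivative_unique_within_closed_interval[where a = 0 and b = "1::real" and x = t])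
  show "(\<sigma> has_vector_derivative \<sigma>' t) (at t within cbox 0 1)"
    using \<sigma>_deriv[OF assms] by (simp add: has_real_derivative_iff_has_vector_derivative)
  have "((\<lambda>t. 1 - \<beta> t) has_real_derivative - \<beta>' t) (at t within {0..1})"
    by (rule derivative_eq_intros \<beta>_deriv[OF assms] refl)+ simp
  hence "(\<sigma> has_real_derivative - \<beta>' t) (at t within {0..1})"
    unfolding has_real_derivative_iff_has_vector_derivative
    by (rule has_vector_derivative_transform[rotated 2]) (use assms \<sigma>_eq in auto)
  thus "(\<sigma> has_vector_derivative - \<beta>' t) (at t within cbox 0 1)"
    by (simp add: has_real_derivative_iff_has_vector_derivative)
qed (use assms in auto)

lemma \<beta>'_nonneg:
  assumes "t \<in> {0..1}" shows "\<beta>' t \<ge> 0"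
proof -
  have "closure {0<..<1} = {0..1::real}" by simp
  thus ?thesis
    using continuous_ge_on_closure[of "{0<..<1::real}" \<beta>' t 0] \<beta>'_cont assms \<beta>'_pos by (simp add: less_imp_le)
qed

lemma \<beta>_strict_mono:
  assumes "0 \<le> a" "a < b" "b \<le> 1" shows "\<beta> a < \<beta> b"
proof (rule DERIV_pos_imp_increasing_open[where f = \<beta>, OF assms(2)])
  show "continuous_on {a..b} \<beta>" by (rule continuous_on_subset[OF \<beta>_cont]) (use assms in auto)
  fix x assume x: "a < x" "x < b"
  have "(\<beta> has_real_derivative \<beta>' x) (at x)"
    using \<beta>_deriv[of x] x assms at_within_Icc_at[of 0 x 1] by simp
  thus "\<exists>y. (\<beta> has_real_derivative y) (at x) \<and> 0 < y" using \<beta>'_pos[of x] x assms by auto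
qed

lemma \<sigma>_pos: "0 \<le> t \<Longrightarrow> t < 1 \<Longrightarrow> \<sigma> t > 0"
  using \<beta>_strict_mono[of t 1] \<beta>_1 \<sigma>_eq[of t] by simp

lemma \<sigma>_0: "\<sigma> 0 = 1" using \<sigma>_eq[of 0] \<beta>_0 by simp

lemma \<sigma>_antimono: "0 \<le> a \<Longrightarrow> a \<le> b \<Longrightarrow> b \<le> 1 \<Longrightarrow> \<sigma> b \<le> \<sigma> a"
  using \<beta>_strict_mono[of a b] \<sigma>_eq[of a] \<sigma>_eq[of b] by (cases "a = b") auto

lemma ell_ge: "\<epsilon> \<le> \<gamma> \<Longrightarrow> t \<in> {0..1} \<Longrightarrow> \<epsilon> \<le> ell t"
  unfolding ell_def using mult_right_mono[of \<epsilon> \<gamma> "\<sigma> t"] \<sigma>_range[of t] sum_1[of t]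
  by (metis add_left_mono atLeastAtMost_iff add.commute distrib_left mult.right_neutral)

lemma ell_pos:
  assumes "t \<in> {0..1}" shows "ell t > 0"
proof -
  have "\<sigma> t > 0 \<or> \<beta> t > 0" using sum_1[OF assms] by linarith
  thus ?thesis unfolding ell_def using \<beta>_range[OF assms] \<sigma>_range[OF assms] \<epsilon>_pos \<gamma>_pos
    by (auto intro: add_pos_nonneg add_nonneg_pos)
qed

text \<open>The new time: \<open>X\<^sub>t / \<sigma>\<^sub>t\<close> is, as a process of the time \<open>\<beta>\<^sub>t / \<sigma>\<^sub>t\<close>, a diffusion whose
  drift is the conditional mean alone. Since the two coefficients add up to 1 the derivative of
  the clock is \<open>\<beta>'\<^sub>t / \<sigma>\<^sub>t\<^sup>2\<close>.\<close>
definition odds :: "real \<Rightarrow> real" where "odds t = \<beta> t / \<sigma> t"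
definition odds' :: "real \<Rightarrow> real" where "odds' t = \<beta>' t / (\<sigma> t)\<^sup>2"

lemma inv_\<sigma>_eq: "0 \<le> t \<Longrightarrow> t < 1 \<Longrightarrow> 1 / \<sigma> t = 1 + odds t"
  using \<sigma>_pos[of t] sum_1[of t] by (simp add: odds_def field_simps)

lemma odds_0: "odds 0 = 0" by (simp add: odds_def \<beta>_0)

lemma odds_nonneg: "0 \<le> t \<Longrightarrow> t < 1 \<Longrightarrow> odds t \<ge> 0"
  using \<beta>_range[of t] \<sigma>_range[of t] by (simp add: odds_def)

lemma inv_\<sigma>_deriv:
  assumes T: "T < 1" and t: "t \<in> {0..T}"
  shows "((\<lambda>t. 1 / \<sigma> t) has_real_derivative odds' t) (at t within {0..T})"
proof -
  have s: "\<sigma> t > 0" using t T by (intro \<sigma>_pos) auto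
  have "(\<sigma> has_real_derivative \<sigma>' t) (at t within {0..T})"
    by (rule has_field_derivative_subset[OF \<sigma>_deriv]) (use t T in auto)
  from DERIV_inverse'[OF this] s show ?thesis
    using \<sigma>'_eq[of t] t T by (simp add: odds'_def divide_simps power2_eq_square)
qed

lemma smooth_clock_odds:
  assumes "0 \<le> T" "T < 1" shows "smooth_clock T odds odds'"
proof
  show "0 \<le> T" by fact
  show "(odds has_real_derivative odds' t) (at t within {0..T})" if t: "t \<in> {0..T}" for t
  proof -
    have "((\<lambda>t. 1 / \<sigma> t - 1) has_real_derivative odds' t) (at t within {0..T})"
      by (rule derivative_eq_intros inv_\<sigma>_deriv[OF assms(2) t] refl)+ simp
    thus ?thesis
      unfolding has_real_derivative_iff_has_vector_derivative
      by (rule has_vector_derivative_transform[rotated 2]) (use t assms inv_\<sigma>_eq in auto)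
  qed
  show "odds' t \<ge> 0" if "t \<in> {0..T}" for t
    using \<beta>'_nonneg[of t] that assms by (simp add: odds'_def)
  have "\<sigma> t \<noteq> 0" if "t \<in> {0..T}" for t using \<sigma>_pos[of t] that assms by auto
  thus "continuous_on {0..T} odds'" unfolding odds'_def
    by (intro continuous_intros continuous_on_subset[OF \<beta>'_cont] continuous_on_subset[OF \<sigma>_cont]) (use assms in auto)
qed

text \<open>Variation of constants: division by \<open>\<sigma>\<close> removes the linear part of the drift, and the
  integration by parts of the noise term \<open>I\<close> is exact, since \<open>x - I\<close> is continuously
  differentiable.\<close>
lemma variation_of_constants:
  fixes x I \<mu> :: "real \<Rightarrow> 'b::euclidean_space"
  assumes T: "0 \<le> T" "T < 1"
    and cont: "continuous_on {0..T} x" "continuous_on {0..T} I" "continuous_on {0..T} \<mu>"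
    and eq: "\<And>t. t \<in> {0..T} \<Longrightarrow> x t = x0 + integral {0..t} (\<lambda>r. (\<sigma>' r / \<sigma> r) *\<^sub>R (x r - \<mu> r)) + I t"
    and I0: "I 0 = 0"
  shows "(1 / \<sigma> T) *\<^sub>R x T = x0 + ((1 / \<sigma> T) *\<^sub>R I T - integral {0..T} (\<lambda>r. odds' r *\<^sub>R I r))
           + integral {0..T} (\<lambda>r. odds' r *\<^sub>R \<mu> r)"
proof -
  interpret smooth_clock T odds odds' by (rule smooth_clock_odds[OF T])
  define A where "A t = x t - I t" for t
  have s: "\<sigma> t > 0" if "t \<in> {0..T}" for t using that T by (intro \<sigma>_pos) auto
  have c: "continuous_on {0..T} (\<lambda>r. (\<sigma>' r / \<sigma> r) *\<^sub>R (x r - \<mu> r))"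
    using s by (intro continuous_intros cont continuous_on_subset[OF \<sigma>'_cont] continuous_on_subset[OF \<sigma>_cont])
      (use T in \<open>auto simp: less_imp_neq[symmetric]\<close>)
  have A': "(A has_vector_derivative (\<sigma>' t / \<sigma> t) *\<^sub>R (x t - \<mu> t)) (at t within {0..T})" if t: "t \<in> {0..T}" for t
  proof -
    have "((\<lambda>t. x0 + integral {0..t} (\<lambda>r. (\<sigma>' r / \<sigma> r) *\<^sub>R (x r - \<mu> r))) has_vector_derivative
       (\<sigma>' t / \<sigma> t) *\<^sub>R (x t - \<mu> t)) (at t within {0..T})"
      using has_vector_derivative_add[OF has_vector_derivative_const integral_has_vector_derivative[OF c t]] by simp
    thus ?thesis
      by (rule has_vector_derivative_transform[rotated 2]) (use t in \<open>auto simp: A_def eq\<close>)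
  qed
  have B': "((\<lambda>t. (1 / \<sigma> t) *\<^sub>R A t) has_vector_derivative odds' t *\<^sub>R (\<mu> t - I t)) (at t within {0..T})"
    if t: "t \<in> {0..T}" for t
  proof -
    have "((\<lambda>t. (1 / \<sigma> t) *\<^sub>R A t) has_vector_derivative
        (1 / \<sigma> t) *\<^sub>R ((\<sigma>' t / \<sigma> t) *\<^sub>R (x t - \<mu> t)) + odds' t *\<^sub>R A t) (at t within {0..T})"
      by (rule has_vector_derivative_scaleR[OF inv_\<sigma>_deriv[OF T(2) t] A'[OF t]])
    also have "(1 / \<sigma> t) *\<^sub>R ((\<sigma>' t / \<sigma> t) *\<^sub>R (x t - \<mu> t)) = - odds' t *\<^sub>R (x t - \<mu> t)"
      using \<sigma>'_eq[of t] t T by (simp add: odds'_def power2_eq_square)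
    also have "- odds' t *\<^sub>R (x t - \<mu> t) + odds' t *\<^sub>R A t = odds' t *\<^sub>R (\<mu> t - I t)"
      by (simp add: A_def algebra_simps)
    finally show ?thesis .
  qed
  have "((\<lambda>t. odds' t *\<^sub>R (\<mu> t - I t)) has_integral ((1 / \<sigma> T) *\<^sub>R A T - (1 / \<sigma> 0) *\<^sub>R A 0)) {0..T}"
    by (intro fundamental_theorem_of_calculus B' T)
  moreover have "((\<lambda>t. odds' t *\<^sub>R \<mu> t - odds' t *\<^sub>R I t) has_integral
     (integral {0..T} (\<lambda>r. odds' r *\<^sub>R \<mu> r) - integral {0..T} (\<lambda>r. odds' r *\<^sub>R I r))) {0..T}"
    by (intro has_integral_diff integrable_integral integrable_continuous_real continuous_intros cont cont')
  ultimately have "(1 / \<sigma> T) *\<^sub>R A T - A 0 = integral {0..T} (\<lambda>r. odds' r *\<^sub>R \<mu> r) - integral {0..T} (\<lambda>r. odds' r *\<^sub>R I r)"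
    by (simp add: \<sigma>_0 scaleR_diff_right has_integral_unique)
  moreover have "A 0 = x0" using eq[of 0] T I0 by (simp add: A_def)
  ultimately show ?thesis by (simp add: A_def algebra_simps)
qed

end

section \<open>Exponentially tilted means of a bounded random vector\<close>

lemma exp_le_quadratic:
  fixes x :: real assumes "x \<le> 1" shows "exp x \<le> 1 + x + x\<^sup>2"
proof (cases "x \<ge> 0")
  case True thus ?thesis using exp_bound[of x] assms by simp
next
  case False
  define f where "f y = 1 + y + y\<^sup>2 - exp y" for y :: real
  have "\<exists>d. (f has_real_derivative d) (at y) \<and> d \<le> 0" if y: "x < y" "y < 0" for y
  proof -
    have "(f has_real_derivative (1 + 2 * y - exp y)) (at y)"
      unfolding f_def by (auto intro!: derivative_eq_intros)
    moreover have "1 + 2 * y - exp y \<le> 0" using exp_ge_add_one_self[of y] y by linarith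
    ultimately show ?thesis by blast
  qed
  hence "f 0 \<le> f x" using False
    by (intro DERIV_nonpos_imp_decreasing_open[where f = f and a = x and b = 0])
       (auto simp: f_def intro!: continuous_intros)
  thus ?thesis by (simp add: f_def)
qed

locale bounded_vector = prob_space P
  for P :: "'p measure" and \<eta> :: "'p \<Rightarrow> 'a::euclidean_space" and K :: real +
  assumes rv [measurable]: "\<eta> \<in> borel_measurable P"
    and bounded: "AE \<omega> in P. norm (\<eta> \<omega>) \<le> K"
begin

lemma K_nonneg: "K \<ge> 0"
proof -
  have "\<exists>\<omega>\<in>space P. norm (\<eta> \<omega>) \<le> K" using bounded AE_contr by blast
  thus ?thesis by (meson norm_ge_zero order_trans)
qed

text \<open>Unnormalized densities of the tilted laws. Positivity everywhere keeps their total mass from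
  vanishing.\<close>
definition weight :: "('p \<Rightarrow> real) \<Rightarrow> bool" where
  "weight w \<longleftrightarrow> w \<in> borel_measurable P \<and> (\<exists>B. AE \<omega> in P. w \<omega> \<le> B) \<and> (\<forall>\<omega>. w \<omega> > 0)"

definition wmean :: "('p \<Rightarrow> real) \<Rightarrow> 'a" where
  "wmean w = (1 / expectation w) *\<^sub>R expectation (\<lambda>\<omega>. w \<omega> *\<^sub>R \<eta> \<omega>)"

lemma weight_rv: "weight w \<Longrightarrow> w \<in> borel_measurable P" by (simp add: weight_def)

lemma weight_integrable:
  fixes f :: "'p \<Rightarrow> 'b::euclidean_space"
  assumes w: "weight w" and [measurable]: "f \<in> borel_measurable P" and f: "AE \<omega> in P. norm (f \<omega>) \<le> C"
  shows "integrable P (\<lambda>\<omega>. w \<omega> *\<^sub>R f \<omega>)"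
proof -
  note [measurable] = weight_rv[OF w]
  obtain B where B: "AE \<omega> in P. w \<omega> \<le> B" and pos: "\<And>\<omega>. w \<omega> > 0" using w by (auto simp: weight_def)
  have "AE \<omega> in P. norm (w \<omega> *\<^sub>R f \<omega>) \<le> B * C"
    using B f
  proof eventually_elim
    case (elim \<omega>)
    thus ?case using pos[of \<omega>] by (auto intro!: mult_mono order_trans[OF less_imp_le[OF pos] elim(1)])
  qed
  thus ?thesis by (intro integrable_const_bound) auto
qed

lemma weight_integrable_real:
  assumes w: "weight w" and "f \<in> borel_measurable P" and "AE \<omega> in P. \<bar>f \<omega>\<bar> \<le> C"
  shows "integrable P (\<lambda>\<omega>. w \<omega> * f \<omega>)"
  using weight_integrable[OF w, of f C] assms by simp

lemma weight_pos: assumes w: "weight w" shows "expectation w > 0"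
proof -
  have i: "integrable P w" using weight_integrable_real[OF w, of "\<lambda>_. 1" 1] by simp
  have "expectation w \<noteq> 0"
  proof
    assume "expectation w = 0"
    hence "AE \<omega> in P. w \<omega> = 0"
      using integral_nonneg_eq_0_iff_AE[OF i] w by (auto simp: weight_def less_imp_le)
    moreover have "AE \<omega> in P. w \<omega> \<noteq> 0" using w by (auto simp: weight_def less_imp_neq[symmetric])
    ultimately have "AE \<omega> in P. False" by eventually_elim auto
    thus False by simp
  qed
  moreover have "expectation w \<ge> 0" using w by (intro Bochner_Integration.integral_nonneg) (auto simp: weight_def less_imp_le)
  ultimately show ?thesis by simp
qed

lemma expectation_weight_mono:
  assumes w: "weight w" and [measurable]: "f \<in> borel_measurable P" and f: "AE \<omega> in P. \<bar>f \<omega>\<bar> \<le> C"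
    and le: "AE \<omega> in P. f \<omega> \<le> c"
  shows "expectation (\<lambda>\<omega>. w \<omega> * f \<omega>) \<le> expectation w * c"
proof -
  have "expectation (\<lambda>\<omega>. w \<omega> * f \<omega>) \<le> expectation (\<lambda>\<omega>. w \<omega> * c)"
  proof (rule integral_mono_AE)
    show "AE \<omega> in P. w \<omega> * f \<omega> \<le> w \<omega> * c" using le
      by eventually_elim (use w in \<open>auto simp: weight_def intro!: mult_left_mono less_imp_le\<close>)
  qed (use weight_integrable_real[OF w, of f C] weight_integrable_real[OF w, of "\<lambda>_. c" "\<bar>c\<bar>"] f in auto)
  thus ?thesis by simp
qed

lemma wmean_scale: "c \<noteq> 0 \<Longrightarrow> wmean (\<lambda>\<omega>. c * w \<omega>) = wmean w"
proof -
  assume c: "c \<noteq> 0"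
  have "expectation (\<lambda>\<omega>. (c * w \<omega>) *\<^sub>R \<eta> \<omega>) = c *\<^sub>R expectation (\<lambda>\<omega>. w \<omega> *\<^sub>R \<eta> \<omega>)"
    unfolding scaleR_scaleR[symmetric] by (rule integral_scaleR_right)
  thus ?thesis using c by (simp add: wmean_def)
qed

lemma wmean_inner:
  assumes w: "weight w"
  shows "expectation (\<lambda>\<omega>. w \<omega> * (e \<bullet> \<eta> \<omega>)) = expectation w * (e \<bullet> wmean w)"
proof -
  have "integrable P (\<lambda>\<omega>. w \<omega> *\<^sub>R \<eta> \<omega>)" using weight_integrable[OF w rv bounded] .
  hence "expectation (\<lambda>\<omega>. e \<bullet> (w \<omega> *\<^sub>R \<eta> \<omega>)) = e \<bullet> expectation (\<lambda>\<omega>. w \<omega> *\<^sub>R \<eta> \<omega>)"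
    by (intro integral_inner_right)
  thus ?thesis using weight_pos[OF w] by (simp add: wmean_def)
qed

lemma inner_bound: "AE \<omega> in P. \<bar>e \<bullet> \<eta> \<omega>\<bar> \<le> norm e * K"
  using bounded by eventually_elim (meson Cauchy_Schwarz_ineq2 mult_left_mono norm_ge_zero order_trans)

lemma norm_wmean:
  assumes w: "weight w" shows "norm (wmean w) \<le> K"
proof (cases "wmean w = 0")
  case False
  let ?e = "wmean w"
  have "expectation w * (?e \<bullet> ?e) \<le> expectation w * (norm ?e * K)"
    unfolding wmean_inner[OF w, symmetric]
    by (rule expectation_weight_mono[OF w _ inner_bound]) (use inner_bound[of ?e] in \<open>auto elim: eventually_mono\<close>)
  hence "norm ?e * norm ?e \<le> norm ?e * K" using weight_pos[OF w]
    by (simp add: power2_norm_eq_inner[symmetric] power2_eq_square)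
  thus ?thesis using False by simp
qed (use K_nonneg in simp)

lemma weight_tilt:
  assumes w: "weight w" shows "weight (\<lambda>\<omega>. w \<omega> * exp (h \<bullet> \<eta> \<omega>))"
proof -
  obtain B where B: "AE \<omega> in P. w \<omega> \<le> B" using w by (auto simp: weight_def)
  have "AE \<omega> in P. w \<omega> * exp (h \<bullet> \<eta> \<omega>) \<le> B * exp (norm h * K)"
    using B inner_bound[of h]
  proof eventually_elim
    case (elim \<omega>)
    have "w \<omega> \<ge> 0" using w by (auto simp: weight_def less_imp_le)
    thus ?case using elim by (intro mult_mono) auto
  qed
  thus ?thesis using w by (auto simp: weight_def)
qed

text \<open>The derivative of the tilted mean is the tilted covariance, which is at most \<open>K\<^sup>2\<close>. This is
  the finite-difference form of that fact, with an explicit second-order error.\<close>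
lemma wmean_tilt_local:
  assumes w: "weight w" and h: "norm h * K \<le> 1"
  shows "norm (wmean (\<lambda>\<omega>. w \<omega> * exp (h \<bullet> \<eta> \<omega>)) - wmean w)
           \<le> exp (K * norm h) * (K\<^sup>2 * norm h + 2 * K ^ 3 * (norm h)\<^sup>2)"
proof (cases "h = 0")
  case False
  define w' where "w' \<omega> = w \<omega> * exp (h \<bullet> \<eta> \<omega>)" for \<omega>
  have w': "weight w'" unfolding w'_def by (rule weight_tilt[OF w])
  note [measurable] = weight_rv[OF w] weight_rv[OF w']
  define e where "e = sgn (wmean w' - wmean w)"
  have e: "norm e \<le> 1" by (simp add: e_def norm_sgn)
  define c where "c = e \<bullet> wmean w"
  define R where "R = K\<^sup>2 * norm h + 2 * K ^ 3 * (norm h)\<^sup>2"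
  have R: "R \<ge> 0" using K_nonneg by (simp add: R_def)
  have hn: "norm h > 0" using False by simp
  have be: "AE \<omega> in P. \<bar>e \<bullet> \<eta> \<omega>\<bar> \<le> K"
    using inner_bound[of e] by eventually_elim (use mult_right_mono[OF e K_nonneg] in auto)
  have c: "\<bar>c\<bar> \<le> K"
    using Cauchy_Schwarz_ineq2[of e "wmean w"] mult_mono[OF e norm_wmean[OF w]] by (simp add: c_def)
  define a where "a \<omega> = e \<bullet> \<eta> \<omega> - c" for \<omega>
  define x where "x \<omega> = h \<bullet> \<eta> \<omega>" for \<omega>
  have [measurable]: "a \<in> borel_measurable P" "x \<in> borel_measurable P"
    unfolding a_def x_def by measurable
  have ba: "AE \<omega> in P. \<bar>a \<omega>\<bar> \<le> 2 * K" using be by eventually_elim (use c in \<open>auto simp: a_def\<close>)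
  have bx: "AE \<omega> in P. \<bar>x \<omega>\<bar> \<le> norm h * K" using inner_bound[of h] by (simp add: x_def)
  \<comment> \<open>the tilted variance of one coordinate is at most its second moment\<close>
  have va: "expectation (\<lambda>\<omega>. w \<omega> * (a \<omega>)\<^sup>2) \<le> expectation w * K\<^sup>2"
  proof -
    have b1: "AE \<omega> in P. \<bar>(e \<bullet> \<eta> \<omega>)\<^sup>2\<bar> \<le> K\<^sup>2"
      using be by eventually_elim (use K_nonneg in \<open>simp add: abs_le_square_iff[symmetric]\<close>)
    have "expectation (\<lambda>\<omega>. w \<omega> * (a \<omega>)\<^sup>2) = expectation (\<lambda>\<omega>. w \<omega> * (e \<bullet> \<eta> \<omega>)\<^sup>2 - (2 * c) * (w \<omega> * (e \<bullet> \<eta> \<omega>)) + c\<^sup>2 * (w \<omega> * 1))"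
      by (intro Bochner_Integration.integral_cong) (auto simp: a_def power2_eq_square algebra_simps)
    also have "\<dots> = expectation (\<lambda>\<omega>. w \<omega> * (e \<bullet> \<eta> \<omega>)\<^sup>2) - (2 * c) * (expectation w * c) + c\<^sup>2 * expectation w"
    proof -
      have "integrable P (\<lambda>\<omega>. w \<omega> * (e \<bullet> \<eta> \<omega>)\<^sup>2)" "integrable P (\<lambda>\<omega>. w \<omega> * (e \<bullet> \<eta> \<omega>))" "integrable P (\<lambda>\<omega>. w \<omega> * 1)"
        by (rule weight_integrable_real[OF w _ b1], measurable)
           (rule weight_integrable_real[OF w _ be], measurable, rule weight_integrable_real[OF w, of _ 1], auto)
      thus ?thesis using wmean_inner[OF w, of e] by (simp add: c_def)
    qed
    also have "\<dots> = expectation (\<lambda>\<omega>. w \<omega> * (e \<bullet> \<eta> \<omega>)\<^sup>2) - c\<^sup>2 * expectation w"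
      by (simp add: power2_eq_square algebra_simps)
    also have "\<dots> \<le> expectation (\<lambda>\<omega>. w \<omega> * (e \<bullet> \<eta> \<omega>)\<^sup>2)" using weight_pos[OF w] by simp
    also have "\<dots> \<le> expectation w * K\<^sup>2"
      by (rule expectation_weight_mono[OF w _ b1]) (use b1 in auto)
    finally show ?thesis .
  qed
  define q where "q \<omega> = norm h / 2 * (a \<omega>)\<^sup>2 + (K\<^sup>2 * norm h / 2 + 2 * K ^ 3 * (norm h)\<^sup>2)" for \<omega>
  have ptw: "AE \<omega> in P. a \<omega> * (exp (x \<omega>) - 1) \<le> q \<omega>"
    using ba bx
  proof eventually_elim
    case (elim \<omega>)
    have x2: "(x \<omega>)\<^sup>2 \<le> (norm h * K)\<^sup>2" using elim by (simp add: abs_le_square_iff[symmetric] K_nonneg)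
    have "\<bar>exp (x \<omega>) - 1 - x \<omega>\<bar> \<le> (x \<omega>)\<^sup>2"
    proof -
      have "exp (x \<omega>) \<le> 1 + x \<omega> + (x \<omega>)\<^sup>2" using exp_le_quadratic[of "x \<omega>"] elim h by auto
      moreover have "1 + x \<omega> \<le> exp (x \<omega>)" "0 \<le> (x \<omega>)\<^sup>2" by (rule exp_ge_add_one_self) simp
      ultimately show ?thesis unfolding abs_le_iff by linarith
    qed
    hence "\<bar>a \<omega>\<bar> * \<bar>exp (x \<omega>) - 1 - x \<omega>\<bar> \<le> (2 * K) * (norm h * K)\<^sup>2"
      using elim x2 by (intro mult_mono) (auto simp: K_nonneg)
    hence 1: "a \<omega> * (exp (x \<omega>) - 1 - x \<omega>) \<le> 2 * K ^ 3 * (norm h)\<^sup>2"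
      by (simp add: abs_mult[symmetric] power2_eq_square power3_eq_cube mult_ac)
    have "0 \<le> (norm h * a \<omega> - x \<omega>)\<^sup>2" by simp
    hence "2 * norm h * (a \<omega> * x \<omega>) \<le> (norm h)\<^sup>2 * (a \<omega>)\<^sup>2 + (norm h * K)\<^sup>2"
      using x2 by (simp add: power2_diff power_mult_distrib algebra_simps)
    hence "2 * norm h * (a \<omega> * x \<omega>) \<le> 2 * norm h * (norm h / 2 * (a \<omega>)\<^sup>2 + K\<^sup>2 * norm h / 2)"
      by (simp add: power2_eq_square algebra_simps)
    hence "a \<omega> * x \<omega> \<le> norm h / 2 * (a \<omega>)\<^sup>2 + K\<^sup>2 * norm h / 2" using hn by simp
    with 1 show ?case by (simp add: q_def algebra_simps)
  qed
  have bexp: "AE \<omega> in P. \<bar>a \<omega> * (exp (x \<omega>) - 1)\<bar> \<le> 2 * K * (exp (norm h * K) + 1)"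
    using ba bx
  proof eventually_elim
    case (elim \<omega>)
    have "\<bar>exp (x \<omega>) - 1\<bar> \<le> exp (x \<omega>) + 1" using exp_gt_zero[of "x \<omega>"] by linarith
    also have "\<dots> \<le> exp (norm h * K) + 1" using elim by simp
    finally show ?case using elim K_nonneg by (auto simp: abs_mult intro!: mult_mono)
  qed
  have ba2: "AE \<omega> in P. \<bar>(a \<omega>)\<^sup>2\<bar> \<le> (2 * K)\<^sup>2"
    using ba
  proof eventually_elim
    case (elim \<omega>)
    thus ?case using power_mono[of "\<bar>a \<omega>\<bar>" "2 * K" 2] by simp
  qed
  have i1: "integrable P (\<lambda>\<omega>. w \<omega> * (a \<omega> * (exp (x \<omega>) - 1)))" by (rule weight_integrable_real[OF w _ bexp]) measurable
  have i2: "integrable P (\<lambda>\<omega>. w \<omega> * a \<omega>)" by (rule weight_integrable_real[OF w _ ba]) measurable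
  have i3: "integrable P (\<lambda>\<omega>. w' \<omega> * (e \<bullet> \<eta> \<omega>))" by (rule weight_integrable_real[OF w' _ be]) measurable
  have i4: "integrable P w'" using weight_integrable_real[OF w', of "\<lambda>_. 1" 1] by simp
  have i5: "integrable P (\<lambda>\<omega>. w \<omega> * (a \<omega>)\<^sup>2)" by (rule weight_integrable_real[OF w _ ba2]) measurable
  have i6: "integrable P w" using weight_integrable_real[OF w, of "\<lambda>_. 1" 1] by simp
  have i7: "integrable P (\<lambda>\<omega>. w \<omega> * (e \<bullet> \<eta> \<omega>))" by (rule weight_integrable_real[OF w _ be]) measurable
  have a0: "expectation (\<lambda>\<omega>. w \<omega> * a \<omega>) = 0"
    using wmean_inner[OF w, of e] i6 i7 by (simp add: a_def right_diff_distrib c_def)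
  have "expectation w' * (e \<bullet> wmean w' - c) = expectation (\<lambda>\<omega>. w' \<omega> * (e \<bullet> \<eta> \<omega>) - w' \<omega> * c)"
    using wmean_inner[OF w', of e] i3 i4 by (simp add: right_diff_distrib)
  also have "\<dots> = expectation (\<lambda>\<omega>. w \<omega> * (a \<omega> * (exp (x \<omega>) - 1)) + w \<omega> * a \<omega>)"
    by (intro Bochner_Integration.integral_cong) (auto simp: w'_def a_def x_def algebra_simps)
  also have "\<dots> = expectation (\<lambda>\<omega>. w \<omega> * (a \<omega> * (exp (x \<omega>) - 1)))" using i1 i2 a0 by simp
  also have "\<dots> \<le> expectation (\<lambda>\<omega>. (norm h / 2) * (w \<omega> * (a \<omega>)\<^sup>2) + (K\<^sup>2 * norm h / 2 + 2 * K ^ 3 * (norm h)\<^sup>2) * w \<omega>)"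
  proof (rule integral_mono_AE[OF i1])
    show "AE \<omega> in P. w \<omega> * (a \<omega> * (exp (x \<omega>) - 1))
       \<le> (norm h / 2) * (w \<omega> * (a \<omega>)\<^sup>2) + (K\<^sup>2 * norm h / 2 + 2 * K ^ 3 * (norm h)\<^sup>2) * w \<omega>"
      using ptw
    proof eventually_elim
      case (elim \<omega>)
      have "w \<omega> > 0" using w by (simp add: weight_def)
      thus ?case using mult_left_mono[OF elim, of "w \<omega>"] by (simp add: q_def algebra_simps)
    qed
  qed (use i5 i6 in auto)
  also have "\<dots> = (norm h / 2) * expectation (\<lambda>\<omega>. w \<omega> * (a \<omega>)\<^sup>2) + (K\<^sup>2 * norm h / 2 + 2 * K ^ 3 * (norm h)\<^sup>2) * expectation w"
    using i5 i6 by simp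
  also have "\<dots> \<le> (norm h / 2) * (expectation w * K\<^sup>2) + (K\<^sup>2 * norm h / 2 + 2 * K ^ 3 * (norm h)\<^sup>2) * expectation w"
    by (rule add_mono[OF mult_left_mono[OF va] order_refl]) simp
  also have "\<dots> = expectation w * R" by (simp add: R_def field_simps)
  finally have main: "expectation w' * (e \<bullet> wmean w' - c) \<le> expectation w * R" .
  have ww': "expectation w \<le> expectation w' * exp (K * norm h)"
  proof -
    have "expectation w \<le> expectation (\<lambda>\<omega>. w' \<omega> * exp (K * norm h))"
    proof (rule integral_mono_AE)
      show "AE \<omega> in P. w \<omega> \<le> w' \<omega> * exp (K * norm h)"
        using bx
      proof eventually_elim
        case (elim \<omega>)
        have "1 \<le> exp (x \<omega> + K * norm h)" using elim by (simp add: mult.commute)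
        moreover have "w \<omega> > 0" using w by (simp add: weight_def)
        ultimately have "w \<omega> * 1 \<le> w \<omega> * exp (x \<omega> + K * norm h)" by (intro mult_left_mono) auto
        thus ?case by (simp add: w'_def x_def exp_add mult_ac)
      qed
    qed (use i4 i6 in auto)
    thus ?thesis by simp
  qed
  have "expectation w' * (e \<bullet> wmean w' - c) \<le> expectation w' * (exp (K * norm h) * R)"
    using main mult_right_mono[OF ww' R] by (simp add: mult_ac)
  hence "e \<bullet> wmean w' - c \<le> exp (K * norm h) * R" using weight_pos[OF w'] by simp
  moreover have "e \<bullet> wmean w' - c = norm (wmean w' - wmean w)"
  proof -
    define d where "d = wmean w' - wmean w"
    have "e \<bullet> wmean w' - c = sgn d \<bullet> d" by (simp add: c_def e_def d_def inner_diff_right)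
    also have "\<dots> = norm d" by (cases "d = 0") (simp_all add: sgn_div_norm dot_square_norm power2_eq_square)
    finally show ?thesis by (simp add: d_def)
  qed
  ultimately show ?thesis by (simp add: w'_def[abs_def] R_def)
qed simp

text \<open>Subdividing the segment removes the second-order error.\<close>
lemma wmean_tilt_lipschitz:
  assumes w: "weight w"
  shows "norm (wmean (\<lambda>\<omega>. w \<omega> * exp (h \<bullet> \<eta> \<omega>)) - wmean w) \<le> K\<^sup>2 * norm h"
proof -
  define v where "v n k = wmean (\<lambda>\<omega>. w \<omega> * exp (((real k / real n) *\<^sub>R h) \<bullet> \<eta> \<omega>))" for n k
  define B where "B n = exp (K * (norm h / real n)) * (K\<^sup>2 * norm h + 2 * K ^ 3 * (norm h)\<^sup>2 * (1 / real n))" for n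
  have "(\<lambda>n. norm h * K / real n) \<longlonglongrightarrow> 0" by (rule lim_const_over_n)
  hence "\<forall>\<^sub>F n in sequentially. norm h * K / real n < 1" using order_tendstoD(2) by fastforce
  hence ev: "\<forall>\<^sub>F n in sequentially. norm (wmean (\<lambda>\<omega>. w \<omega> * exp (h \<bullet> \<eta> \<omega>)) - wmean w) \<le> B n"
    using eventually_gt_at_top[of 0]
  proof eventually_elim
    case (elim n)
    have "norm (v n n - v n 0) = norm (\<Sum>k<n. v n (Suc k) - v n k)"
      by (simp add: sum_lessThan_telescope)
    also have "\<dots> \<le> (\<Sum>k<n. B n / real n)"
    proof (rule sum_norm_le)
      fix k
      define hn where "hn = (1 / real n) *\<^sub>R h"
      have "v n (Suc k) = wmean (\<lambda>\<omega>. (w \<omega> * exp (((real k / real n) *\<^sub>R h) \<bullet> \<eta> \<omega>)) * exp (hn \<bullet> \<eta> \<omega>))"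
        unfolding v_def hn_def by (simp add: mult.assoc add_divide_distrib algebra_simps flip: exp_add)
      moreover have "norm hn * K \<le> 1" using elim by (simp add: hn_def)
      ultimately have "norm (v n (Suc k) - v n k) \<le> exp (K * norm hn) * (K\<^sup>2 * norm hn + 2 * K ^ 3 * (norm hn)\<^sup>2)"
        using wmean_tilt_local[OF weight_tilt[OF w]] unfolding v_def by presburger
      also have "\<dots> = B n / real n" using elim
        by (simp add: B_def hn_def power2_eq_square field_simps)
      finally show "norm (v n (Suc k) - v n k) \<le> B n / real n" .
    qed
    also have "\<dots> = B n" using elim by simp
    finally show ?case using elim by (simp add: v_def)
  qed
  have "B \<longlonglongrightarrow> exp (K * 0) * (K\<^sup>2 * norm h + 2 * K ^ 3 * (norm h)\<^sup>2 * 0)"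
    unfolding B_def by (intro tendsto_intros lim_const_over_n lim_1_over_n)
  hence "B \<longlonglongrightarrow> K\<^sup>2 * norm h" by simp
  thus ?thesis using ev by (rule tendsto_lowerbound) simp
qed

end

section \<open>Both drifts in terms of tilted means\<close>

locale schedule_vector = schedule \<beta> \<beta>' \<sigma> \<sigma>' \<epsilon> \<gamma> + bounded_vector P \<eta> K
  for \<beta> \<beta>' \<sigma> \<sigma>' \<epsilon> \<gamma> and P :: "'p measure" and \<eta> :: "'p \<Rightarrow> 'a::euclidean_space" and K
begin

text \<open>The conditional mean of \<open>\<eta>\<close> given that the interpolant is at \<open>x\<close> at time \<open>t\<close>.\<close>
definition post_mean :: "real \<Rightarrow> 'a \<Rightarrow> 'a" where
  "post_mean t x = wmean (\<lambda>\<omega>. kern t x (\<eta> \<omega>))"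

lemma ell_\<sigma>_pos: "t \<in> {0..<1} \<Longrightarrow> ell t * \<sigma> t > 0"
  using ell_pos[of t] \<sigma>_pos[of t] by simp

lemma kern_pos: "kern t x y > 0" by (simp add: kern_def)

lemma kern_le_1: "t \<in> {0..<1} \<Longrightarrow> kern t x y \<le> 1"
proof -
  assume "t \<in> {0..<1}"
  hence "0 \<le> (norm (x - \<beta> t *\<^sub>R y))\<^sup>2 / (2 * (ell t * \<sigma> t))"
    using ell_\<sigma>_pos[of t] by (intro divide_nonneg_nonneg) auto
  thus ?thesis by (simp add: kern_def mult.assoc)
qed

lemma kern_rv [measurable]: "(\<lambda>\<omega>. kern t x (\<eta> \<omega>)) \<in> borel_measurable P"
  unfolding kern_def by measurable

lemma weight_kern: "t \<in> {0..<1} \<Longrightarrow> weight (\<lambda>\<omega>. kern t x (\<eta> \<omega>))"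
  unfolding weight_def using kern_le_1[of t x] kern_pos by (auto intro!: exI[of _ 1])

lemma drift_eq:
  assumes t: "t \<in> {0..<1}"
  shows "drift P \<eta> t x = (\<sigma>' t / \<sigma> t) *\<^sub>R (x - post_mean t x)"
proof -
  let ?k = "\<lambda>\<omega>. kern t x (\<eta> \<omega>)"
  note w = weight_kern[OF t, of x]
  have i: "integrable P (\<lambda>\<omega>. ?k \<omega> *\<^sub>R \<eta> \<omega>)" by (rule weight_integrable[OF w rv bounded])
  have i1: "integrable P ?k" using weight_integrable_real[OF w, of "\<lambda>_. 1" 1] by simp
  hence i2: "integrable P (\<lambda>\<omega>. ?k \<omega> *\<^sub>R x)" by simp
  have "expectation (\<lambda>\<omega>. ?k \<omega> *\<^sub>R (x - \<eta> \<omega>)) = expectation ?k *\<^sub>R x - expectation (\<lambda>\<omega>. ?k \<omega> *\<^sub>R \<eta> \<omega>)"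
    using i i1 i2 by (simp add: scaleR_diff_right)
  also have "expectation (\<lambda>\<omega>. ?k \<omega> *\<^sub>R \<eta> \<omega>) = expectation ?k *\<^sub>R post_mean t x"
    using weight_pos[OF w] by (simp add: post_mean_def wmean_def)
  finally show ?thesis
    using weight_pos[OF w] by (simp add: drift_def flip: scaleR_diff_right)
qed

lemma norm_post_mean: "t \<in> {0..<1} \<Longrightarrow> norm (post_mean t x) \<le> K"
  unfolding post_mean_def by (intro norm_wmean weight_kern)

text \<open>Moving \<open>x\<close> tilts the weight, up to a factor that does not depend on \<open>\<eta>\<close>.\<close>
lemma kern_shift:
  assumes t: "t \<in> {0..<1}"
  shows "kern t y z = exp (((norm x)\<^sup>2 - (norm y)\<^sup>2) / (2 * ell t * \<sigma> t))
           * (kern t x z * exp (((\<beta> t / (ell t * \<sigma> t)) *\<^sub>R (y - x)) \<bullet> z))"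
proof -
  define s where "s = ell t * \<sigma> t"
  have s: "s > 0" using ell_\<sigma>_pos[OF t] by (simp add: s_def)
  have e: "(norm (x - \<beta> t *\<^sub>R z))\<^sup>2 = (norm x)\<^sup>2 - 2 * \<beta> t * (x \<bullet> z) + (\<beta> t)\<^sup>2 * (norm z)\<^sup>2" for x
    by (simp add: power2_norm_eq_inner inner_diff algebra_simps inner_commute power2_eq_square[of "\<beta> t"])
  have "- (norm (y - \<beta> t *\<^sub>R z))\<^sup>2 / (2 * s) = ((norm x)\<^sup>2 - (norm y)\<^sup>2) / (2 * s)
      + (- (norm (x - \<beta> t *\<^sub>R z))\<^sup>2 / (2 * s) + ((\<beta> t / s) *\<^sub>R (y - x)) \<bullet> z)"
    using s by (simp add: e inner_diff_left field_simps)
  moreover have "kern t x z = exp (- (norm (x - \<beta> t *\<^sub>R z))\<^sup>2 / (2 * s))" for x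
    by (simp add: kern_def s_def mult.assoc)
  moreover have "2 * ell t * \<sigma> t = 2 * s" by (simp add: s_def)
  ultimately show ?thesis unfolding s_def[symmetric] by (simp only: exp_add[symmetric])
qed

lemma post_mean_lipschitz:
  assumes t: "t \<in> {0..<1}"
  shows "norm (post_mean t y - post_mean t x) \<le> K\<^sup>2 * (\<beta> t / (ell t * \<sigma> t)) * norm (y - x)"
proof -
  define h where "h = (\<beta> t / (ell t * \<sigma> t)) *\<^sub>R (y - x)"
  have "post_mean t y = wmean (\<lambda>\<omega>. kern t x (\<eta> \<omega>) * exp (h \<bullet> \<eta> \<omega>))"
    unfolding post_mean_def kern_shift[OF t, of y _ x] h_def by (rule wmean_scale) simp
  hence "norm (post_mean t y - post_mean t x) \<le> K\<^sup>2 * norm h"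
    using wmean_tilt_lipschitz[OF weight_kern[OF t, of x], of h] by (simp add: post_mean_def)
  thus ?thesis using ell_\<sigma>_pos[OF t] \<beta>_range[of t] t by (simp add: h_def abs_of_nonneg)
qed

lemma post_mean_cont: "t \<in> {0..<1} \<Longrightarrow> continuous_on UNIV (post_mean t)"
proof (rule lipschitz_on_continuous_on[where X = UNIV and L = "K\<^sup>2 * (\<beta> t / (ell t * \<sigma> t))"])
  assume t: "t \<in> {0..<1}"
  show "(K\<^sup>2 * (\<beta> t / (ell t * \<sigma> t)))-lipschitz_on UNIV (post_mean t)"
    using post_mean_lipschitz[OF t] ell_\<sigma>_pos[OF t] \<beta>_range[of t] t
    by (intro lipschitz_onI) (auto simp: dist_norm)
qed

lemma post_mean_path_cont:
  assumes T: "T < 1" and x: "continuous_on {0..T} x"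
  shows "continuous_on {0..T} (\<lambda>r. post_mean r (x r))"
proof (rule continuous_on_sequentiallyI)
  fix u a assume u: "\<forall>n. u n \<in> {0..T}" and a: "a \<in> {0..T}" and lim: "u \<longlonglongrightarrow> a"
  have s: "r \<in> {0..<1}" if "r \<in> {0..T}" for r using that T by auto
  have cs: "continuous_on {0..T} \<beta>" "continuous_on {0..T} \<sigma>"
    by (rule continuous_on_subset[OF \<beta>_cont] continuous_on_subset[OF \<sigma>_cont], use T in auto)+
  have k: "(\<lambda>n. kern (u n) (x (u n)) z) \<longlonglongrightarrow> kern a (x a) z" for z
  proof -
    have nz: "2 * (\<epsilon> * \<beta> r + \<gamma> * \<sigma> r) * \<sigma> r \<noteq> 0" if "r \<in> {0..T}" for r
      using ell_\<sigma>_pos[OF s[OF that]] unfolding ell_def mult.assoc by linarith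
    have "continuous_on {0..T} (\<lambda>r. kern r (x r) z)"
      unfolding kern_def ell_def by (intro continuous_intros cs x ballI nz)
    thus ?thesis using u a lim by (auto simp: continuous_on_sequentially o_def)
  qed
  have 1: "(\<lambda>n. expectation (\<lambda>\<omega>. kern (u n) (x (u n)) (\<eta> \<omega>))) \<longlonglongrightarrow> expectation (\<lambda>\<omega>. kern a (x a) (\<eta> \<omega>))"
  proof (rule integral_dominated_convergence[where w = "\<lambda>_. 1"])
    show "AE \<omega> in P. norm (kern (u n) (x (u n)) (\<eta> \<omega>)) \<le> 1" for n
      using kern_le_1[OF s, of "u n"] u by (intro AE_I2) (simp add: abs_of_pos[OF kern_pos])
  qed (auto simp: k)
  have 2: "(\<lambda>n. expectation (\<lambda>\<omega>. kern (u n) (x (u n)) (\<eta> \<omega>) *\<^sub>R \<eta> \<omega>)) \<longlonglongrightarrow> expectation (\<lambda>\<omega>. kern a (x a) (\<eta> \<omega>) *\<^sub>R \<eta> \<omega>)"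
  proof (rule integral_dominated_convergence[where w = "\<lambda>_. K"])
    show "AE \<omega> in P. norm (kern (u n) (x (u n)) (\<eta> \<omega>) *\<^sub>R \<eta> \<omega>) \<le> K" for n
      using bounded
    proof eventually_elim
      case (elim \<omega>)
      have "kern (u n) (x (u n)) (\<eta> \<omega>) * norm (\<eta> \<omega>) \<le> 1 * K"
        using elim kern_le_1[of "u n"] s u kern_pos K_nonneg by (intro mult_mono) auto
      thus ?case using kern_pos[of "u n" "x (u n)" "\<eta> \<omega>"] by simp
    qed
  qed (auto intro!: tendsto_intros k)
  show "(\<lambda>n. post_mean (u n) (x (u n))) \<longlonglongrightarrow> post_mean a (x a)"
    unfolding post_mean_def wmean_def
    using weight_pos[OF weight_kern[OF s[OF a], of "x a"]] by (intro tendsto_intros 1 2) simp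
qed

end

text \<open>The empirical drift is the drift of the uniform law on the sample, so everything proved for
  conditional means applies to it as well.\<close>
lemma (in schedule) schedule_vector_sample:
  fixes y :: "nat \<Rightarrow> 'b::euclidean_space"
  assumes "N \<ge> 1" "\<And>i. i \<in> {1..N} \<Longrightarrow> norm (y i) \<le> K"
  shows "schedule_vector \<beta> \<beta>' \<sigma> \<sigma>' \<epsilon> \<gamma> (measure_pmf (pmf_of_set {1..N})) y K"
proof -
  have "set_pmf (pmf_of_set {1..N}) = {1..N}" using assms by (intro set_pmf_of_set) auto
  thus ?thesis using assms
    by unfold_locales (auto simp: AE_measure_pmf_iff)
qed

lemma integral_uniform_sample:
  fixes f :: "nat \<Rightarrow> 'b::euclidean_space"
  assumes "N \<ge> (1::nat)"
  shows "(LINT i|measure_pmf (pmf_of_set {1..N}). f i) = (1 / real N) *\<^sub>R (\<Sum>i=1..N. f i)"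
  using assms by (subst integral_measure_pmf[where A = "{1..N}"])
    (auto simp: set_pmf_of_set scaleR_sum_right)

lemma (in schedule) empirical_drift_eq:
  fixes y :: "nat \<Rightarrow> 'b::euclidean_space"
  assumes "N \<ge> 1"
  shows "empirical_drift N y t x = drift (measure_pmf (pmf_of_set {1..N})) y t x"
  unfolding empirical_drift_def drift_def
  unfolding integral_uniform_sample[OF assms] using assms by simp

context schedule
begin

definition emp_mean :: "nat \<Rightarrow> (nat \<Rightarrow> 'b::euclidean_space) \<Rightarrow> real \<Rightarrow> 'b \<Rightarrow> 'b" where
  "emp_mean N y t x = (1 / (\<Sum>i=1..N. kern t x (y i))) *\<^sub>R (\<Sum>i=1..N. kern t x (y i) *\<^sub>R y i)"

context
  fixes N :: nat and y :: "nat \<Rightarrow> 'b::euclidean_space" and K :: real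
  assumes N: "N \<ge> 1" and y: "\<And>i. i \<in> {1..N} \<Longrightarrow> norm (y i) \<le> K"
begin

interpretation S: schedule_vector \<beta> \<beta>' \<sigma> \<sigma>' \<epsilon> \<gamma> "measure_pmf (pmf_of_set {1..N})" y K
  by (rule schedule_vector_sample[OF N y])

lemma emp_mean_eq: "emp_mean N y t x = S.post_mean t x"
  unfolding S.post_mean_def S.wmean_def emp_mean_def integral_uniform_sample[OF N] using N by simp

lemma emp_drift_eq:
  "t \<in> {0..<1} \<Longrightarrow> empirical_drift N y t x = (\<sigma>' t / \<sigma> t) *\<^sub>R (x - emp_mean N y t x)"
  unfolding emp_mean_eq empirical_drift_eq[OF N] by (rule S.drift_eq)

lemma norm_emp_mean: "t \<in> {0..<1} \<Longrightarrow> norm (emp_mean N y t x) \<le> K"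
  unfolding emp_mean_eq by (rule S.norm_post_mean)

lemma emp_mean_lipschitz: "t \<in> {0..<1} \<Longrightarrow>
    norm (emp_mean N y t x' - emp_mean N y t x) \<le> K\<^sup>2 * (\<beta> t / (ell t * \<sigma> t)) * norm (x' - x)"
  unfolding emp_mean_eq by (rule S.post_mean_lipschitz)

lemma emp_mean_path_cont:
  "T < 1 \<Longrightarrow> continuous_on {0..T} x \<Longrightarrow> continuous_on {0..T} (\<lambda>r. emp_mean N y r (x r))"
  unfolding emp_mean_eq by (rule S.post_mean_path_cont)

end

end

section \<open>Exponential moments of Wiener integrals\<close>

lemma gaussian_density_tilt:
  fixes z x :: "'a::euclidean_space"
  assumes v: "v > 0"
  shows "gaussian_density v x * exp (z \<bullet> x) = exp ((norm z)\<^sup>2 * v / 2) * gaussian_density v (x - v *\<^sub>R z)"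
proof -
  have "(norm (x - v *\<^sub>R z))\<^sup>2 = (norm x)\<^sup>2 - 2 * v * (z \<bullet> x) + v * v * (norm z)\<^sup>2"
    by (simp add: power2_norm_eq_inner inner_diff algebra_simps inner_commute)
  hence "- (norm x)\<^sup>2 / (2 * v) + z \<bullet> x = (norm z)\<^sup>2 * v / 2 + - (norm (x - v *\<^sub>R z))\<^sup>2 / (2 * v)"
    using v by (simp add: field_simps)
  thus ?thesis by (simp add: gaussian_density_def flip: exp_add)
qed

lemma (in prob_space) isotropic_gaussian_mgf:
  fixes Z :: "'a \<Rightarrow> 'b::euclidean_space"
  assumes Z: "isotropic_gaussian M v Z" and v: "v > 0"
  shows "(\<integral>\<^sup>+\<omega>. ennreal (exp (z \<bullet> Z \<omega>)) \<partial>M) = ennreal (exp ((norm z)\<^sup>2 * v / 2))"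
proof -
  let ?f = "gaussian_density v :: 'b \<Rightarrow> real"
  have D: "distributed M lborel Z (\<lambda>x. ennreal (?f x))" using Z by (simp add: isotropic_gaussian_def)
  have f0: "?f x \<ge> 0" for x using v by (simp add: gaussian_density_def)
  have [measurable]: "?f \<in> borel_measurable borel" unfolding gaussian_density_def by measurable
  have 1: "(\<integral>\<^sup>+x. ennreal (?f x) \<partial>lborel) = 1"
    using distributed_nn_integral[OF D, of "\<lambda>_. 1"] by (simp add: emeasure_space_1)
  have "(\<integral>\<^sup>+\<omega>. ennreal (exp (z \<bullet> Z \<omega>)) \<partial>M) = (\<integral>\<^sup>+x. ennreal (?f x) * ennreal (exp (z \<bullet> x)) \<partial>lborel)"
    using distributed_nn_integral[OF D, of "\<lambda>x. ennreal (exp (z \<bullet> x))"] by simp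
  also have "\<dots> = (\<integral>\<^sup>+x. ennreal (exp ((norm z)\<^sup>2 * v / 2)) * ennreal (?f (x - v *\<^sub>R z)) \<partial>lborel)"
    using f0 by (intro nn_integral_cong) (simp add: gaussian_density_tilt[OF v] flip: ennreal_mult)
  also have "\<dots> = ennreal (exp ((norm z)\<^sup>2 * v / 2)) * (\<integral>\<^sup>+x. ennreal (?f (x - v *\<^sub>R z)) \<partial>lborel)"
    by (rule nn_integral_cmult) measurable
  also have "(\<integral>\<^sup>+x. ennreal (?f (x - v *\<^sub>R z)) \<partial>lborel)
      = (\<integral>\<^sup>+x. ennreal (?f (x - v *\<^sub>R z)) \<partial>distr lborel borel ((+) (v *\<^sub>R z)))"
    by (simp add: lborel_distr_plus)
  also have "\<dots> = 1" using 1 by (subst nn_integral_distr) auto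
  finally show ?thesis by simp
qed

lemma step_fun_simps: "step_fun [] s = 0"
    "step_fun ((c, a, b) # cs) s = c * indicator {a<..b} s + step_fun cs s"
    "step_fun (cs @ cs') s = step_fun cs s + step_fun cs' s"
    "step_integral W [] \<omega> = 0"
    "step_integral W ((c, a, b) # cs) \<omega> = c *\<^sub>R (W b \<omega> - W a \<omega>) + step_integral W cs \<omega>"
    "step_integral W (cs @ cs') \<omega> = step_integral W cs \<omega> + step_integral W cs' \<omega>"
  by (simp_all add: step_fun_def step_integral_def)

definition steps_in :: "real \<Rightarrow> (real \<times> real \<times> real) list \<Rightarrow> bool" where
  "steps_in t cs \<longleftrightarrow> (\<forall>(c, a, b)\<in>set cs. 0 \<le> a \<and> a \<le> b \<and> b \<le> t)"

lemma steps_in_simps [simp]: "steps_in t []"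
    "steps_in t ((c, a, b) # cs) \<longleftrightarrow> 0 \<le> a \<and> a \<le> b \<and> b \<le> t \<and> steps_in t cs"
    "steps_in t (cs @ cs') \<longleftrightarrow> steps_in t cs \<and> steps_in t cs'"
  by (simp_all add: steps_in_def ball_Un)

lemma step_fun_measurable [measurable]: "step_fun cs \<in> borel_measurable borel"
proof (induction cs)
  case (Cons x cs)
  obtain c a b where x: "x = (c, a, b)" by (cases x) auto
  note [measurable] = Cons
  have "step_fun (x # cs) = (\<lambda>s. c * indicator {a<..b} s + step_fun cs s)"
    by (auto simp: x step_fun_simps)
  thus ?case by simp
qed (simp add: step_fun_simps[abs_def])

text \<open>Overlapping steps are resolved on the grid of all their end points; on each cell of it the
  step function is constant.\<close>
lemma step_grid:
  fixes W :: "real \<Rightarrow> 'w \<Rightarrow> 'a::euclidean_space"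
  assumes t: "t \<ge> 0" and cs: "steps_in t cs"
  obtains n :: nat and \<tau> :: "nat \<Rightarrow> real"
  where "0 \<le> \<tau> 0" "\<tau> n \<le> t" "\<And>i. i < n \<Longrightarrow> \<tau> i \<le> \<tau> (Suc i)"
    "\<And>\<omega>. step_integral W cs \<omega> = (\<Sum>k<n. step_fun cs (\<tau> (Suc k)) *\<^sub>R (W (\<tau> (Suc k)) \<omega> - W (\<tau> k) \<omega>))"
    "\<And>k s. k < n \<Longrightarrow> s \<in> {\<tau> k<..\<tau> (Suc k)} \<Longrightarrow> step_fun cs s = step_fun cs (\<tau> (Suc k))"
proof -
  define Q where "Q = insert 0 ((\<lambda>(c, a, b). a) ` set cs \<union> (\<lambda>(c, a, b). b) ` set cs)"
  have finQ: "finite Q" by (simp add: Q_def)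
  have Qt: "Q \<subseteq> {0..t}" using cs t by (force simp: Q_def steps_in_def)
  define xs where "xs = sorted_list_of_set Q"
  define n where "n = length xs - 1"
  define \<tau> where "\<tau> k = xs ! k" for k
  have set_xs: "set xs = Q" using finQ by (simp add: xs_def)
  have len: "length xs = Suc n" using set_xs by (cases xs) (auto simp: n_def Q_def)
  have strict: "\<tau> i < \<tau> j" if "i < j" "j \<le> n" for i j
    using sorted_wrt_nth_less[of "(<)" xs i j] that len by (simp add: \<tau>_def xs_def)
  have mono: "\<tau> i \<le> \<tau> j" if "i \<le> j" "j \<le> n" for i j
    using strict[of i j] that by (cases "i = j") auto
  have order_iff: "\<tau> i < \<tau> j \<longleftrightarrow> i < j" if "i \<le> n" "j \<le> n" for i j
    using strict[of i j] mono[of j i] that by (cases "i < j") auto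
  have mem: "\<tau> i \<in> Q" if "i \<le> n" for i using that len set_xs nth_mem[of i xs] by (auto simp: \<tau>_def)
  have ex: "\<exists>i\<le>n. \<tau> i = q" if "q \<in> Q" for q
    using that len set_xs in_set_conv_nth[of q xs] by (auto simp: \<tau>_def less_Suc_eq_le)
  have main: "(\<forall>\<omega>. step_integral W ds \<omega> = (\<Sum>k<n. step_fun ds (\<tau> (Suc k)) *\<^sub>R (W (\<tau> (Suc k)) \<omega> - W (\<tau> k) \<omega>)))
     \<and> (\<forall>k<n. \<forall>s\<in>{\<tau> k<..\<tau> (Suc k)}. step_fun ds s = step_fun ds (\<tau> (Suc k)))"
    if "set ds \<subseteq> set cs" for ds
    using that
  proof (induction ds)
    case (Cons x ds)
    obtain c a b where x: "x = (c, a, b)" by (cases x) auto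
    have "a \<in> Q" "b \<in> Q" using Cons.prems x by (force simp: Q_def)+
    then obtain i j where ij: "i \<le> n" "\<tau> i = a" "j \<le> n" "\<tau> j = b" using ex by metis
    have "a \<le> b" using cs Cons.prems x by (auto simp: steps_in_def)
    hence le: "i \<le> j" using strict[of j i] ij by force
    have ind: "\<tau> (Suc k) \<in> {a<..b} \<longleftrightarrow> i \<le> k \<and> k < j" if "k < n" for k
      using that ij order_iff[of i "Suc k"] order_iff[of j "Suc k"] by (auto simp: not_less[symmetric])
    have ind': "s \<in> {a<..b} \<longleftrightarrow> i \<le> k \<and> k < j" if k: "k < n" and s: "s \<in> {\<tau> k<..\<tau> (Suc k)}" for k s
    proof -
      have "a < s \<longleftrightarrow> i \<le> k"
        using mono[of i k] mono[of "Suc k" i] k s ij by (cases "i \<le> k") (auto simp: not_le)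
      moreover have "s \<le> b \<longleftrightarrow> k < j"
        using mono[of "Suc k" j] mono[of j k] k s ij by (cases "k < j") (auto simp: not_less)
      ultimately show ?thesis by simp
    qed
    have W: "c *\<^sub>R (W b \<omega> - W a \<omega>) = (\<Sum>k<n. (c * indicator {a<..b} (\<tau> (Suc k))) *\<^sub>R (W (\<tau> (Suc k)) \<omega> - W (\<tau> k) \<omega>))" for \<omega>
    proof -
      have "(\<Sum>k<n. (c * indicator {a<..b} (\<tau> (Suc k))) *\<^sub>R (W (\<tau> (Suc k)) \<omega> - W (\<tau> k) \<omega>))
          = (\<Sum>k<n. if k \<in> {i..<j} then c *\<^sub>R (W (\<tau> (Suc k)) \<omega> - W (\<tau> k) \<omega>) else 0)"
        using ind by (intro sum.cong) (auto simp: indicator_def)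
      also have "\<dots> = (\<Sum>k\<in>{..<n} \<inter> {i..<j}. c *\<^sub>R (W (\<tau> (Suc k)) \<omega> - W (\<tau> k) \<omega>))"
        by (subst sum.inter_restrict) auto
      also have "{..<n} \<inter> {i..<j} = {i..<j}" using ij by auto
      also have "(\<Sum>k\<in>{i..<j}. c *\<^sub>R (W (\<tau> (Suc k)) \<omega> - W (\<tau> k) \<omega>)) = c *\<^sub>R (W b \<omega> - W a \<omega>)"
        using sum_Suc_diff'[OF le, of "\<lambda>k. W (\<tau> k) \<omega>"] ij by (simp add: scaleR_sum_right[symmetric])
      finally show ?thesis by simp
    qed
    have sub: "set ds \<subseteq> set cs" using Cons.prems by simp
    have IH: "\<And>\<omega>. step_integral W ds \<omega> = (\<Sum>k<n. step_fun ds (\<tau> (Suc k)) *\<^sub>R (W (\<tau> (Suc k)) \<omega> - W (\<tau> k) \<omega>))"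
      "\<And>k s. k < n \<Longrightarrow> s \<in> {\<tau> k<..\<tau> (Suc k)} \<Longrightarrow> step_fun ds s = step_fun ds (\<tau> (Suc k))"
      by (rule Cons.IH[OF sub, THEN conjunct1, rule_format], rule Cons.IH[OF sub, THEN conjunct2, rule_format])
    show ?case
    proof (intro conjI allI impI ballI)
      fix k s assume k: "k < n" "s \<in> {\<tau> k<..\<tau> (Suc k)}"
      have "(indicator {a<..b} s :: real) = indicator {a<..b} (\<tau> (Suc k))"
        using ind[OF k(1)] ind'[OF k] by (simp add: indicator_def)
      thus "step_fun (x # ds) s = step_fun (x # ds) (\<tau> (Suc k))"
        using IH(2)[OF k] by (simp add: x step_fun_simps)
    qed (simp add: x step_fun_simps W IH(1) scaleR_add_left sum.distrib)
  qed (simp add: step_fun_simps)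
  show ?thesis
  proof (rule that[of \<tau> n])
    show "0 \<le> \<tau> 0" "\<tau> n \<le> t" using mem[of 0] mem[of n] Qt by auto
    show "\<tau> i \<le> \<tau> (Suc i)" if "i < n" for i using that by (intro mono) auto
    show "step_integral W cs \<omega> = (\<Sum>k<n. step_fun cs (\<tau> (Suc k)) *\<^sub>R (W (\<tau> (Suc k)) \<omega> - W (\<tau> k) \<omega>))" for \<omega>
      by (rule main[OF order_refl, THEN conjunct1, rule_format])
    show "step_fun cs s = step_fun cs (\<tau> (Suc k))" if "k < n" "s \<in> {\<tau> k<..\<tau> (Suc k)}" for k s
      by (rule main[OF order_refl, THEN conjunct2, rule_format, OF that])
  qed
qed

lemma indicator_cells_le_1:
  fixes \<tau> :: "nat \<Rightarrow> real"
  assumes "\<And>i. i < n \<Longrightarrow> \<tau> i \<le> \<tau> (Suc i)"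
  shows "(\<Sum>k<n. indicator {\<tau> k<..\<tau> (Suc k)} s) = (indicator {\<tau> 0<..\<tau> n} s :: real) \<and> \<tau> 0 \<le> \<tau> n"
  using assms
proof (induction n)
  case (Suc n)
  have le: "\<tau> n \<le> \<tau> (Suc n)" using Suc.prems by simp
  have IH: "(\<Sum>k<n. indicator {\<tau> k<..\<tau> (Suc k)} s) = (indicator {\<tau> 0<..\<tau> n} s :: real)" "\<tau> 0 \<le> \<tau> n"
    using Suc by simp_all
  have "(\<Sum>k<Suc n. indicator {\<tau> k<..\<tau> (Suc k)} s) = (indicator {\<tau> 0<..\<tau> n} s + indicator {\<tau> n<..\<tau> (Suc n)} s :: real)"
    using IH by simp
  also have "\<dots> = indicator {\<tau> 0<..\<tau> (Suc n)} s" using IH(2) le by (auto simp: indicator_def)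
  finally show ?case using IH(2) le by simp
qed simp

locale brownian = prob_space M for M :: "'w measure" +
  fixes W :: "real \<Rightarrow> 'w \<Rightarrow> 'a::euclidean_space"
  assumes bm: "brownian_motion M W"
begin

lemma W_rv: "t \<ge> 0 \<Longrightarrow> W t \<in> borel_measurable M"
  using bm by (simp add: brownian_motion_def)

lemma step_integral_rv: "steps_in t cs \<Longrightarrow> step_integral W cs \<in> borel_measurable M"
proof (induction cs)
  case (Cons x cs)
  obtain c a b where x: "x = (c, a, b)" by (cases x) auto
  have [measurable]: "W a \<in> borel_measurable M" "W b \<in> borel_measurable M" "step_integral W cs \<in> borel_measurable M"
    using Cons x by (auto intro!: W_rv)
  have "step_integral W (x # cs) = (\<lambda>\<omega>. c *\<^sub>R (W b \<omega> - W a \<omega>) + step_integral W cs \<omega>)"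
    by (auto simp: x step_fun_simps)
  thus ?case by simp
qed (simp add: step_fun_simps[abs_def])

lemma increment_mgf:
  assumes "0 \<le> s" "s \<le> t"
  shows "(\<integral>\<^sup>+\<omega>. ennreal (exp (z \<bullet> (W t \<omega> - W s \<omega>))) \<partial>M) = ennreal (exp ((norm z)\<^sup>2 * (t - s) / 2))"
proof (cases "s = t")
  case False
  hence "isotropic_gaussian M (t - s) (\<lambda>\<omega>. W t \<omega> - W s \<omega>)" using bm assms by (auto simp: brownian_motion_def)
  thus ?thesis using False assms by (intro isotropic_gaussian_mgf) auto
qed (simp add: emeasure_space_1)

lemma grid_sum_mgf:
  assumes "0 \<le> \<tau> 0" "\<And>i. i < n \<Longrightarrow> \<tau> i \<le> \<tau> (Suc i)"
  shows "(\<integral>\<^sup>+\<omega>. ennreal (exp (z \<bullet> (\<Sum>k<n. f k *\<^sub>R (W (\<tau> (Suc k)) \<omega> - W (\<tau> k) \<omega>)))) \<partial>M)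
       = ennreal (exp ((norm z)\<^sup>2 / 2 * (\<Sum>k<n. (f k)\<^sup>2 * (\<tau> (Suc k) - \<tau> k))))"
proof -
  have ind: "indep_vars (\<lambda>_. borel) (\<lambda>i \<omega>. W (\<tau> (Suc i)) \<omega> - W (\<tau> i) \<omega>) {..<n}"
    using bm assms by (auto simp: brownian_motion_def)
  have nonneg: "0 \<le> \<tau> k" if "k \<le> n" for k
    using that
  proof (induction k)
    case (Suc k) thus ?case using assms(2)[of k] by simp
  qed (use assms in simp)
  define Y where "Y k \<omega> = ennreal (exp ((f k *\<^sub>R z) \<bullet> (W (\<tau> (Suc k)) \<omega> - W (\<tau> k) \<omega>)))" for k \<omega>
  have "indep_vars (\<lambda>_. borel) Y {..<n}"
    unfolding Y_def by (rule indep_vars_compose2[OF ind]) measurable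
  hence "(\<integral>\<^sup>+\<omega>. (\<Prod>k<n. Y k \<omega>) \<partial>M) = (\<Prod>k<n. \<integral>\<^sup>+\<omega>. Y k \<omega> \<partial>M)"
    by (intro indep_vars_nn_integral) auto
  also have "\<dots> = (\<Prod>k<n. ennreal (exp ((norm z)\<^sup>2 / 2 * ((f k)\<^sup>2 * (\<tau> (Suc k) - \<tau> k)))))"
  proof (rule prod.cong[OF refl])
    fix k assume "k \<in> {..<n}"
    hence "(\<integral>\<^sup>+\<omega>. Y k \<omega> \<partial>M) = ennreal (exp ((norm (f k *\<^sub>R z))\<^sup>2 * (\<tau> (Suc k) - \<tau> k) / 2))"
      unfolding Y_def using nonneg[of k] assms(2)[of k] by (intro increment_mgf) auto
    also have "(norm (f k *\<^sub>R z))\<^sup>2 * (\<tau> (Suc k) - \<tau> k) / 2 = (norm z)\<^sup>2 / 2 * ((f k)\<^sup>2 * (\<tau> (Suc k) - \<tau> k))"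
      by (simp add: power_mult_distrib)
    finally show "(\<integral>\<^sup>+\<omega>. Y k \<omega> \<partial>M) = ennreal (exp ((norm z)\<^sup>2 / 2 * ((f k)\<^sup>2 * (\<tau> (Suc k) - \<tau> k))))" .
  qed
  also have "\<dots> = ennreal (exp ((norm z)\<^sup>2 / 2 * (\<Sum>k<n. (f k)\<^sup>2 * (\<tau> (Suc k) - \<tau> k))))"
    by (simp add: prod_ennreal exp_sum[symmetric] sum_distrib_left)
  finally show ?thesis
    by (simp add: Y_def prod_ennreal exp_sum[symmetric] inner_sum_right)
qed

lemma step_integral_mgf:
  assumes t: "t \<ge> 0" and cs: "steps_in t cs"
    and G: "(\<integral>\<^sup>+s\<in>{0..t}. ennreal ((step_fun cs s)\<^sup>2) \<partial>lborel) \<le> ennreal G" "G \<ge> 0"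
  shows "(\<integral>\<^sup>+\<omega>. ennreal (exp (z \<bullet> step_integral W cs \<omega>)) \<partial>M) \<le> ennreal (exp ((norm z)\<^sup>2 / 2 * G))"
proof -
  obtain n \<tau> where g:
    "0 \<le> \<tau> 0" "\<tau> n \<le> t" "\<And>i. i < n \<Longrightarrow> \<tau> i \<le> \<tau> (Suc i)"
    "\<And>\<omega>. step_integral W cs \<omega> = (\<Sum>k<n. step_fun cs (\<tau> (Suc k)) *\<^sub>R (W (\<tau> (Suc k)) \<omega> - W (\<tau> k) \<omega>))"
    "\<And>k s. k < n \<Longrightarrow> s \<in> {\<tau> k<..\<tau> (Suc k)} \<Longrightarrow> step_fun cs s = step_fun cs (\<tau> (Suc k))"
    by (rule step_grid[OF t cs, of W]) (rule that)
  define F where "F k = (step_fun cs (\<tau> (Suc k)))\<^sup>2" for k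
  have le: "(\<Sum>k<n. F k * (\<tau> (Suc k) - \<tau> k)) \<le> G"
  proof -
    have "ennreal (\<Sum>k<n. F k * (\<tau> (Suc k) - \<tau> k)) = (\<Sum>k<n. ennreal (F k) * ennreal (\<tau> (Suc k) - \<tau> k))"
      using g(3) by (subst sum_ennreal[symmetric]) (auto simp: F_def ennreal_mult intro!: mult_nonneg_nonneg)
    also have "\<dots> = (\<Sum>k<n. \<integral>\<^sup>+s. ennreal (F k * indicator {\<tau> k<..\<tau> (Suc k)} s) \<partial>lborel)"
    proof (rule sum.cong[OF refl])
      fix k assume "k \<in> {..<n}"
      have "(\<integral>\<^sup>+s. ennreal (F k * indicator {\<tau> k<..\<tau> (Suc k)} s) \<partial>lborel)
          = (\<integral>\<^sup>+s. ennreal (F k) * indicator {\<tau> k<..\<tau> (Suc k)} s \<partial>lborel)"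
        by (intro nn_integral_cong) (auto simp: indicator_def)
      also have "\<dots> = ennreal (F k) * ennreal (\<tau> (Suc k) - \<tau> k)"
        using g(3)[of k] \<open>k \<in> {..<n}\<close> by (simp add: nn_integral_cmult_indicator)
      finally show "ennreal (F k) * ennreal (\<tau> (Suc k) - \<tau> k) = (\<integral>\<^sup>+s. ennreal (F k * indicator {\<tau> k<..\<tau> (Suc k)} s) \<partial>lborel)"
        by simp
    qed
    also have "\<dots> = (\<integral>\<^sup>+s. (\<Sum>k<n. ennreal (F k * indicator {\<tau> k<..\<tau> (Suc k)} s)) \<partial>lborel)"
      by (rule nn_integral_sum[symmetric]) measurable
    also have "\<dots> \<le> (\<integral>\<^sup>+s\<in>{0..t}. ennreal ((step_fun cs s)\<^sup>2) \<partial>lborel)"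
    proof (rule nn_integral_mono)
      fix s
      have "(\<Sum>k<n. F k * indicator {\<tau> k<..\<tau> (Suc k)} s) = (\<Sum>k<n. (step_fun cs s)\<^sup>2 * indicator {\<tau> k<..\<tau> (Suc k)} s)"
      proof (rule sum.cong[OF refl])
        fix k assume "k \<in> {..<n}"
        thus "F k * indicator {\<tau> k<..\<tau> (Suc k)} s = (step_fun cs s)\<^sup>2 * indicator {\<tau> k<..\<tau> (Suc k)} s"
          using g(5)[of k s] by (simp add: indicator_def F_def)
      qed
      also have "\<dots> = (step_fun cs s)\<^sup>2 * indicator {\<tau> 0<..\<tau> n} s"
        using indicator_cells_le_1[of n \<tau> s] g(3) by (simp add: sum_distrib_left[symmetric])
      also have "\<dots> \<le> (step_fun cs s)\<^sup>2 * indicator {0..t} s"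
        using g(1,2) by (auto simp: indicator_def)
      finally have "(\<Sum>k<n. F k * indicator {\<tau> k<..\<tau> (Suc k)} s) \<le> (step_fun cs s)\<^sup>2 * indicator {0..t} s" .
      hence "ennreal (\<Sum>k<n. F k * indicator {\<tau> k<..\<tau> (Suc k)} s) \<le> ennreal ((step_fun cs s)\<^sup>2 * indicator {0..t} s)"
        by (rule ennreal_leI)
      also have "\<dots> = ennreal ((step_fun cs s)\<^sup>2) * indicator {0..t} s" by (simp add: indicator_def)
      finally show "(\<Sum>k<n. ennreal (F k * indicator {\<tau> k<..\<tau> (Suc k)} s)) \<le> ennreal ((step_fun cs s)\<^sup>2) * indicator {0..t} s"
        by (subst sum_ennreal) (simp_all add: F_def)
    qed
    also have "\<dots> \<le> ennreal G" by fact
    finally show ?thesis using G(2) by simp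
  qed
  have "(\<integral>\<^sup>+\<omega>. ennreal (exp (z \<bullet> step_integral W cs \<omega>)) \<partial>M) = ennreal (exp ((norm z)\<^sup>2 / 2 * (\<Sum>k<n. F k * (\<tau> (Suc k) - \<tau> k))))"
    unfolding g(4) F_def by (rule grid_sum_mgf[OF g(1) g(3)])
  also have "\<dots> \<le> ennreal (exp ((norm z)\<^sup>2 / 2 * G))"
    using le by (intro ennreal_leI) (simp add: mult_left_mono)
  finally show ?thesis .
qed

end

text \<open>Truncation at 1 makes the squared distances integrable without changing their limits.\<close>
lemma (in prob_space) AE_convergent_subseq:
  fixes S :: "nat \<Rightarrow> 'a \<Rightarrow> 'b::euclidean_space"
  assumes [measurable]: "\<And>n. S n \<in> borel_measurable M" "J \<in> borel_measurable M"
    and lim: "(\<lambda>n. \<integral>\<^sup>+\<omega>. ennreal ((norm (S n \<omega> - J \<omega>))\<^sup>2) \<partial>M) \<longlonglongrightarrow> 0"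
  obtains r :: "nat \<Rightarrow> nat" where "strict_mono r" "AE \<omega> in M. (\<lambda>n. S (r n) \<omega>) \<longlonglongrightarrow> J \<omega>"
proof -
  define u where "u n \<omega> = min 1 ((norm (S n \<omega> - J \<omega>))\<^sup>2)" for n \<omega>
  have u: "0 \<le> u n \<omega>" "u n \<omega> \<le> 1" for n \<omega> by (auto simp: u_def)
  have [measurable]: "u n \<in> borel_measurable M" for n unfolding u_def by measurable
  have int: "integrable M (u n)" for n
    by (rule integrable_const_bound[where B = 1]) (use u in auto)
  have "(\<lambda>n. \<integral>\<^sup>+\<omega>. ennreal (u n \<omega>) \<partial>M) \<longlonglongrightarrow> 0"
    by (rule tendsto_sandwich[OF _ _ tendsto_const lim])
       (auto intro!: always_eventually nn_integral_mono ennreal_leI simp: u_def)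
  hence "(\<lambda>n. ennreal (\<integral>\<omega>. u n \<omega> \<partial>M)) \<longlonglongrightarrow> ennreal 0"
    using nn_integral_eq_integral[OF int] u by simp
  hence "(\<lambda>n. \<integral>\<omega>. u n \<omega> \<partial>M) \<longlonglongrightarrow> 0"
    by (subst (asm) tendsto_ennreal_iff) (use u in auto)
  hence "(\<lambda>n. \<integral>\<omega>. norm (u n \<omega>) \<partial>M) \<longlonglongrightarrow> 0" using u by simp
  from tendsto_L1_AE_subseq[OF int this] obtain r where
    r: "strict_mono r" "AE \<omega> in M. (\<lambda>n. u (r n) \<omega>) \<longlonglongrightarrow> 0" by auto
  have "AE \<omega> in M. (\<lambda>n. S (r n) \<omega>) \<longlonglongrightarrow> J \<omega>"
    using r(2)
  proof eventually_elim
    case (elim \<omega>)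
    have "\<forall>\<^sub>F n in sequentially. u (r n) \<omega> = (norm (S (r n) \<omega> - J \<omega>))\<^sup>2"
      using order_tendstoD(2)[OF elim, of 1] by (auto simp: u_def elim!: eventually_mono)
    hence "(\<lambda>n. (norm (S (r n) \<omega> - J \<omega>))\<^sup>2) \<longlonglongrightarrow> 0" using elim by (rule Lim_transform_eventually[rotated])
    hence "(\<lambda>n. sqrt ((norm (S (r n) \<omega> - J \<omega>))\<^sup>2)) \<longlonglongrightarrow> sqrt 0" by (rule tendsto_real_sqrt)
    hence "(\<lambda>n. norm (S (r n) \<omega> - J \<omega>)) \<longlonglongrightarrow> 0" by simp
    thus ?case by (simp add: tendsto_norm_zero_iff LIM_zero_iff)
  qed
  with r(1) show ?thesis by (rule that)
qed

lemma nn_integral_le_AE_limit: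
  fixes f :: "nat \<Rightarrow> 'b \<Rightarrow> ennreal"
  assumes "\<And>n. f n \<in> borel_measurable N" and lim: "AE x in N. (\<lambda>n. f n x) \<longlonglongrightarrow> g x"
    and le: "\<forall>\<^sub>F n in sequentially. (\<integral>\<^sup>+x. f n x \<partial>N) \<le> c"
  shows "(\<integral>\<^sup>+x. g x \<partial>N) \<le> c"
proof -
  have "(\<integral>\<^sup>+x. g x \<partial>N) = (\<integral>\<^sup>+x. liminf (\<lambda>n. f n x) \<partial>N)"
    using lim by (intro nn_integral_cong_AE) (auto elim!: eventually_mono simp: lim_imp_Liminf)
  also have "\<dots> \<le> liminf (\<lambda>n. \<integral>\<^sup>+x. f n x \<partial>N)" by (rule nn_integral_liminf) fact
  also have "\<dots> \<le> limsup (\<lambda>n. \<integral>\<^sup>+x. f n x \<partial>N)" by (rule Liminf_le_Limsup) simp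
  also have "\<dots> \<le> c" by (rule Limsup_bounded[OF le])
  finally show ?thesis .
qed

lemma nn_integral_square_sum_le:
  fixes f g :: "'b \<Rightarrow> 'c::euclidean_space"
  assumes [measurable]: "f \<in> borel_measurable N" "g \<in> borel_measurable N"
  shows "(\<integral>\<^sup>+x. ennreal ((norm (f x + g x))\<^sup>2) \<partial>N)
     \<le> 2 * (\<integral>\<^sup>+x. ennreal ((norm (f x))\<^sup>2) \<partial>N) + 2 * (\<integral>\<^sup>+x. ennreal ((norm (g x))\<^sup>2) \<partial>N)"
proof -
  have "(norm (a + b))\<^sup>2 \<le> 2 * (norm a)\<^sup>2 + 2 * (norm b)\<^sup>2" for a b :: 'c
  proof -
    have "(norm (a + b))\<^sup>2 \<le> (norm a + norm b)\<^sup>2" by (intro power_mono norm_triangle_ineq) auto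
    also have "\<dots> \<le> 2 * (norm a)\<^sup>2 + 2 * (norm b)\<^sup>2"
      using sum_squares_bound[of "norm a" "norm b"] by (simp add: power2_sum)
    finally show ?thesis .
  qed
  hence "(\<integral>\<^sup>+x. ennreal ((norm (f x + g x))\<^sup>2) \<partial>N)
     \<le> (\<integral>\<^sup>+x. 2 * ennreal ((norm (f x))\<^sup>2) + 2 * ennreal ((norm (g x))\<^sup>2) \<partial>N)"
    by (intro nn_integral_mono) (simp add: ennreal_leI flip: ennreal_plus ennreal_mult' ennreal_numeral)
  also have "\<dots> = 2 * (\<integral>\<^sup>+x. ennreal ((norm (f x))\<^sup>2) \<partial>N) + 2 * (\<integral>\<^sup>+x. ennreal ((norm (g x))\<^sup>2) \<partial>N)"
    by (simp add: nn_integral_add nn_integral_cmult)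
  finally show ?thesis .
qed

lemma nn_integral_interval_eq:
  fixes h :: "real \<Rightarrow> real"
  shows "(\<integral>\<^sup>+s\<in>{0..t}. ennreal ((h s)\<^sup>2) \<partial>lborel)
      = (\<integral>\<^sup>+s. ennreal ((norm (indicator {0..t} s * h s))\<^sup>2) \<partial>lborel)"
  by (intro nn_integral_cong) (auto simp: indicator_def)

lemma tendsto_0_double_sum:
  fixes A B C :: "nat \<Rightarrow> ennreal"
  assumes "A \<longlonglongrightarrow> 0" "B \<longlonglongrightarrow> 0" "\<And>n. C n \<le> 2 * A n + 2 * B n"
  shows "C \<longlonglongrightarrow> 0"
proof (rule tendsto_sandwich[OF _ _ tendsto_const])
  have "(\<lambda>n. 2 * A n + 2 * B n) \<longlonglongrightarrow> 2 * 0 + 2 * 0"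
    by (intro tendsto_add ennreal_tendsto_cmult assms) auto
  thus "(\<lambda>n. 2 * A n + 2 * B n) \<longlonglongrightarrow> 0" by simp
qed (use assms(3) in auto)

context brownian
begin

lemma wiener_integral_rv: "wiener_integral M W g t J \<Longrightarrow> J \<in> borel_measurable M"
  by (simp add: wiener_integral_def)

lemma wiener_integralE:
  assumes "wiener_integral M W g t J"
  obtains cs where "\<And>n. steps_in t (cs n)"
    "(\<lambda>n. \<integral>\<^sup>+s\<in>{0..t}. ennreal ((step_fun (cs n) s - g s)\<^sup>2) \<partial>lborel) \<longlonglongrightarrow> 0"
    "(\<lambda>n. \<integral>\<^sup>+\<omega>. ennreal ((norm (step_integral W (cs n) \<omega> - J \<omega>))\<^sup>2) \<partial>M) \<longlonglongrightarrow> 0"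
  using assms unfolding wiener_integral_def steps_in_def by blast

lemma wiener_integralI:
  assumes "J \<in> borel_measurable M" "\<And>n. steps_in t (cs n)"
    "(\<lambda>n. \<integral>\<^sup>+s\<in>{0..t}. ennreal ((step_fun (cs n) s - g s)\<^sup>2) \<partial>lborel) \<longlonglongrightarrow> 0"
    "(\<lambda>n. \<integral>\<^sup>+\<omega>. ennreal ((norm (step_integral W (cs n) \<omega> - J \<omega>))\<^sup>2) \<partial>M) \<longlonglongrightarrow> 0"
  shows "wiener_integral M W g t J"
  using assms unfolding wiener_integral_def steps_in_def by blast

text \<open>Fatou's lemma along an almost surely convergent subsequence. The constant is twice the
  sharp one, which spares the convergence of the second moments of the step functions.\<close>
lemma wiener_integral_mgf:
  assumes J: "wiener_integral M W g t J" and t: "t \<ge> 0" and [measurable]: "g \<in> borel_measurable borel"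
    and G: "(\<integral>\<^sup>+s\<in>{0..t}. ennreal ((g s)\<^sup>2) \<partial>lborel) \<le> ennreal G" "G \<ge> 0"
  shows "(\<integral>\<^sup>+\<omega>. ennreal (exp (z \<bullet> J \<omega>)) \<partial>M) \<le> ennreal (exp ((norm z)\<^sup>2 * G))"
proof -
  obtain cs where cs: "\<And>n. steps_in t (cs n)"
    "(\<lambda>n. \<integral>\<^sup>+s\<in>{0..t}. ennreal ((step_fun (cs n) s - g s)\<^sup>2) \<partial>lborel) \<longlonglongrightarrow> 0"
    "(\<lambda>n. \<integral>\<^sup>+\<omega>. ennreal ((norm (step_integral W (cs n) \<omega> - J \<omega>))\<^sup>2) \<partial>M) \<longlonglongrightarrow> 0"
    by (rule wiener_integralE[OF J]) (rule that)
  note [measurable] = wiener_integral_rv[OF J] step_integral_rv[OF cs(1)]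
  obtain r where r: "strict_mono r" "AE \<omega> in M. (\<lambda>n. step_integral W (cs (r n)) \<omega>) \<longlonglongrightarrow> J \<omega>"
    by (rule AE_convergent_subseq[of "\<lambda>n. step_integral W (cs n)" J]) (use cs(3) in auto)
  have main: "(\<integral>\<^sup>+\<omega>. ennreal (exp (z \<bullet> J \<omega>)) \<partial>M) \<le> ennreal (exp ((norm z)\<^sup>2 * (G + d)))" if d: "d > 0" for d
  proof -
    have "(\<lambda>n. \<integral>\<^sup>+s\<in>{0..t}. ennreal ((step_fun (cs (r n)) s - g s)\<^sup>2) \<partial>lborel) \<longlonglongrightarrow> 0"
      using LIMSEQ_subseq_LIMSEQ[OF cs(2) r(1)] by (simp add: o_def)
    hence ev: "\<forall>\<^sub>F n in sequentially. (\<integral>\<^sup>+s\<in>{0..t}. ennreal ((step_fun (cs (r n)) s - g s)\<^sup>2) \<partial>lborel) < ennreal d"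
      using d by (intro order_tendstoD(2)) auto
    have ev2: "\<forall>\<^sub>F n in sequentially. (\<integral>\<^sup>+\<omega>. ennreal (exp (z \<bullet> step_integral W (cs (r n)) \<omega>)) \<partial>M) \<le> ennreal (exp ((norm z)\<^sup>2 * (G + d)))"
      using ev
    proof eventually_elim
      case (elim n)
      let ?f = "step_fun (cs (r n))"
      have "(\<integral>\<^sup>+s\<in>{0..t}. ennreal ((?f s)\<^sup>2) \<partial>lborel)
          = (\<integral>\<^sup>+s. ennreal ((norm (indicator {0..t} s * (?f s - g s) + indicator {0..t} s * g s))\<^sup>2) \<partial>lborel)"
        by (intro nn_integral_cong) (auto simp: indicator_def)
      also have "\<dots> \<le> 2 * (\<integral>\<^sup>+s\<in>{0..t}. ennreal ((?f s - g s)\<^sup>2) \<partial>lborel) + 2 * (\<integral>\<^sup>+s\<in>{0..t}. ennreal ((g s)\<^sup>2) \<partial>lborel)"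
        unfolding nn_integral_interval_eq by (rule nn_integral_square_sum_le) measurable
      also have "\<dots> \<le> 2 * ennreal d + 2 * ennreal G"
        using elim G by (intro add_mono mult_left_mono) auto
      also have "\<dots> = ennreal (2 * (G + d))"
      proof -
        have "2 * ennreal d = ennreal (2 * d)" "2 * ennreal G = ennreal (2 * G)"
          using d G ennreal_mult'[of 2 d] ennreal_mult'[of 2 G] by simp_all
        moreover have "ennreal (2 * d) + ennreal (2 * G) = ennreal (2 * d + 2 * G)"
          using d G by (intro ennreal_plus[symmetric]) auto
        ultimately show ?thesis by (simp only: algebra_simps)
      qed
      finally have "(\<integral>\<^sup>+s\<in>{0..t}. ennreal ((?f s)\<^sup>2) \<partial>lborel) \<le> ennreal (2 * (G + d))" .
      hence "(\<integral>\<^sup>+\<omega>. ennreal (exp (z \<bullet> step_integral W (cs (r n)) \<omega>)) \<partial>M) \<le> ennreal (exp ((norm z)\<^sup>2 / 2 * (2 * (G + d))))"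
        by (rule step_integral_mgf[OF t cs(1)]) (use d G in auto)
      moreover have "(norm z)\<^sup>2 / 2 * (2 * (G + d)) = (norm z)\<^sup>2 * (G + d)" by (simp only: field_simps)
      ultimately show ?case by (simp only:)
    qed
    have "AE \<omega> in M. (\<lambda>n. ennreal (exp (z \<bullet> step_integral W (cs (r n)) \<omega>))) \<longlonglongrightarrow> ennreal (exp (z \<bullet> J \<omega>))"
      using r(2) by eventually_elim (intro tendsto_intros)
    thus ?thesis by (rule nn_integral_le_AE_limit[rotated, OF _ ev2]) measurable
  qed
  have lim: "(\<lambda>n. ennreal (exp ((norm z)\<^sup>2 * (G + 1 / real (Suc n))))) \<longlonglongrightarrow> ennreal (exp ((norm z)\<^sup>2 * (G + 0)))"
    by (intro tendsto_intros LIMSEQ_Suc[OF lim_1_over_n])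
  have "(\<integral>\<^sup>+\<omega>. ennreal (exp (z \<bullet> J \<omega>)) \<partial>M) \<le> ennreal (exp ((norm z)\<^sup>2 * (G + 0)))"
    by (rule LIMSEQ_le_const[OF lim]) (intro exI allI impI main, simp)
  thus ?thesis by (simp only: add_0_right)
qed

lemma wiener_integral_cong:
  assumes J: "wiener_integral M W g t J" and eq: "\<And>s. s \<in> {0..t} \<Longrightarrow> g s = h s"
  shows "wiener_integral M W h t J"
proof -
  have "(\<integral>\<^sup>+s\<in>{0..t}. ennreal ((step_fun c s - g s)\<^sup>2) \<partial>lborel) = (\<integral>\<^sup>+s\<in>{0..t}. ennreal ((step_fun c s - h s)\<^sup>2) \<partial>lborel)" for c
    by (intro nn_integral_cong) (auto simp: indicator_def eq)
  thus ?thesis using J unfolding wiener_integral_def by simp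
qed

lemma wiener_integral_zero: "t \<ge> 0 \<Longrightarrow> wiener_integral M W (\<lambda>_. 0) t (\<lambda>_. 0)"
  by (rule wiener_integralI[where cs = "\<lambda>_. []"]) (auto simp: step_fun_simps)

lemma wiener_integral_add:
  assumes J: "wiener_integral M W g t J" and J': "wiener_integral M W g' t J'"
    and [measurable]: "g \<in> borel_measurable borel" "g' \<in> borel_measurable borel"
  shows "wiener_integral M W (\<lambda>s. g s + g' s) t (\<lambda>\<omega>. J \<omega> + J' \<omega>)"
proof -
  obtain cs where cs: "\<And>n. steps_in t (cs n)"
    "(\<lambda>n. \<integral>\<^sup>+s\<in>{0..t}. ennreal ((step_fun (cs n) s - g s)\<^sup>2) \<partial>lborel) \<longlonglongrightarrow> 0"
    "(\<lambda>n. \<integral>\<^sup>+\<omega>. ennreal ((norm (step_integral W (cs n) \<omega> - J \<omega>))\<^sup>2) \<partial>M) \<longlonglongrightarrow> 0"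
    by (rule wiener_integralE[OF J]) (rule that)
  obtain cs' where cs': "\<And>n. steps_in t (cs' n)"
    "(\<lambda>n. \<integral>\<^sup>+s\<in>{0..t}. ennreal ((step_fun (cs' n) s - g' s)\<^sup>2) \<partial>lborel) \<longlonglongrightarrow> 0"
    "(\<lambda>n. \<integral>\<^sup>+\<omega>. ennreal ((norm (step_integral W (cs' n) \<omega> - J' \<omega>))\<^sup>2) \<partial>M) \<longlonglongrightarrow> 0"
    by (rule wiener_integralE[OF J']) (rule that)
  note [measurable] = wiener_integral_rv[OF J] wiener_integral_rv[OF J'] step_integral_rv[OF cs(1)] step_integral_rv[OF cs'(1)]
  show ?thesis
  proof (rule wiener_integralI[where cs = "\<lambda>n. cs n @ cs' n"])
    show "(\<lambda>n. \<integral>\<^sup>+s\<in>{0..t}. ennreal ((step_fun (cs n @ cs' n) s - (g s + g' s))\<^sup>2) \<partial>lborel) \<longlonglongrightarrow> 0"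
    proof (rule tendsto_0_double_sum[OF cs(2) cs'(2)])
      fix n
      have "(\<integral>\<^sup>+s\<in>{0..t}. ennreal ((step_fun (cs n @ cs' n) s - (g s + g' s))\<^sup>2) \<partial>lborel)
        = (\<integral>\<^sup>+s. ennreal ((norm (indicator {0..t} s * (step_fun (cs n) s - g s) + indicator {0..t} s * (step_fun (cs' n) s - g' s)))\<^sup>2) \<partial>lborel)"
        by (intro nn_integral_cong) (auto simp: indicator_def step_fun_simps algebra_simps)
      also have "\<dots> \<le> 2 * (\<integral>\<^sup>+s\<in>{0..t}. ennreal ((step_fun (cs n) s - g s)\<^sup>2) \<partial>lborel)
          + 2 * (\<integral>\<^sup>+s\<in>{0..t}. ennreal ((step_fun (cs' n) s - g' s)\<^sup>2) \<partial>lborel)"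
        unfolding nn_integral_interval_eq by (rule nn_integral_square_sum_le) measurable
      finally show "(\<integral>\<^sup>+s\<in>{0..t}. ennreal ((step_fun (cs n @ cs' n) s - (g s + g' s))\<^sup>2) \<partial>lborel)
         \<le> 2 * (\<integral>\<^sup>+s\<in>{0..t}. ennreal ((step_fun (cs n) s - g s)\<^sup>2) \<partial>lborel)
          + 2 * (\<integral>\<^sup>+s\<in>{0..t}. ennreal ((step_fun (cs' n) s - g' s)\<^sup>2) \<partial>lborel)" .
    qed
    show "(\<lambda>n. \<integral>\<^sup>+\<omega>. ennreal ((norm (step_integral W (cs n @ cs' n) \<omega> - (J \<omega> + J' \<omega>)))\<^sup>2) \<partial>M) \<longlonglongrightarrow> 0"
    proof (rule tendsto_0_double_sum[OF cs(3) cs'(3)])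
      fix n
      have eq: "step_integral W (cs n @ cs' n) \<omega> - (J \<omega> + J' \<omega>)
         = (step_integral W (cs n) \<omega> - J \<omega>) + (step_integral W (cs' n) \<omega> - J' \<omega>)" for \<omega>
        by (simp add: step_fun_simps)
      show "(\<integral>\<^sup>+\<omega>. ennreal ((norm (step_integral W (cs n @ cs' n) \<omega> - (J \<omega> + J' \<omega>)))\<^sup>2) \<partial>M)
         \<le> 2 * (\<integral>\<^sup>+\<omega>. ennreal ((norm (step_integral W (cs n) \<omega> - J \<omega>))\<^sup>2) \<partial>M)
          + 2 * (\<integral>\<^sup>+\<omega>. ennreal ((norm (step_integral W (cs' n) \<omega> - J' \<omega>))\<^sup>2) \<partial>M)"
        unfolding eq by (rule nn_integral_square_sum_le) measurable
    qed
  qed (use cs(1) cs'(1) in auto)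
qed

lemma wiener_integral_scale:
  assumes J: "wiener_integral M W g t J" and [measurable]: "g \<in> borel_measurable borel"
  shows "wiener_integral M W (\<lambda>s. c * g s) t (\<lambda>\<omega>. c *\<^sub>R J \<omega>)"
proof -
  obtain cs where cs: "\<And>n. steps_in t (cs n)"
    "(\<lambda>n. \<integral>\<^sup>+s\<in>{0..t}. ennreal ((step_fun (cs n) s - g s)\<^sup>2) \<partial>lborel) \<longlonglongrightarrow> 0"
    "(\<lambda>n. \<integral>\<^sup>+\<omega>. ennreal ((norm (step_integral W (cs n) \<omega> - J \<omega>))\<^sup>2) \<partial>M) \<longlonglongrightarrow> 0"
    by (rule wiener_integralE[OF J]) (rule that)
  note [measurable] = wiener_integral_rv[OF J] step_integral_rv[OF cs(1)]
  define m where "m = map (\<lambda>(k, a, b). (c * k, a :: real, b :: real))"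
  have m: "step_fun (m ds) s = c * step_fun ds s" "step_integral W (m ds) \<omega> = c *\<^sub>R step_integral W ds \<omega>"
    "steps_in t (m ds) = steps_in t ds" for ds s \<omega>
    unfolding m_def by (induction ds) (auto simp: step_fun_simps algebra_simps)
  show ?thesis
  proof (rule wiener_integralI[where cs = "\<lambda>n. m (cs n)"])
    have "(\<lambda>n. ennreal (c\<^sup>2) * (\<integral>\<^sup>+s\<in>{0..t}. ennreal ((step_fun (cs n) s - g s)\<^sup>2) \<partial>lborel)) \<longlonglongrightarrow> ennreal (c\<^sup>2) * 0"
      by (intro ennreal_tendsto_cmult cs) auto
    moreover have "ennreal (c\<^sup>2) * (\<integral>\<^sup>+s\<in>{0..t}. ennreal ((step_fun (cs n) s - g s)\<^sup>2) \<partial>lborel)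
       = (\<integral>\<^sup>+s\<in>{0..t}. ennreal ((step_fun (m (cs n)) s - c * g s)\<^sup>2) \<partial>lborel)" for n
      by (subst nn_integral_cmult[symmetric], measurable, intro nn_integral_cong)
         (auto simp: indicator_def m power_mult_distrib simp flip: ennreal_mult right_diff_distrib)
    ultimately show "(\<lambda>n. \<integral>\<^sup>+s\<in>{0..t}. ennreal ((step_fun (m (cs n)) s - c * g s)\<^sup>2) \<partial>lborel) \<longlonglongrightarrow> 0" by simp
    have "(\<lambda>n. ennreal (c\<^sup>2) * (\<integral>\<^sup>+\<omega>. ennreal ((norm (step_integral W (cs n) \<omega> - J \<omega>))\<^sup>2) \<partial>M)) \<longlonglongrightarrow> ennreal (c\<^sup>2) * 0"
      by (intro ennreal_tendsto_cmult cs) auto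
    moreover have "ennreal (c\<^sup>2) * (\<integral>\<^sup>+\<omega>. ennreal ((norm (step_integral W (cs n) \<omega> - J \<omega>))\<^sup>2) \<partial>M)
       = (\<integral>\<^sup>+\<omega>. ennreal ((norm (step_integral W (m (cs n)) \<omega> - c *\<^sub>R J \<omega>))\<^sup>2) \<partial>M)" for n
      by (subst nn_integral_cmult[symmetric], measurable, intro nn_integral_cong)
         (auto simp: m power_mult_distrib simp flip: ennreal_mult scaleR_right_diff_distrib)
    ultimately show "(\<lambda>n. \<integral>\<^sup>+\<omega>. ennreal ((norm (step_integral W (m (cs n)) \<omega> - c *\<^sub>R J \<omega>))\<^sup>2) \<partial>M) \<longlonglongrightarrow> 0" by simp
  qed (use cs(1) m in auto)
qed

lemma wiener_integral_sum:
  assumes "t \<ge> 0" "\<And>k. k \<in> A \<Longrightarrow> wiener_integral M W (g k) t (J k)"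
    and "\<And>k. k \<in> A \<Longrightarrow> g k \<in> borel_measurable borel" and "finite A"
  shows "wiener_integral M W (\<lambda>s. \<Sum>k\<in>A. g k s) t (\<lambda>\<omega>. \<Sum>k\<in>A. J k \<omega>)"
  using assms(4,2,3)
proof (induction A rule: finite_induct)
  case (insert k A)
  thus ?case by (simp add: wiener_integral_add borel_measurable_sum)
qed (use wiener_integral_zero[OF assms(1)] in simp)

lemma steps_outside:
  assumes "steps_in t cs" "s > t" shows "step_fun cs s = 0"
  using assms
proof (induction cs)
  case (Cons x cs)
  thus ?case by (cases x) (auto simp: step_fun_simps)
qed (simp add: step_fun_simps)

lemma steps_in_mono: "steps_in t cs \<Longrightarrow> t \<le> t' \<Longrightarrow> steps_in t' cs"
  by (force simp: steps_in_def)

lemma wiener_integral_extend: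
  assumes J: "wiener_integral M W g s J" and s: "0 \<le> s" "s \<le> t"
  shows "wiener_integral M W (\<lambda>r. indicator {..s} r * g r) t J"
proof -
  obtain cs where cs: "\<And>n. steps_in s (cs n)"
    "(\<lambda>n. \<integral>\<^sup>+r\<in>{0..s}. ennreal ((step_fun (cs n) r - g r)\<^sup>2) \<partial>lborel) \<longlonglongrightarrow> 0"
    "(\<lambda>n. \<integral>\<^sup>+\<omega>. ennreal ((norm (step_integral W (cs n) \<omega> - J \<omega>))\<^sup>2) \<partial>M) \<longlonglongrightarrow> 0"
    by (rule wiener_integralE[OF J]) (rule that)
  have "(\<integral>\<^sup>+r\<in>{0..t}. ennreal ((step_fun (cs n) r - indicator {..s} r * g r)\<^sup>2) \<partial>lborel)
      = (\<integral>\<^sup>+r\<in>{0..s}. ennreal ((step_fun (cs n) r - g r)\<^sup>2) \<partial>lborel)" for n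
    using steps_outside[OF cs(1), of _ n] s by (intro nn_integral_cong) (auto simp: indicator_def not_le)
  thus ?thesis using cs s steps_in_mono[OF cs(1) s(2)]
    by (intro wiener_integralI[where cs = cs] wiener_integral_rv[OF J]) auto
qed

text \<open>If \<open>g = 0\<close> almost everywhere then \<open>E exp (\<plusminus> b \<bullet> J) \<le> 1\<close>, while \<open>e\<^sup>x + e\<^sup>-\<^sup>x > 2\<close> unless \<open>x = 0\<close>.\<close>
lemma wiener_integral_0_AE:
  assumes J: "wiener_integral M W g t J" and t: "t \<ge> 0" and g: "g \<in> borel_measurable borel"
    and 0: "(\<integral>\<^sup>+s\<in>{0..t}. ennreal ((g s)\<^sup>2) \<partial>lborel) = 0"
  shows "AE \<omega> in M. J \<omega> = 0"
proof -
  note [measurable] = wiener_integral_rv[OF J]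
  have le: "(\<integral>\<^sup>+\<omega>. ennreal (exp (z \<bullet> J \<omega>)) \<partial>M) \<le> 1" for z
    using wiener_integral_mgf[OF J t g, of 0 z] 0 by simp
  have "AE \<omega> in M. b \<bullet> J \<omega> = 0" for b
  proof -
    define h where "h \<omega> = (exp ((b \<bullet> J \<omega>) / 2) - exp (- (b \<bullet> J \<omega>) / 2))\<^sup>2" for \<omega>
    have [measurable]: "h \<in> borel_measurable M" unfolding h_def by measurable
    have "(\<integral>\<^sup>+\<omega>. ennreal (h \<omega>) \<partial>M) + 2 = (\<integral>\<^sup>+\<omega>. ennreal (h \<omega>) + 2 \<partial>M)"
      by (simp add: nn_integral_add emeasure_space_1)
    also have "\<dots> = (\<integral>\<^sup>+\<omega>. ennreal (exp (b \<bullet> J \<omega>)) + ennreal (exp ((- b) \<bullet> J \<omega>)) \<partial>M)"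
    proof (rule nn_integral_cong)
      fix \<omega>
      have "h \<omega> + 2 = exp (b \<bullet> J \<omega>) + exp ((- b) \<bullet> J \<omega>)"
        by (simp add: h_def power2_eq_square algebra_simps flip: exp_add)
      thus "ennreal (h \<omega>) + 2 = ennreal (exp (b \<bullet> J \<omega>)) + ennreal (exp ((- b) \<bullet> J \<omega>))"
        by (simp add: h_def flip: ennreal_plus ennreal_numeral)
    qed
    also have "\<dots> = (\<integral>\<^sup>+\<omega>. ennreal (exp (b \<bullet> J \<omega>)) \<partial>M) + (\<integral>\<^sup>+\<omega>. ennreal (exp ((- b) \<bullet> J \<omega>)) \<partial>M)"
      by (rule nn_integral_add) measurable
    also have "\<dots> \<le> 1 + 1" by (intro add_mono le)
    finally have "2 + (\<integral>\<^sup>+\<omega>. ennreal (h \<omega>) \<partial>M) \<le> 2 + 0" by (simp add: add.commute)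
    hence "(\<integral>\<^sup>+\<omega>. ennreal (h \<omega>) \<partial>M) = 0" unfolding ennreal_add_left_cancel_le by auto
    hence "AE \<omega> in M. ennreal (h \<omega>) = 0" by (subst (asm) nn_integral_0_iff_AE) auto
    thus ?thesis by eventually_elim (auto simp: h_def ennreal_eq_0_iff)
  qed
  hence "AE \<omega> in M. \<forall>b\<in>Basis. b \<bullet> J \<omega> = 0" by (simp add: AE_finite_all)
  thus ?thesis by eventually_elim (auto intro: euclidean_eqI simp: inner_commute)
qed

lemma wiener_integral_unique:
  assumes "wiener_integral M W g t J" "wiener_integral M W g t J'" "t \<ge> 0" "g \<in> borel_measurable borel"
  shows "AE \<omega> in M. J \<omega> = J' \<omega>"
proof -
  have "wiener_integral M W (\<lambda>s. g s + (-1) * g s) t (\<lambda>\<omega>. J \<omega> + (-1) *\<^sub>R J' \<omega>)"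
    using assms by (intro wiener_integral_add wiener_integral_scale) auto
  from wiener_integral_0_AE[OF this assms(3)] have "AE \<omega> in M. J \<omega> + (-1) *\<^sub>R J' \<omega> = 0" by simp
  thus ?thesis by eventually_elim simp
qed

end

section \<open>The noise in the new time\<close>

lemma summation_by_parts:
  fixes x :: "nat \<Rightarrow> 'b::real_vector"
  shows "(\<Sum>k<m. a k *\<^sub>R (x (Suc k) - x k)) = a m *\<^sub>R x m - a 0 *\<^sub>R x 0 - (\<Sum>k<m. (a (Suc k) - a k) *\<^sub>R x (Suc k))"
  by (induction m) (simp_all add: algebra_simps)

locale schedule_noise = schedule \<beta> \<beta>' \<sigma> \<sigma>' \<epsilon> \<gamma> + brownian M W
  for \<beta> \<beta>' \<sigma> \<sigma>' \<epsilon> \<gamma> and M :: "'w measure" and W :: "real \<Rightarrow> 'w \<Rightarrow> 'a::euclidean_space"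
begin

text \<open>The diffusion coefficient, cut off so that it is a Borel function on the whole line.\<close>
definition vol :: "real \<Rightarrow> real" where "vol s = indicator {0..1} s * sqrt (\<epsilon> * \<beta>' s)"

lemma vol_rv [measurable]: "vol \<in> borel_measurable borel"
proof -
  have "(\<lambda>s. indicator {0..1} s *\<^sub>R sqrt (\<epsilon> * \<beta>' s)) \<in> borel_measurable borel"
    by (intro borel_measurable_continuous_on_indicator continuous_intros \<beta>'_cont) auto
  thus ?thesis by (simp add: vol_def[abs_def])
qed

lemma vol_eq: "s \<in> {0..1} \<Longrightarrow> vol s = sqrt (\<epsilon> * \<beta>' s)" by (simp add: vol_def)

lemma wiener_integral_vol:
  "t \<in> {0..<1} \<Longrightarrow> wiener_integral M W (\<lambda>t. sqrt (\<epsilon> * \<beta>' t)) t J \<Longrightarrow> wiener_integral M W vol t J"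
  by (rule wiener_integral_cong) (auto simp: vol_eq)

text \<open>The Wiener integral of \<open>1 / \<sigma>\<close> against \<open>dI\<close>, integrated by parts so that it is defined path by
  path. It drives the equation in odds time.\<close>
definition noise :: "(real \<Rightarrow> 'w \<Rightarrow> 'a) \<Rightarrow> real \<Rightarrow> 'w \<Rightarrow> 'a" where
  "noise I t \<omega> = (1 / \<sigma> t) *\<^sub>R I t \<omega> - integral {0..t} (\<lambda>r. odds' r *\<^sub>R I r \<omega>)"

text \<open>The Riemann-Stieltjes sums before the integration by parts.\<close>
definition noise_sum :: "(real \<Rightarrow> 'w \<Rightarrow> 'a) \<Rightarrow> real \<Rightarrow> nat \<Rightarrow> 'w \<Rightarrow> 'a" where
  "noise_sum I T n \<omega> = (\<Sum>k<n. (1 / \<sigma> (mesh T n k)) *\<^sub>R (I (mesh T n (Suc k)) \<omega> - I (mesh T n k) \<omega>))"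

lemma noise_sum_tendsto:
  assumes T: "0 \<le> T" "T < 1" and I: "continuous_on {0..T} (\<lambda>t. I t \<omega>)" "I 0 \<omega> = 0"
  shows "(\<lambda>n. noise_sum I T n \<omega>) \<longlonglongrightarrow> noise I T \<omega>"
proof -
  interpret smooth_clock T odds odds' by (rule smooth_clock_odds[OF T])
  have "(\<lambda>n. \<Sum>k<n. (odds (mesh T n (Suc k)) - odds (mesh T n k)) *\<^sub>R I (mesh T n (Suc k)) \<omega>)
      \<longlonglongrightarrow> integral {0..T} (\<lambda>r. odds' r *\<^sub>R I r \<omega>)"
    by (rule riemann_sum_tendsto[OF I(1)]) (auto intro: mesh_mono T)
  hence "(\<lambda>n. (1 / \<sigma> T) *\<^sub>R I T \<omega> - (\<Sum>k<n. (odds (mesh T n (Suc k)) - odds (mesh T n k)) *\<^sub>R I (mesh T n (Suc k)) \<omega>))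
      \<longlonglongrightarrow> noise I T \<omega>"
    unfolding noise_def by (intro tendsto_intros)
  moreover have "\<forall>\<^sub>F n in sequentially. (1 / \<sigma> T) *\<^sub>R I T \<omega> - (\<Sum>k<n. (odds (mesh T n (Suc k)) - odds (mesh T n k)) *\<^sub>R I (mesh T n (Suc k)) \<omega>)
      = noise_sum I T n \<omega>"
    using eventually_gt_at_top[of 0]
  proof eventually_elim
    case (elim n)
    have "(\<Sum>k<n. (1 / \<sigma> (mesh T n (Suc k)) - 1 / \<sigma> (mesh T n k)) *\<^sub>R I (mesh T n (Suc k)) \<omega>)
       = (\<Sum>k<n. (odds (mesh T n (Suc k)) - odds (mesh T n k)) *\<^sub>R I (mesh T n (Suc k)) \<omega>)"
    proof (rule sum.cong[OF refl])
      fix k assume "k \<in> {..<n}"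
      hence "mesh T n k \<in> {0..T}" "mesh T n (Suc k) \<in> {0..T}" using mesh_in[OF T(1) elim] by auto
      thus "(1 / \<sigma> (mesh T n (Suc k)) - 1 / \<sigma> (mesh T n k)) *\<^sub>R I (mesh T n (Suc k)) \<omega>
          = (odds (mesh T n (Suc k)) - odds (mesh T n k)) *\<^sub>R I (mesh T n (Suc k)) \<omega>"
        using T inv_\<sigma>_eq[of "mesh T n k"] inv_\<sigma>_eq[of "mesh T n (Suc k)"] by simp
    qed
    thus ?case
      unfolding noise_sum_def summation_by_parts[of "\<lambda>k. 1 / \<sigma> (mesh T n k)" "\<lambda>k. I (mesh T n k) \<omega>"]
      using elim I(2) by (simp add: mesh_n)
  qed
  ultimately show ?thesis by (rule Lim_transform_eventually)
qed

lemma nn_integral_odds':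
  assumes T: "0 \<le> T" "T < 1"
  shows "(\<integral>\<^sup>+s\<in>{0..T}. ennreal (\<epsilon> * odds' s) \<partial>lborel) = ennreal (\<epsilon> * odds T)"
proof -
  interpret smooth_clock T odds odds' by (rule smooth_clock_odds[OF T])
  define h where "h s = (if s \<in> {0..T} then \<epsilon> * odds' s else 0)" for s
  have "(\<lambda>s. indicator {0..T} s *\<^sub>R (\<epsilon> * odds' s)) \<in> borel_measurable borel"
    by (intro borel_measurable_continuous_on_indicator continuous_intros cont') auto
  moreover have "(\<lambda>s. indicator {0..T} s *\<^sub>R (\<epsilon> * odds' s)) = h" by (auto simp: h_def indicator_def)
  ultimately have m: "h \<in> borel_measurable borel" by simp
  have "((\<lambda>s. \<epsilon> * odds' s) has_integral \<epsilon> * (odds T - odds 0)) {0..T}"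
    using T by (intro has_integral_mult_right integral_clock) auto
  hence "(h has_integral \<epsilon> * odds T) UNIV"
    unfolding h_def by (subst has_integral_restrict_UNIV) (simp add: odds_0)
  from nn_integral_has_integral_lborel[OF m _ this]
  have "(\<integral>\<^sup>+s. ennreal (h s) \<partial>lborel) = ennreal (\<epsilon> * odds T)"
    using nonneg' \<epsilon>_pos by (auto simp: h_def)
  moreover have "(\<integral>\<^sup>+s\<in>{0..T}. ennreal (\<epsilon> * odds' s) \<partial>lborel) = (\<integral>\<^sup>+s. ennreal (h s) \<partial>lborel)"
    by (intro nn_integral_cong) (auto simp: h_def indicator_def)
  ultimately show ?thesis by simp
qed

text \<open>The Riemann-Stieltjes sums are Wiener integrals of \<open>vol / \<sigma>\<close> frozen at the left end of each
  cell; as \<open>\<sigma>\<close> decreases, freezing only decreases the integrand.\<close>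
lemma noise_sum_wiener:
  assumes T: "0 \<le> T" "T < 1" and n: "n > 0"
    and I: "\<And>t. t \<in> {0..<1} \<Longrightarrow> wiener_integral M W vol t (I t)"
  obtains g where "g \<in> borel_measurable borel" "wiener_integral M W g T (noise_sum I T n)"
    "(\<integral>\<^sup>+s\<in>{0..T}. ennreal ((g s)\<^sup>2) \<partial>lborel) \<le> ennreal (\<epsilon> * odds T)"
proof
  let ?m = "mesh T n"
  let ?e = "\<lambda>t r. indicator {..t} r * vol r"
  define g where "g r = (\<Sum>k<n. (1 / \<sigma> (?m k)) * (?e (?m (Suc k)) r + (-1) * ?e (?m k) r))" for r
  have m: "?m k \<in> {0..T}" if "k \<le> n" for k using mesh_in[OF T(1) n that] .
  show [measurable]: "g \<in> borel_measurable borel" unfolding g_def by measurable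
  have "wiener_integral M W g T (\<lambda>\<omega>. \<Sum>k<n. (1 / \<sigma> (?m k)) *\<^sub>R (I (?m (Suc k)) \<omega> + (-1) *\<^sub>R I (?m k) \<omega>))"
    unfolding g_def
  proof (rule wiener_integral_sum[OF T(1)])
    fix k assume k: "k \<in> {..<n}"
    show "wiener_integral M W (\<lambda>s. (1 / \<sigma> (?m k)) * (?e (?m (Suc k)) s + (-1) * ?e (?m k) s)) T
            (\<lambda>\<omega>. (1 / \<sigma> (?m k)) *\<^sub>R (I (?m (Suc k)) \<omega> + (-1) *\<^sub>R I (?m k) \<omega>))"
      using m[of k] m[of "Suc k"] k T
      by (intro wiener_integral_scale wiener_integral_add wiener_integral_extend I) auto
  qed auto
  thus "wiener_integral M W g T (noise_sum I T n)" by (simp add: noise_sum_def[abs_def])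
  have "(\<integral>\<^sup>+s\<in>{0..T}. ennreal ((g s)\<^sup>2) \<partial>lborel) \<le> (\<integral>\<^sup>+s\<in>{0..T}. ennreal (\<epsilon> * odds' s) \<partial>lborel)"
  proof (rule nn_integral_mono)
    fix s :: real
    have "(g s)\<^sup>2 \<le> \<epsilon> * odds' s" if s: "s \<in> {0..T}"
    proof -
      have ss: "\<sigma> s > 0" using s T by (intro \<sigma>_pos) auto
      define c where "c = (\<Sum>k<n. (1 / \<sigma> (?m k)) * indicator {?m k<..?m (Suc k)} s :: real)"
      have "g s = c * vol s"
        unfolding g_def c_def sum_distrib_right
      proof (rule sum.cong[OF refl])
        fix k
        have "indicator {..?m (Suc k)} s - indicator {..?m k} s = (indicator {?m k<..?m (Suc k)} s :: real)"
          using mesh_mono[OF T(1), of k "Suc k" n] by (auto simp: indicator_def)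
        thus "(1 / \<sigma> (?m k)) * (?e (?m (Suc k)) s + (-1) * ?e (?m k) s) = (1 / \<sigma> (?m k)) * indicator {?m k<..?m (Suc k)} s * vol s"
          by (simp add: algebra_simps flip: left_diff_distrib)
      qed
      moreover have "0 \<le> c" unfolding c_def
      proof (rule sum_nonneg)
        fix k assume "k \<in> {..<n}"
        hence "\<sigma> (?m k) > 0" using m[of k] T by (intro \<sigma>_pos) auto
        thus "0 \<le> (1 / \<sigma> (?m k)) * indicator {?m k<..?m (Suc k)} s" by simp
      qed
      moreover have "c \<le> 1 / \<sigma> s"
      proof -
        have "c \<le> (\<Sum>k<n. (1 / \<sigma> s) * indicator {?m k<..?m (Suc k)} s)"
          unfolding c_def
        proof (rule sum_mono)
          fix k assume "k \<in> {..<n}"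
          thus "(1 / \<sigma> (?m k)) * indicator {?m k<..?m (Suc k)} s \<le> (1 / \<sigma> s) * (indicator {?m k<..?m (Suc k)} s :: real)"
            using m[of k] s T ss \<sigma>_antimono[of "?m k" s] by (auto simp: indicator_def intro!: divide_left_mono)
        qed
        also have "\<dots> = (1 / \<sigma> s) * indicator {?m 0<..?m n} s"
          using indicator_cells_le_1[of n ?m s] mesh_mono[OF T(1)] by (simp add: sum_divide_distrib[symmetric])
        also have "\<dots> \<le> 1 / \<sigma> s" using ss by (auto simp: indicator_def)
        finally show ?thesis .
      qed
      ultimately have "(g s)\<^sup>2 \<le> (1 / \<sigma> s)\<^sup>2 * (vol s)\<^sup>2"
        by (auto simp: power_mult_distrib intro!: mult_right_mono power_mono)
      also have "\<dots> = \<epsilon> * odds' s"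
        using s T \<beta>'_nonneg[of s] \<epsilon>_pos by (simp add: vol_eq odds'_def power_divide)
      finally show ?thesis .
    qed
    thus "ennreal ((g s)\<^sup>2) * indicator {0..T} s \<le> ennreal (\<epsilon> * odds' s) * indicator {0..T} s"
      by (auto simp: indicator_def intro: ennreal_leI)
  qed
  thus "(\<integral>\<^sup>+s\<in>{0..T}. ennreal ((g s)\<^sup>2) \<partial>lborel) \<le> ennreal (\<epsilon> * odds T)"
    by (simp add: nn_integral_odds'[OF T])
qed

lemma noise_mgf:
  assumes T: "0 \<le> T" "T < 1"
    and I: "\<And>t. t \<in> {0..<1} \<Longrightarrow> wiener_integral M W vol t (I t)"
    and cont: "AE \<omega> in M. continuous_on {0..T} (\<lambda>t. I t \<omega>) \<and> I 0 \<omega> = 0"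
  shows "(\<integral>\<^sup>+\<omega>. ennreal (exp (z \<bullet> noise I T \<omega>)) \<partial>M) \<le> ennreal (exp ((norm z)\<^sup>2 * (\<epsilon> * odds T)))"
proof (rule nn_integral_le_AE_limit[where f = "\<lambda>n \<omega>. ennreal (exp (z \<bullet> noise_sum I T (Suc n) \<omega>))"])
  show "AE \<omega> in M. (\<lambda>n. ennreal (exp (z \<bullet> noise_sum I T (Suc n) \<omega>))) \<longlonglongrightarrow> ennreal (exp (z \<bullet> noise I T \<omega>))"
    using cont by eventually_elim (intro tendsto_intros LIMSEQ_Suc noise_sum_tendsto T, auto)
  have *: "noise_sum I T (Suc n) \<in> borel_measurable M
      \<and> (\<integral>\<^sup>+\<omega>. ennreal (exp (z \<bullet> noise_sum I T (Suc n) \<omega>)) \<partial>M) \<le> ennreal (exp ((norm z)\<^sup>2 * (\<epsilon> * odds T)))" for n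
  proof -
    obtain g where g: "g \<in> borel_measurable borel" "wiener_integral M W g T (noise_sum I T (Suc n))"
      "(\<integral>\<^sup>+s\<in>{0..T}. ennreal ((g s)\<^sup>2) \<partial>lborel) \<le> ennreal (\<epsilon> * odds T)"
      by (rule noise_sum_wiener[OF T zero_less_Suc I])
    show ?thesis
      using wiener_integral_mgf[OF g(2) T(1) g(1) g(3)] odds_nonneg[OF T] \<epsilon>_pos wiener_integral_rv[OF g(2)] by simp
  qed
  show "(\<lambda>\<omega>. ennreal (exp (z \<bullet> noise_sum I T (Suc n) \<omega>))) \<in> borel_measurable M" for n
  proof -
    note [measurable] = *[of n, THEN conjunct1]
    show ?thesis by measurable
  qed
  show "\<forall>\<^sub>F n in sequentially. (\<integral>\<^sup>+\<omega>. ennreal (exp (z \<bullet> noise_sum I T (Suc n) \<omega>)) \<partial>M)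
      \<le> ennreal (exp ((norm z)\<^sup>2 * (\<epsilon> * odds T)))"
    using * by simp
qed

end

text \<open>The norm is at most the dimension times the absolute value of some coordinate.\<close>
lemma (in prob_space) exp_norm_moment:
  fixes Z :: "'a \<Rightarrow> 'b::euclidean_space" and l v :: real
  assumes [measurable]: "Z \<in> borel_measurable M"
    and mgf: "\<And>z. (\<integral>\<^sup>+\<omega>. ennreal (exp (z \<bullet> Z \<omega>)) \<partial>M) \<le> ennreal (exp ((norm z)\<^sup>2 * v))"
    and l: "l \<ge> 0"
  shows "(\<integral>\<^sup>+\<omega>. ennreal (exp (l * norm (Z \<omega>))) \<partial>M) \<le> ennreal (2 * DIM('b) * exp ((l * DIM('b))\<^sup>2 * v))"
proof -
  define d where "d = real (DIM('b))"
  have d: "d > 0" by (simp add: d_def)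
  have "exp (l * norm x) \<le> (\<Sum>b\<in>Basis. exp (((l * d) *\<^sub>R b) \<bullet> x) + exp ((- (l * d) *\<^sub>R b) \<bullet> x))" for x :: 'b
  proof -
    have "\<exists>b\<in>Basis. norm x \<le> d * \<bar>x \<bullet> b\<bar>"
    proof (rule ccontr)
      assume "\<not> (\<exists>b\<in>Basis. norm x \<le> d * \<bar>x \<bullet> b\<bar>)"
      hence "(\<Sum>b\<in>(Basis :: 'b set). \<bar>x \<bullet> b\<bar>) < (\<Sum>b\<in>(Basis :: 'b set). norm x / d)"
        using d by (intro sum_strict_mono) (auto simp: field_simps not_le)
      also have "\<dots> = norm x" using d by (simp add: d_def)
      finally show False using norm_le_l1[of x] by simp
    qed
    then obtain b where b: "b \<in> Basis" "norm x \<le> d * \<bar>x \<bullet> b\<bar>" by auto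
    have "l * norm x \<le> l * d * \<bar>x \<bullet> b\<bar>" using mult_left_mono[OF b(2) l] by (simp add: mult_ac)
    hence "exp (l * norm x) \<le> exp (l * d * \<bar>x \<bullet> b\<bar>)" by simp
    also have "\<dots> \<le> exp (((l * d) *\<^sub>R b) \<bullet> x) + exp ((- (l * d) *\<^sub>R b) \<bullet> x)"
      by (cases "x \<bullet> b \<ge> 0") (simp_all add: inner_commute abs_if)
    also have "\<dots> \<le> (\<Sum>b\<in>Basis. exp (((l * d) *\<^sub>R b) \<bullet> x) + exp ((- (l * d) *\<^sub>R b) \<bullet> x))"
      using b(1) by (rule member_le_sum) (auto intro: add_nonneg_nonneg)
    finally show ?thesis .
  qed
  hence "(\<integral>\<^sup>+\<omega>. ennreal (exp (l * norm (Z \<omega>))) \<partial>M)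
      \<le> (\<integral>\<^sup>+\<omega>. (\<Sum>b\<in>Basis. ennreal (exp (((l * d) *\<^sub>R b) \<bullet> Z \<omega>)) + ennreal (exp ((- (l * d) *\<^sub>R b) \<bullet> Z \<omega>))) \<partial>M)"
    by (intro nn_integral_mono) (simp add: ennreal_leI flip: ennreal_plus)
  also have "\<dots> = (\<Sum>b\<in>Basis. (\<integral>\<^sup>+\<omega>. ennreal (exp (((l * d) *\<^sub>R b) \<bullet> Z \<omega>)) \<partial>M) + (\<integral>\<^sup>+\<omega>. ennreal (exp ((- (l * d) *\<^sub>R b) \<bullet> Z \<omega>)) \<partial>M))"
    by (subst nn_integral_sum) (auto simp: nn_integral_add)
  also have "\<dots> \<le> (\<Sum>b\<in>(Basis :: 'b set). ennreal (exp ((l * d)\<^sup>2 * v)) + ennreal (exp ((l * d)\<^sup>2 * v)))"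
  proof (intro sum_mono add_mono)
    fix b :: 'b assume b: "b \<in> Basis"
    show "(\<integral>\<^sup>+\<omega>. ennreal (exp (((l * d) *\<^sub>R b) \<bullet> Z \<omega>)) \<partial>M) \<le> ennreal (exp ((l * d)\<^sup>2 * v))"
      using mgf[of "(l * d) *\<^sub>R b"] b by (simp add: power_mult_distrib)
    show "(\<integral>\<^sup>+\<omega>. ennreal (exp ((- (l * d) *\<^sub>R b) \<bullet> Z \<omega>)) \<partial>M) \<le> ennreal (exp ((l * d)\<^sup>2 * v))"
      using mgf[of "- (l * d) *\<^sub>R b"] b by (simp add: power_mult_distrib)
  qed
  also have "\<dots> = ennreal (2 * DIM('b) * exp ((l * d)\<^sup>2 * v))"
    by (simp add: ennreal_of_nat_eq_real_of_nat mult_ac flip: ennreal_plus ennreal_mult)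
  finally show ?thesis by (simp add: d_def)
qed

section \<open>Paths of the two diffusions\<close>

lemma eq_of_eq_on_rationals:
  fixes f g :: "real \<Rightarrow> 'b::real_normed_vector"
  assumes f: "continuous_on {0..T} f" and g: "continuous_on {0..T} g"
    and eq: "\<And>r. r \<in> \<rat> \<Longrightarrow> 0 \<le> r \<Longrightarrow> r < T \<Longrightarrow> f r = g r" and t: "0 \<le> t" "t < T"
  shows "f t = g t"
proof (rule ccontr)
  assume "f t \<noteq> g t"
  hence e: "dist (f t - g t) 0 > 0" by simp
  have "continuous_on {0..T} (\<lambda>r. f r - g r)" by (intro continuous_intros f g)
  then obtain d where d: "d > 0" "\<And>r. r \<in> {0..T} \<Longrightarrow> dist r t < d \<Longrightarrow> dist (f r - g r) (f t - g t) < dist (f t - g t) 0"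
    using e t unfolding continuous_on_iff by (metis atLeastAtMost_iff less_imp_le)
  obtain r where r: "r \<in> \<rat>" "t < r" "r < min (t + d) T"
    using Rats_dense_in_real[of t "min (t + d) T"] d(1) t by auto
  hence "dist (f r - g r) (f t - g t) < dist (f t - g t) 0" using t by (intro d(2)) (auto simp: dist_real_def)
  thus False using eq[of r] r t by (simp add: dist_norm norm_minus_commute)
qed

context schedule
begin

lemma drift_path_cont:
  fixes x \<mu> :: "real \<Rightarrow> 'b::euclidean_space"
  assumes "T < 1" "continuous_on {0..T} x" "continuous_on {0..T} \<mu>"
  shows "continuous_on {0..T} (\<lambda>r. (\<sigma>' r / \<sigma> r) *\<^sub>R (x r - \<mu> r))"
proof -
  have "\<sigma> r \<noteq> 0" if "r \<in> {0..T}" for r using \<sigma>_pos[of r] that assms by auto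
  thus ?thesis
    by (intro continuous_intros assms continuous_on_subset[OF \<sigma>'_cont] continuous_on_subset[OF \<sigma>_cont])
       (use assms in auto)
qed

lemma sde_path:
  fixes x I :: "real \<Rightarrow> 'b::euclidean_space" and f :: "real \<Rightarrow> 'b \<Rightarrow> 'b"
  assumes x: "continuous_on {0..<1} x"
    and f: "\<And>t x. t \<in> {0..<1} \<Longrightarrow> f t x = (\<sigma>' t / \<sigma> t) *\<^sub>R (x - m t x)"
    and m: "\<And>T. T < 1 \<Longrightarrow> continuous_on {0..T} (\<lambda>r. m r (x r))"
    and eq: "\<And>t. t \<in> {0..<1} \<Longrightarrow> set_integrable lborel {0..t} (\<lambda>s. f s (x s)) \<and>
               x t = x0 + (LBINT s:{0..t}. f s (x s)) + I t"
  shows "\<And>t. t \<in> {0..<1} \<Longrightarrow> x t = x0 + integral {0..t} (\<lambda>r. (\<sigma>' r / \<sigma> r) *\<^sub>R (x r - m r (x r))) + I t"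
    and "\<And>T. T < 1 \<Longrightarrow> continuous_on {0..T} I"
proof -
  show 1: "x t = x0 + integral {0..t} (\<lambda>r. (\<sigma>' r / \<sigma> r) *\<^sub>R (x r - m r (x r))) + I t" if t: "t \<in> {0..<1}" for t
  proof -
    have "(LBINT s:{0..t}. f s (x s)) = integral {0..t} (\<lambda>s. f s (x s))"
      using eq[OF t] by (intro set_borel_integral_eq_integral) auto
    also have "\<dots> = integral {0..t} (\<lambda>r. (\<sigma>' r / \<sigma> r) *\<^sub>R (x r - m r (x r)))"
      using t by (intro integral_cong f) auto
    finally show ?thesis using eq[OF t] by simp
  qed
  show "continuous_on {0..T} I" if T: "T < 1" for T
  proof -
    have xT: "continuous_on {0..T} x" by (rule continuous_on_subset[OF x]) (use T in auto)
    have "continuous_on {0..T} (\<lambda>t. x t - x0 - integral {0..t} (\<lambda>r. (\<sigma>' r / \<sigma> r) *\<^sub>R (x r - m r (x r))))"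
      by (intro continuous_intros xT indefinite_integral_continuous_1 integrable_continuous_real
          drift_path_cont[OF T xT m[OF T]])
    thus ?thesis by (rule continuous_on_eq) (use 1 T in auto)
  qed
qed

end

locale bounded_coupling =
  coupled_diffusions P \<eta> \<beta> \<beta>' \<sigma> \<sigma>' \<epsilon> \<gamma> M N \<eta>s W \<xi> X XN
  for P :: "'p measure" and \<eta> :: "'p \<Rightarrow> 'a::euclidean_space"
    and \<beta> \<beta>' \<sigma> \<sigma>' \<epsilon> \<gamma> and M :: "'w measure" and N \<eta>s W \<xi> X XN +
  fixes K :: real
  assumes \<eta>_bounded: "AE \<omega> in P. norm (\<eta> \<omega>) \<le> K" and \<epsilon>_le_\<gamma>: "\<epsilon> \<le> \<gamma>"

sublocale bounded_coupling \<subseteq> SV: schedule_vector \<beta> \<beta>' \<sigma> \<sigma>' \<epsilon> \<gamma> P \<eta> K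
  by unfold_locales (use \<eta>_rv \<eta>_bounded in auto)

sublocale bounded_coupling \<subseteq> SN: schedule_noise \<beta> \<beta>' \<sigma> \<sigma>' \<epsilon> \<gamma> M W
  by unfold_locales (rule W_bm)

context bounded_coupling
begin

lemma \<eta>s_rv: "i \<in> {1..N} \<Longrightarrow> \<eta>s i \<in> borel_measurable M"
  using copies_indep by (auto simp: indep_vars_def)

lemma \<eta>s_bounded: "AE \<omega> in M. \<forall>i\<in>{1..N}. norm (\<eta>s i \<omega>) \<le> K"
proof -
  have "AE \<omega> in M. norm (\<eta>s i \<omega>) \<le> K" if i: "i \<in> {1..N}" for i
  proof -
    have "AE y in distr P borel \<eta>. norm y \<le> K" using \<eta>_bounded \<eta>_rv by (subst AE_distr_iff) auto
    thus ?thesis unfolding copies_law[OF i, symmetric] using \<eta>s_rv[OF i] by (subst (asm) AE_distr_iff) auto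
  qed
  thus ?thesis by (subst AE_finite_all) auto
qed

abbreviation "sample_mean \<omega> \<equiv> emp_mean N (\<lambda>i. \<eta>s i \<omega>)"

definition good_path :: "(real \<Rightarrow> 'w \<Rightarrow> 'a) \<Rightarrow> 'w \<Rightarrow> bool" where
  "good_path I \<omega> \<longleftrightarrow>
     (\<forall>i\<in>{1..N}. norm (\<eta>s i \<omega>) \<le> K) \<and> I 0 \<omega> = 0 \<and>
     continuous_on {0..<1} (\<lambda>t. X t \<omega>) \<and> continuous_on {0..<1} (\<lambda>t. XN t \<omega>) \<and>
     (\<forall>T<1. continuous_on {0..T} (\<lambda>t. I t \<omega>)) \<and>
     (\<forall>t\<in>{0..<1}. X t \<omega> = \<xi> \<omega> + integral {0..t} (\<lambda>r. (\<sigma>' r / \<sigma> r) *\<^sub>R (X r \<omega> - SV.post_mean r (X r \<omega>))) + I t \<omega>) \<and>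
     (\<forall>t\<in>{0..<1}. XN t \<omega> = \<xi> \<omega> + integral {0..t} (\<lambda>r. (\<sigma>' r / \<sigma> r) *\<^sub>R (XN r \<omega> - sample_mean \<omega> r (XN r \<omega>))) + I t \<omega>)"

text \<open>Wiener integrals are unique only up to null sets that depend on the time. Both equations can
  nevertheless be driven by one version \<open>I\<close>: the two versions agree at all rational times, and
  the equations force them to be continuous.\<close>
lemma good_paths:
  obtains I where "\<And>t. t \<in> {0..<1} \<Longrightarrow> wiener_integral M W SN.vol t (I t)" "AE \<omega> in M. good_path I \<omega>"
proof -
  let ?g = "\<lambda>t. sqrt (\<epsilon> * \<beta>' t)"
  obtain I where I: "\<forall>t\<in>{0..<1}. wiener_integral M W ?g t (I t)"
    "AE \<omega> in M. continuous_on {0..<1} (\<lambda>t. X t \<omega>) \<and> (\<forall>t\<in>{0..<1}.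
       set_integrable lborel {0..t} (\<lambda>s. drift P \<eta> s (X s \<omega>)) \<and>
       X t \<omega> = \<xi> \<omega> + (LBINT s:{0..t}. drift P \<eta> s (X s \<omega>)) + I t \<omega>)"
    using X_sde unfolding sde_solution_def by blast
  obtain J where J: "\<forall>t\<in>{0..<1}. wiener_integral M W ?g t (J t)"
    "AE \<omega> in M. continuous_on {0..<1} (\<lambda>t. XN t \<omega>) \<and> (\<forall>t\<in>{0..<1}.
       set_integrable lborel {0..t} (\<lambda>s. empirical_drift N (\<lambda>i. \<eta>s i \<omega>) s (XN s \<omega>)) \<and>
       XN t \<omega> = \<xi> \<omega> + (LBINT s:{0..t}. empirical_drift N (\<lambda>i. \<eta>s i \<omega>) s (XN s \<omega>)) + J t \<omega>)"
    using XN_sde unfolding sde_solution_def by blast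
  have wI: "wiener_integral M W SN.vol t (I t)" and wJ: "wiener_integral M W SN.vol t (J t)" if "t \<in> {0..<1}" for t
    using I(1) J(1) SN.wiener_integral_vol that by auto
  have "AE \<omega> in M. I r \<omega> = J r \<omega>" if "r \<in> {0..<1}" for r
    using that by (intro SN.wiener_integral_unique[OF wI wJ]) auto
  moreover have "countable (\<rat> \<inter> {0..<1::real})" using countable_rat by blast
  ultimately have q: "AE \<omega> in M. \<forall>r\<in>\<rat> \<inter> {0..<1}. I r \<omega> = J r \<omega>"
    by (subst AE_ball_countable) auto
  have 0: "AE \<omega> in M. I 0 \<omega> = 0"
  proof (rule SN.wiener_integral_0_AE[OF wI])
    have "AE s in lborel. s \<noteq> (0::real)" by (rule AE_lborel_singleton)
    thus "(\<integral>\<^sup>+s\<in>{0..0}. ennreal ((SN.vol s)\<^sup>2) \<partial>lborel) = 0"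
      by (subst nn_integral_0_iff_AE) (auto elim!: eventually_mono simp: indicator_def)
  qed auto
  have "AE \<omega> in M. good_path I \<omega>"
    using I(2) J(2) q 0 \<eta>s_bounded
  proof eventually_elim
    case (elim \<omega>)
    have y: "norm (\<eta>s i \<omega>) \<le> K" if "i \<in> {1..N}" for i using elim that by blast
    have c0: "continuous_on {0..<1} (\<lambda>t. X t \<omega>)" "continuous_on {0..<1} (\<lambda>t. XN t \<omega>)" using elim by blast+
    have cX: "continuous_on {0..T} (\<lambda>t. X t \<omega>)" "continuous_on {0..T} (\<lambda>t. XN t \<omega>)" if "T < 1" for T
      using that by (auto intro: continuous_on_subset[OF c0(1)] continuous_on_subset[OF c0(2)])
    have eX: "set_integrable lborel {0..t} (\<lambda>s. drift P \<eta> s (X s \<omega>)) \<and>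
       X t \<omega> = \<xi> \<omega> + (LBINT s:{0..t}. drift P \<eta> s (X s \<omega>)) + I t \<omega>" if "t \<in> {0..<1}" for t
      using elim that by blast
    have eXN: "set_integrable lborel {0..t} (\<lambda>s. empirical_drift N (\<lambda>i. \<eta>s i \<omega>) s (XN s \<omega>)) \<and>
       XN t \<omega> = \<xi> \<omega> + (LBINT s:{0..t}. empirical_drift N (\<lambda>i. \<eta>s i \<omega>) s (XN s \<omega>)) + J t \<omega>" if "t \<in> {0..<1}" for t
      using elim that by blast
    have dN: "empirical_drift N (\<lambda>i. \<eta>s i \<omega>) t x = (\<sigma>' t / \<sigma> t) *\<^sub>R (x - sample_mean \<omega> t x)" if "t \<in> {0..<1}" for t x
      by (rule emp_drift_eq[OF N_pos y that])
    have mN: "continuous_on {0..T} (\<lambda>r. sample_mean \<omega> r (XN r \<omega>))" if "T < 1" for T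
      by (rule emp_mean_path_cont[OF N_pos y that cX(2)[OF that]])
    have m: "continuous_on {0..T} (\<lambda>r. SV.post_mean r (X r \<omega>))" if "T < 1" for T
      by (rule SV.post_mean_path_cont[OF that cX(1)[OF that]])
    have X: "X t \<omega> = \<xi> \<omega> + integral {0..t} (\<lambda>r. (\<sigma>' r / \<sigma> r) *\<^sub>R (X r \<omega> - SV.post_mean r (X r \<omega>))) + I t \<omega>"
      if "t \<in> {0..<1}" for t by (rule sde_path(1)[OF c0(1) SV.drift_eq m eX that])
    have cI: "continuous_on {0..T} (\<lambda>t. I t \<omega>)" if "T < 1" for T
      by (rule sde_path(2)[OF c0(1) SV.drift_eq m eX that])
    have XN: "XN t \<omega> = \<xi> \<omega> + integral {0..t} (\<lambda>r. (\<sigma>' r / \<sigma> r) *\<^sub>R (XN r \<omega> - sample_mean \<omega> r (XN r \<omega>))) + J t \<omega>"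
      if "t \<in> {0..<1}" for t by (rule sde_path(1)[OF c0(2) dN mN eXN that])
    have cJ: "continuous_on {0..T} (\<lambda>t. J t \<omega>)" if "T < 1" for T
      by (rule sde_path(2)[OF c0(2) dN mN eXN that])
    have q': "I r \<omega> = J r \<omega>" if "r \<in> \<rat>" "0 \<le> r" "r < 1" for r using elim that by auto
    have IJ: "I t \<omega> = J t \<omega>" if t: "t \<in> {0..<1}" for t
    proof (rule eq_of_eq_on_rationals[where T = "(1 + t) / 2"])
      show "continuous_on {0..(1 + t) / 2} (\<lambda>t. I t \<omega>)" "continuous_on {0..(1 + t) / 2} (\<lambda>t. J t \<omega>)"
        using t by (auto intro!: cI cJ)
      show "I r \<omega> = J r \<omega>" if "r \<in> \<rat>" "0 \<le> r" "r < (1 + t) / 2" for r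
        using that t by (intro q') auto
    qed (use t in auto)
    show ?case unfolding good_path_def
    proof (intro conjI ballI allI impI c0)
      show "XN t \<omega> = \<xi> \<omega> + integral {0..t} (\<lambda>r. (\<sigma>' r / \<sigma> r) *\<^sub>R (XN r \<omega> - sample_mean \<omega> r (XN r \<omega>))) + I t \<omega>"
        if "t \<in> {0..<1}" for t unfolding IJ[OF that] by (rule XN[OF that])
    qed (fact y cI X | use elim in blast)+
  qed
  from that[OF wI this] show ?thesis .
qed

lemma good_path_cont:
  assumes "good_path I \<omega>" "T < 1"
  shows "continuous_on {0..T} (\<lambda>t. X t \<omega>)" "continuous_on {0..T} (\<lambda>t. XN t \<omega>)" "continuous_on {0..T} (\<lambda>t. I t \<omega>)"
    "continuous_on {0..T} (\<lambda>r. SV.post_mean r (X r \<omega>))" "continuous_on {0..T} (\<lambda>r. sample_mean \<omega> r (XN r \<omega>))"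
    "continuous_on {0..T} (\<lambda>r. sample_mean \<omega> r (X r \<omega>))"
proof -
  show X: "continuous_on {0..T} (\<lambda>t. X t \<omega>)" and XN: "continuous_on {0..T} (\<lambda>t. XN t \<omega>)" and "continuous_on {0..T} (\<lambda>t. I t \<omega>)"
    using assms by (auto simp: good_path_def intro: continuous_on_subset)
  have y: "norm (\<eta>s i \<omega>) \<le> K" if "i \<in> {1..N}" for i using assms that by (auto simp: good_path_def)
  show "continuous_on {0..T} (\<lambda>r. SV.post_mean r (X r \<omega>))"
    by (rule SV.post_mean_path_cont[OF assms(2) X])
  show "continuous_on {0..T} (\<lambda>r. sample_mean \<omega> r (XN r \<omega>))"
    by (rule emp_mean_path_cont[OF N_pos y assms(2) XN])
  show "continuous_on {0..T} (\<lambda>r. sample_mean \<omega> r (X r \<omega>))"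
    by (rule emp_mean_path_cont[OF N_pos y assms(2) X])
qed

lemma X_in_odds_time:
  assumes g: "good_path I \<omega>" and T: "0 \<le> T" "T < 1"
  shows "(1 / \<sigma> T) *\<^sub>R X T \<omega> = \<xi> \<omega> + SN.noise I T \<omega> + integral {0..T} (\<lambda>r. odds' r *\<^sub>R SV.post_mean r (X r \<omega>))"
  unfolding SN.noise_def
  by (rule variation_of_constants[OF T good_path_cont(1,3,4)[OF g T(2)]])
     (use g T in \<open>auto simp: good_path_def\<close>)

text \<open>The noise cancels in the difference.\<close>
lemma difference_in_odds_time:
  assumes g: "good_path I \<omega>" and T: "0 \<le> T" "T < 1"
  shows "(1 / \<sigma> T) *\<^sub>R (XN T \<omega> - X T \<omega>)
       = integral {0..T} (\<lambda>r. odds' r *\<^sub>R (sample_mean \<omega> r (XN r \<omega>) - SV.post_mean r (X r \<omega>)))"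
proof -
  note c = good_path_cont[OF g T(2)]
  have "(1 / \<sigma> T) *\<^sub>R (XN T \<omega> - X T \<omega>) = 0 + ((1 / \<sigma> T) *\<^sub>R 0 - integral {0..T} (\<lambda>r. odds' r *\<^sub>R 0))
      + integral {0..T} (\<lambda>r. odds' r *\<^sub>R (sample_mean \<omega> r (XN r \<omega>) - SV.post_mean r (X r \<omega>)))"
  proof (rule variation_of_constants[OF T, where x = "\<lambda>t. XN t \<omega> - X t \<omega>" and I = "\<lambda>_. 0"])
    show "continuous_on {0..T} (\<lambda>t. XN t \<omega> - X t \<omega>)"
      "continuous_on {0..T} (\<lambda>r. sample_mean \<omega> r (XN r \<omega>) - SV.post_mean r (X r \<omega>))"
      by (intro continuous_intros c)+
    fix t assume t: "t \<in> {0..T}"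
    have sub: "{0..t} \<subseteq> {0..T}" and t1: "t < 1" using t T by auto
    have "integral {0..t} (\<lambda>r. (\<sigma>' r / \<sigma> r) *\<^sub>R (XN r \<omega> - sample_mean \<omega> r (XN r \<omega>)))
        - integral {0..t} (\<lambda>r. (\<sigma>' r / \<sigma> r) *\<^sub>R (X r \<omega> - SV.post_mean r (X r \<omega>)))
       = integral {0..t} (\<lambda>r. (\<sigma>' r / \<sigma> r) *\<^sub>R (XN r \<omega> - sample_mean \<omega> r (XN r \<omega>))
            - (\<sigma>' r / \<sigma> r) *\<^sub>R (X r \<omega> - SV.post_mean r (X r \<omega>)))"
      by (rule integral_diff[symmetric])
         (intro integrable_continuous_real drift_path_cont t1 good_path_cont[OF g t1])+
    also have "\<dots> = integral {0..t} (\<lambda>r. (\<sigma>' r / \<sigma> r) *\<^sub>R (XN r \<omega> - X r \<omega> - (sample_mean \<omega> r (XN r \<omega>) - SV.post_mean r (X r \<omega>))))"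
    proof -
      have "c *\<^sub>R (x - m) - c *\<^sub>R (x' - m') = c *\<^sub>R (x - x' - (m - m'))" for c and x x' m m' :: 'a
        by (simp add: algebra_simps)
      thus ?thesis by simp
    qed
    finally have i: "integral {0..t} (\<lambda>r. (\<sigma>' r / \<sigma> r) *\<^sub>R (XN r \<omega> - sample_mean \<omega> r (XN r \<omega>)))
        - integral {0..t} (\<lambda>r. (\<sigma>' r / \<sigma> r) *\<^sub>R (X r \<omega> - SV.post_mean r (X r \<omega>)))
       = integral {0..t} (\<lambda>r. (\<sigma>' r / \<sigma> r) *\<^sub>R (XN r \<omega> - X r \<omega> - (sample_mean \<omega> r (XN r \<omega>) - SV.post_mean r (X r \<omega>))))" .
    have "t \<in> {0..<1}" using t T by auto
    hence "X t \<omega> = \<xi> \<omega> + integral {0..t} (\<lambda>r. (\<sigma>' r / \<sigma> r) *\<^sub>R (X r \<omega> - SV.post_mean r (X r \<omega>))) + I t \<omega>"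
      "XN t \<omega> = \<xi> \<omega> + integral {0..t} (\<lambda>r. (\<sigma>' r / \<sigma> r) *\<^sub>R (XN r \<omega> - sample_mean \<omega> r (XN r \<omega>))) + I t \<omega>"
      using g unfolding good_path_def by blast+
    hence "XN t \<omega> - X t \<omega> = integral {0..t} (\<lambda>r. (\<sigma>' r / \<sigma> r) *\<^sub>R (XN r \<omega> - sample_mean \<omega> r (XN r \<omega>)))
        - integral {0..t} (\<lambda>r. (\<sigma>' r / \<sigma> r) *\<^sub>R (X r \<omega> - SV.post_mean r (X r \<omega>)))"
      by (metis (no_types, lifting) add_diff_cancel_left add_diff_cancel_right)
    thus "XN t \<omega> - X t \<omega> = 0 + integral {0..t} (\<lambda>r. (\<sigma>' r / \<sigma> r) *\<^sub>R (XN r \<omega> - X r \<omega>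
        - (sample_mean \<omega> r (XN r \<omega>) - SV.post_mean r (X r \<omega>)))) + 0"
      unfolding i by simp
  qed auto
  thus ?thesis by simp
qed

definition fluct :: "real \<Rightarrow> 'w \<Rightarrow> real" where
  "fluct r \<omega> = norm (sample_mean \<omega> r (X r \<omega>) - SV.post_mean r (X r \<omega>))"

text \<open>In odds time the derivative of a tilted mean is the tilted covariance times \<open>\<beta> / l\<close>.\<close>
lemma slope_le: "r \<in> {0..<1} \<Longrightarrow> \<beta> r / ell r \<le> 1 / \<epsilon>"
  using ell_ge[OF \<epsilon>_le_\<gamma>, of r] \<beta>_range[of r] \<epsilon>_pos by (intro frac_le) auto

text \<open>The Lipschitz constant of the empirical mean is used between \<open>X\<^sup>N\<close> and \<open>X\<close>, so that the
  fluctuation is evaluated at \<open>X\<close>, which does not depend on the sample.\<close>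
lemma difference_gronwall:
  assumes g: "good_path I \<omega>" and T: "0 \<le> T" "T < 1"
  shows "norm ((1 / \<sigma> T) *\<^sub>R (XN T \<omega> - X T \<omega>))
       \<le> exp (K\<^sup>2 / \<epsilon> * odds T) * integral {0..T} (\<lambda>r. odds' r * fluct r \<omega>)"
proof -
  interpret smooth_clock T odds odds' by (rule smooth_clock_odds[OF T])
  note c = good_path_cont[OF g T(2)]
  have y: "norm (\<eta>s i \<omega>) \<le> K" if "i \<in> {1..N}" for i using g that by (auto simp: good_path_def)
  define a where "a t = norm ((1 / \<sigma> t) *\<^sub>R (XN t \<omega> - X t \<omega>))" for t
  have s: "\<sigma> t > 0" if "t \<in> {0..T}" for t using that T by (intro \<sigma>_pos) auto
  have "a T \<le> exp (K\<^sup>2 / \<epsilon> * odds T) * integral {0..T} (\<lambda>r. odds' r * fluct r \<omega>)"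
  proof (rule gronwall)
    have s0: "\<sigma> t \<noteq> 0" if "t \<in> {0..T}" for t using s[OF that] by simp
    have c\<sigma>: "continuous_on {0..T} \<sigma>" by (rule continuous_on_subset[OF \<sigma>_cont]) (use T in auto)
    show "continuous_on {0..T} a" unfolding a_def
      by (intro continuous_on_norm continuous_on_scaleR continuous_on_divide continuous_on_diff continuous_on_const c(1,2) c\<sigma> ballI s0)
    show cF: "continuous_on {0..T} (\<lambda>r. fluct r \<omega>)" unfolding fluct_def by (intro continuous_on_norm continuous_on_diff c(4,6))
    show "0 \<le> K\<^sup>2 / \<epsilon>" using \<epsilon>_pos by simp
    show "odds 0 = 0" by (rule odds_0)
    fix t assume t: "t \<in> {0..T}"
    hence t1: "t < 1" "0 \<le> t" and sub: "{0..t} \<subseteq> {0..T}" using T by auto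
    note c' = good_path_cont[OF g t1(1)]
    have c\<omega>: "continuous_on {0..t} odds'" "continuous_on {0..t} (\<lambda>r. fluct r \<omega>)"
      by (rule continuous_on_subset[OF cont' sub] continuous_on_subset[OF cF sub])+
    have ca: "continuous_on {0..t} a" by (rule continuous_on_subset[OF \<open>continuous_on {0..T} a\<close> sub])
    have "a t = norm (integral {0..t} (\<lambda>r. odds' r *\<^sub>R (sample_mean \<omega> r (XN r \<omega>) - SV.post_mean r (X r \<omega>))))"
      by (simp only: a_def difference_in_odds_time[OF g t1(2,1)])
    also have "\<dots> \<le> integral {0..t} (\<lambda>r. odds' r * (K\<^sup>2 / \<epsilon> * a r + fluct r \<omega>))"
    proof (rule integral_norm_bound_integral)
      show "(\<lambda>r. odds' r *\<^sub>R (sample_mean \<omega> r (XN r \<omega>) - SV.post_mean r (X r \<omega>))) integrable_on {0..t}"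
        by (intro integrable_continuous_real continuous_on_scaleR continuous_on_diff c\<omega>(1) c'(4,5))
      show "(\<lambda>r. odds' r * (K\<^sup>2 / \<epsilon> * a r + fluct r \<omega>)) integrable_on {0..t}"
        by (intro integrable_continuous_real continuous_on_mult continuous_on_add continuous_on_const ca c\<omega>)
      fix r assume r: "r \<in> {0..t}"
      hence r1: "r \<in> {0..<1}" and rT: "r \<in> {0..T}" using t1 sub by auto
      have "norm (sample_mean \<omega> r (XN r \<omega>) - sample_mean \<omega> r (X r \<omega>))
          \<le> K\<^sup>2 * (\<beta> r / (ell r * \<sigma> r)) * norm (XN r \<omega> - X r \<omega>)"
        by (rule emp_mean_lipschitz[OF N_pos y r1])
      also have "\<dots> = K\<^sup>2 * (\<beta> r / ell r) * a r" using s[OF rT] by (simp add: a_def)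
      also have "\<dots> \<le> K\<^sup>2 * (1 / \<epsilon>) * a r"
        using slope_le[OF r1] by (intro mult_right_mono mult_left_mono) (auto simp: a_def)
      finally have "norm (sample_mean \<omega> r (XN r \<omega>) - SV.post_mean r (X r \<omega>)) \<le> K\<^sup>2 / \<epsilon> * a r + fluct r \<omega>"
        using norm_triangle_ineq[of "sample_mean \<omega> r (XN r \<omega>) - sample_mean \<omega> r (X r \<omega>)"
            "sample_mean \<omega> r (X r \<omega>) - SV.post_mean r (X r \<omega>)"]
        by (simp add: fluct_def)
      thus "norm (odds' r *\<^sub>R (sample_mean \<omega> r (XN r \<omega>) - SV.post_mean r (X r \<omega>))) \<le> odds' r * (K\<^sup>2 / \<epsilon> * a r + fluct r \<omega>)"
        using nonneg'[OF rT] by (simp add: mult_left_mono)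
    qed
    finally show "a t \<le> integral {0..t} (\<lambda>r. odds' r * (K\<^sup>2 / \<epsilon> * a r + fluct r \<omega>))" .
  qed (auto simp: fluct_def)
  thus ?thesis by (simp add: a_def)
qed

end

section \<open>The ideal diffusion is a function of the noise\<close>

lemma (in prob_space) independent_distr_pair:
  assumes "independent M S Y T Z"
  shows "distr M (S \<Otimes>\<^sub>M T) (\<lambda>\<omega>. (Y \<omega>, Z \<omega>)) = distr M S Y \<Otimes>\<^sub>M distr M T Z"
proof -
  have [measurable]: "Y \<in> measurable M S" "Z \<in> measurable M T"
    and ind: "indep_set {Y -` A \<inter> space M | A. A \<in> sets S} {Z -` B \<inter> space M | B. B \<in> sets T}"
    using assms by (auto simp: independent_def)
  interpret Y: prob_space "distr M S Y" by (rule prob_space_distr) measurable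
  interpret Z: prob_space "distr M T Z" by (rule prob_space_distr) measurable
  show ?thesis
  proof (rule pair_measure_eqI[symmetric])
    show "sigma_finite_measure (distr M S Y)" "sigma_finite_measure (distr M T Z)" by unfold_locales
    show "sets (distr M S Y \<Otimes>\<^sub>M distr M T Z) = sets (distr M (S \<Otimes>\<^sub>M T) (\<lambda>\<omega>. (Y \<omega>, Z \<omega>)))"
      by (simp cong: sets_pair_measure_cong)
    fix A B assume "A \<in> sets (distr M S Y)" "B \<in> sets (distr M T Z)"
    hence AB [measurable]: "A \<in> sets S" "B \<in> sets T" by auto
    have "prob ((Y -` A \<inter> space M) \<inter> (Z -` B \<inter> space M)) = prob (Y -` A \<inter> space M) * prob (Z -` B \<inter> space M)"
      using AB by (intro indep_setD[OF ind]) auto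
    moreover have "(Y -` A \<inter> space M) \<inter> (Z -` B \<inter> space M) = (\<lambda>\<omega>. (Y \<omega>, Z \<omega>)) -` (A \<times> B) \<inter> space M" by auto
    ultimately show "emeasure (distr M S Y) A * emeasure (distr M T Z) B
        = emeasure (distr M (S \<Otimes>\<^sub>M T) (\<lambda>\<omega>. (Y \<omega>, Z \<omega>))) (A \<times> B)"
      by (simp add: emeasure_distr emeasure_eq_measure ennreal_mult)
  qed
qed

lemma step_integral_path:
  "steps_in t cs \<Longrightarrow> step_integral W cs \<omega> = step_integral (\<lambda>t p. p t) cs (path W \<omega>)"
proof (induction cs)
  case (Cons x cs)
  thus ?case by (cases x) (simp add: step_fun_simps path_def)
qed (simp add: step_fun_simps)

lemma step_integral_coordinates:
  "steps_in t cs \<Longrightarrow> (step_integral (\<lambda>t p. p t) cs :: (real \<Rightarrow> 'a::euclidean_space) \<Rightarrow> 'a) \<in> borel_measurable path_space"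
proof (induction cs)
  case (Cons x cs)
  obtain c a b where x: "x = (c, a, b)" by (cases x) auto
  have [measurable]: "(\<lambda>p :: real \<Rightarrow> 'a. p a) \<in> borel_measurable path_space" "(\<lambda>p :: real \<Rightarrow> 'a. p b) \<in> borel_measurable path_space"
    using Cons.prems x by (auto intro!: measurable_component_singleton)
  have [measurable]: "(step_integral (\<lambda>t p. p t) cs :: (real \<Rightarrow> 'a) \<Rightarrow> 'a) \<in> borel_measurable path_space"
    using Cons x by auto
  have "(step_integral (\<lambda>t p. p t) (x # cs) :: (real \<Rightarrow> 'a) \<Rightarrow> 'a)
      = (\<lambda>p. c *\<^sub>R (p b - p a) + step_integral (\<lambda>t p. p t) cs p)"
    by (auto simp: x step_fun_simps)
  thus ?case by simp
qed (simp add: step_fun_simps[abs_def])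

context bounded_coupling
begin

text \<open>Only up to null sets, because Wiener integrals and solutions are determined only almost
  surely.\<close>
definition noise_determined :: "('w \<Rightarrow> 'a) \<Rightarrow> bool" where
  "noise_determined Z \<longleftrightarrow>
     (\<exists>H\<in>borel_measurable (borel \<Otimes>\<^sub>M path_space). AE \<omega> in M. Z \<omega> = H (\<xi> \<omega>, path W \<omega>))"

lemma noise_determined_comp2:
  assumes Y: "noise_determined Y" and Z: "noise_determined Z"
    and f [measurable]: "(\<lambda>(x, y). f x y) \<in> borel_measurable (borel \<Otimes>\<^sub>M borel)"
  shows "noise_determined (\<lambda>\<omega>. f (Y \<omega>) (Z \<omega>))"
proof -
  obtain H where H [measurable]: "H \<in> borel_measurable (borel \<Otimes>\<^sub>M path_space)" "AE \<omega> in M. Y \<omega> = H (\<xi> \<omega>, path W \<omega>)"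
    using Y by (auto simp: noise_determined_def)
  obtain G where G [measurable]: "G \<in> borel_measurable (borel \<Otimes>\<^sub>M path_space)" "AE \<omega> in M. Z \<omega> = G (\<xi> \<omega>, path W \<omega>)"
    using Z by (auto simp: noise_determined_def)
  have "(\<lambda>x. (\<lambda>(x, y). f x y) (H x, G x)) \<in> borel_measurable (borel \<Otimes>\<^sub>M path_space)" by measurable
  moreover have "AE \<omega> in M. f (Y \<omega>) (Z \<omega>) = (\<lambda>(x, y). f x y) (H (\<xi> \<omega>, path W \<omega>), G (\<xi> \<omega>, path W \<omega>))"
    using H(2) G(2) by eventually_elim simp
  ultimately show ?thesis unfolding noise_determined_def by (intro bexI[of _ "\<lambda>x. (\<lambda>(x, y). f x y) (H x, G x)"])
qed

lemma noise_determined_comp: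
  assumes "noise_determined Y" and [measurable]: "f \<in> borel_measurable borel"
  shows "noise_determined (\<lambda>\<omega>. f (Y \<omega>))"
  using noise_determined_comp2[OF assms(1,1), of "\<lambda>x _. f x"] by simp

lemma noise_determined_add:
  "noise_determined Y \<Longrightarrow> noise_determined Z \<Longrightarrow> noise_determined (\<lambda>\<omega>. Y \<omega> + Z \<omega>)"
  by (rule noise_determined_comp2[where f = "\<lambda>x y. x + y"]) auto

lemma noise_determined_const: "noise_determined (\<lambda>_. c)"
  unfolding noise_determined_def by (intro bexI[of _ "\<lambda>_. c"]) auto

lemma noise_determined_scale: "noise_determined Y \<Longrightarrow> noise_determined (\<lambda>\<omega>. c *\<^sub>R Y \<omega>)"
  by (rule noise_determined_comp) auto

lemma noise_determined_sum:
  "(\<And>k. k < n \<Longrightarrow> noise_determined (Y k)) \<Longrightarrow> noise_determined (\<lambda>\<omega>. \<Sum>k<n::nat. Y k \<omega>)"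
  by (induction n) (simp_all add: noise_determined_const noise_determined_add)

lemma noise_determined_\<xi>: "noise_determined \<xi>"
  unfolding noise_determined_def by (intro bexI[of _ fst]) auto

lemma noise_determined_limit:
  assumes Z: "\<And>n. noise_determined (Z n)" and lim: "AE \<omega> in M. (\<lambda>n. Z n \<omega>) \<longlonglongrightarrow> Y \<omega>"
  shows "noise_determined Y"
proof -
  obtain H where H: "\<And>n. H n \<in> borel_measurable (borel \<Otimes>\<^sub>M path_space)" "\<And>n. AE \<omega> in M. Z n \<omega> = H n (\<xi> \<omega>, path W \<omega>)"
    using Z unfolding noise_determined_def by metis
  have "(\<lambda>x. lim (\<lambda>n. H n x)) \<in> borel_measurable (borel \<Otimes>\<^sub>M path_space)"
    by (rule borel_measurable_lim_metric) (rule H(1))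
  moreover have "AE \<omega> in M. \<forall>n. Z n \<omega> = H n (\<xi> \<omega>, path W \<omega>)" using H(2) by (simp add: AE_all_countable)
  hence "AE \<omega> in M. Y \<omega> = lim (\<lambda>n. H n (\<xi> \<omega>, path W \<omega>))"
    using lim by eventually_elim (simp add: limI)
  ultimately show ?thesis unfolding noise_determined_def by (intro bexI[of _ "\<lambda>x. lim (\<lambda>n. H n x)"])
qed

lemma noise_determined_wiener:
  assumes J: "wiener_integral M W g t J"
  shows "noise_determined J"
proof -
  obtain cs where cs: "\<And>n. steps_in t (cs n)"
    "(\<lambda>n. \<integral>\<^sup>+s\<in>{0..t}. ennreal ((step_fun (cs n) s - g s)\<^sup>2) \<partial>lborel) \<longlonglongrightarrow> 0"
    "(\<lambda>n. \<integral>\<^sup>+\<omega>. ennreal ((norm (step_integral W (cs n) \<omega> - J \<omega>))\<^sup>2) \<partial>M) \<longlonglongrightarrow> 0"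
    by (rule SN.wiener_integralE[OF J]) (rule that)
  obtain r where r: "strict_mono r" "AE \<omega> in M. (\<lambda>n. step_integral W (cs (r n)) \<omega>) \<longlonglongrightarrow> J \<omega>"
    by (rule AE_convergent_subseq[of "\<lambda>n. step_integral W (cs n)" J])
       (use cs(3) SN.step_integral_rv[OF cs(1)] SN.wiener_integral_rv[OF J] in auto)
  show ?thesis
  proof (rule noise_determined_limit[OF _ r(2)])
    fix n
    note [measurable] = step_integral_coordinates[OF cs(1), of "r n", where 'a = 'a]
    show "noise_determined (\<lambda>\<omega>. step_integral W (cs (r n)) \<omega>)"
      unfolding noise_determined_def
      by (intro bexI[of _ "\<lambda>x. step_integral (\<lambda>t p. p t) (cs (r n)) (snd x)"])
         (auto simp: step_integral_path[OF cs(1), of W])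
  qed
qed

lemma noise_determined_noise:
  assumes I: "\<And>t. t \<in> {0..<1} \<Longrightarrow> wiener_integral M W SN.vol t (I t)" "AE \<omega> in M. good_path I \<omega>"
    and T: "0 \<le> T" "T < 1"
  shows "noise_determined (SN.noise I T)"
proof (rule noise_determined_limit[where Z = "\<lambda>n. SN.noise_sum I T (Suc n)"])
  show "AE \<omega> in M. (\<lambda>n. SN.noise_sum I T (Suc n) \<omega>) \<longlonglongrightarrow> SN.noise I T \<omega>"
    using I(2)
  proof eventually_elim
    case (elim \<omega>)
    show ?case using elim good_path_cont(3)[OF elim T(2)]
      by (intro LIMSEQ_Suc SN.noise_sum_tendsto T) (auto simp: good_path_def)
  qed
  fix n
  have "wiener_integral M W SN.vol (mesh T (Suc n) k) (I (mesh T (Suc n) k))" if "k \<le> Suc n" for k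
    using mesh_in[OF T(1), of "Suc n" k] that T by (intro I(1)) auto
  hence *: "noise_determined (I (mesh T (Suc n) k))" if "k \<le> Suc n" for k
    using that noise_determined_wiener by blast
  have "noise_determined (\<lambda>\<omega>. \<Sum>k<Suc n. (1 / \<sigma> (mesh T (Suc n) k)) *\<^sub>R (I (mesh T (Suc n) (Suc k)) \<omega> + (-1) *\<^sub>R I (mesh T (Suc n) k) \<omega>))"
    by (intro noise_determined_sum noise_determined_scale noise_determined_add *) auto
  moreover have "(\<lambda>\<omega>. \<Sum>k<Suc n. (1 / \<sigma> (mesh T (Suc n) k)) *\<^sub>R (I (mesh T (Suc n) (Suc k)) \<omega> + (-1) *\<^sub>R I (mesh T (Suc n) k) \<omega>))
      = SN.noise_sum I T (Suc n)"
    by (intro ext) (simp add: SN.noise_sum_def del: sum.lessThan_Suc)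
  ultimately show "noise_determined (SN.noise_sum I T (Suc n))" by (simp only:)
qed

text \<open>Strong solution: the Euler scheme in odds time, whose steps are explicit functions of the
  noise, converges to the drift part of \<open>X\<close>.\<close>
lemma noise_determined_X:
  assumes I: "\<And>t. t \<in> {0..<1} \<Longrightarrow> wiener_integral M W SN.vol t (I t)" "AE \<omega> in M. good_path I \<omega>"
    and T: "0 \<le> T" "T < 1"
  shows "noise_determined (X T)"
proof -
  interpret smooth_clock T odds odds' by (rule smooth_clock_odds[OF T])
  define \<phi> where "\<phi> \<omega> r d = SV.post_mean r (\<sigma> r *\<^sub>R (\<xi> \<omega> + SN.noise I r \<omega> + d))" for \<omega> r d
  have E: "noise_determined (\<lambda>\<omega>. euler (\<phi> \<omega>) (Suc n) k)" if "k \<le> Suc n" for n k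
    using that
  proof (induction k)
    case (Suc k)
    let ?r = "mesh T (Suc n) k"
    have r: "?r \<in> {0..<1}" using mesh_in[OF T(1), of "Suc n" k] Suc.prems T by auto
    have "noise_determined (\<lambda>\<omega>. \<sigma> ?r *\<^sub>R (\<xi> \<omega> + SN.noise I ?r \<omega> + euler (\<phi> \<omega>) (Suc n) k))"
      using Suc r by (intro noise_determined_scale noise_determined_add noise_determined_\<xi> noise_determined_noise[OF I]) auto
    hence "noise_determined (\<lambda>\<omega>. \<phi> \<omega> ?r (euler (\<phi> \<omega>) (Suc n) k))"
      unfolding \<phi>_def by (rule noise_determined_comp) (intro borel_measurable_continuous_onI SV.post_mean_cont r)
    thus ?case using Suc unfolding euler.simps
      by (intro noise_determined_add noise_determined_scale) simp_all
  qed (simp add: noise_determined_const)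
  have "noise_determined (\<lambda>\<omega>. integral {0..T} (\<lambda>r. odds' r *\<^sub>R SV.post_mean r (X r \<omega>)))"
  proof (rule noise_determined_limit[where Z = "\<lambda>n \<omega>. euler (\<phi> \<omega>) (Suc n) (Suc n)"])
    show "AE \<omega> in M. (\<lambda>n. euler (\<phi> \<omega>) (Suc n) (Suc n)) \<longlonglongrightarrow> integral {0..T} (\<lambda>r. odds' r *\<^sub>R SV.post_mean r (X r \<omega>))"
      using I(2)
    proof eventually_elim
      case (elim \<omega>)
      define D where "D t = integral {0..t} (\<lambda>r. odds' r *\<^sub>R SV.post_mean r (X r \<omega>))" for t
      have eq: "\<phi> \<omega> r (D r) = SV.post_mean r (X r \<omega>)" if r: "r \<in> {0..T}" for r
      proof -
        have "(1 / \<sigma> r) *\<^sub>R X r \<omega> = \<xi> \<omega> + SN.noise I r \<omega> + D r"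
          unfolding D_def by (rule X_in_odds_time[OF elim]) (use r T in auto)
        hence "\<sigma> r *\<^sub>R (\<xi> \<omega> + SN.noise I r \<omega> + D r) = \<sigma> r *\<^sub>R ((1 / \<sigma> r) *\<^sub>R X r \<omega>)" by (rule arg_cong[OF sym])
        also have "\<dots> = X r \<omega>" using \<sigma>_pos[of r] r T by simp
        finally show ?thesis by (simp add: \<phi>_def)
      qed
      have "(\<lambda>n. euler (\<phi> \<omega>) n n) \<longlonglongrightarrow> D T"
      proof (rule euler_tendsto[where L = "K\<^sup>2 / \<epsilon>"])
        show "D t = integral {0..t} (\<lambda>r. odds' r *\<^sub>R \<phi> \<omega> r (D r))" if "t \<in> {0..T}" for t
          unfolding D_def[of t] by (rule integral_cong, subst eq) (use that in auto)
        show "continuous_on {0..T} (\<lambda>r. \<phi> \<omega> r (D r))"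
          by (rule continuous_on_eq[OF good_path_cont(4)[OF elim T(2)]]) (simp add: eq)
        show "norm (\<phi> \<omega> r x - \<phi> \<omega> r y) \<le> K\<^sup>2 / \<epsilon> * norm (x - y)" if r: "r \<in> {0..T}" for r x y
        proof -
          have r1: "r \<in> {0..<1}" using r T by auto
          have s: "\<sigma> r > 0" using r1 by (intro \<sigma>_pos) auto
          have "norm (\<phi> \<omega> r x - \<phi> \<omega> r y) \<le> K\<^sup>2 * (\<beta> r / (ell r * \<sigma> r)) * norm (\<sigma> r *\<^sub>R (\<xi> \<omega> + SN.noise I r \<omega> + x) - \<sigma> r *\<^sub>R (\<xi> \<omega> + SN.noise I r \<omega> + y))"
            unfolding \<phi>_def by (rule SV.post_mean_lipschitz[OF r1])
          also have "\<sigma> r *\<^sub>R (\<xi> \<omega> + SN.noise I r \<omega> + x) - \<sigma> r *\<^sub>R (\<xi> \<omega> + SN.noise I r \<omega> + y) = \<sigma> r *\<^sub>R (x - y)"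
            by (simp add: algebra_simps)
          also have "K\<^sup>2 * (\<beta> r / (ell r * \<sigma> r)) * norm (\<sigma> r *\<^sub>R (x - y)) = K\<^sup>2 * (\<beta> r / ell r) * norm (x - y)"
            using s by simp
          also have "\<dots> \<le> K\<^sup>2 * (1 / \<epsilon>) * norm (x - y)"
            by (intro mult_right_mono mult_left_mono slope_le[OF r1]) auto
          finally show ?thesis by simp
        qed
      qed (use \<epsilon>_pos in auto)
      thus ?case unfolding D_def by (rule LIMSEQ_Suc)
    qed
  qed (rule E, simp)
  hence "noise_determined (\<lambda>\<omega>. \<sigma> T *\<^sub>R (\<xi> \<omega> + SN.noise I T \<omega> + integral {0..T} (\<lambda>r. odds' r *\<^sub>R SV.post_mean r (X r \<omega>))))"
    by (intro noise_determined_scale noise_determined_add noise_determined_\<xi> noise_determined_noise[OF I T])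
  then obtain H where H: "H \<in> borel_measurable (borel \<Otimes>\<^sub>M path_space)"
    "AE \<omega> in M. \<sigma> T *\<^sub>R (\<xi> \<omega> + SN.noise I T \<omega> + integral {0..T} (\<lambda>r. odds' r *\<^sub>R SV.post_mean r (X r \<omega>))) = H (\<xi> \<omega>, path W \<omega>)"
    unfolding noise_determined_def by blast
  have "AE \<omega> in M. X T \<omega> = H (\<xi> \<omega>, path W \<omega>)"
    using H(2) I(2)
  proof eventually_elim
    case (elim \<omega>)
    have "X T \<omega> = \<sigma> T *\<^sub>R ((1 / \<sigma> T) *\<^sub>R X T \<omega>)" using \<sigma>_pos[OF T] by simp
    thus ?case unfolding X_in_odds_time[OF elim(2) T] using elim(1) by (rule trans)
  qed
  thus ?thesis using H(1) unfolding noise_determined_def by blast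
qed

abbreviation "sample \<omega> \<equiv> \<lambda>i\<in>{1..N}. \<eta>s i \<omega>"
abbreviation "sample_space \<equiv> PiM {1..N} (\<lambda>_. borel :: 'a measure)"

lemma sample_rv [measurable]: "sample \<in> measurable M sample_space"
  using \<eta>s_rv by (intro measurable_restrict) auto

text \<open>Fubini's theorem: bounds over the sample at a fixed point may be integrated along \<open>Z\<close>.\<close>
lemma nn_integral_noise_determined_le:
  assumes Z: "noise_determined Z"
    and F [measurable]: "F \<in> borel_measurable (borel \<Otimes>\<^sub>M sample_space)"
    and g [measurable]: "g \<in> borel_measurable borel"
    and le: "\<And>x. (\<integral>\<^sup>+\<omega>. F (x, sample \<omega>) \<partial>M) \<le> (g x :: ennreal)"
  shows "(\<integral>\<^sup>+\<omega>. F (Z \<omega>, sample \<omega>) \<partial>M) \<le> (\<integral>\<^sup>+\<omega>. g (Z \<omega>) \<partial>M)"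
proof -
  let ?S = "borel \<Otimes>\<^sub>M path_space" and ?n = "\<lambda>\<omega>. (\<xi> \<omega>, path W \<omega>)"
  obtain H where H [measurable]: "H \<in> borel_measurable ?S" and eq: "AE \<omega> in M. Z \<omega> = H (?n \<omega>)"
    using Z by (auto simp: noise_determined_def)
  have n [measurable]: "?n \<in> measurable M ?S" using noise_copies_indep by (simp add: independent_def)
  interpret A: prob_space "distr M ?S ?n" by (rule prob_space_distr) measurable
  interpret B: prob_space "distr M sample_space sample" by (rule prob_space_distr) measurable
  have "(\<integral>\<^sup>+\<omega>. F (Z \<omega>, sample \<omega>) \<partial>M) = (\<integral>\<^sup>+\<omega>. F (H (?n \<omega>), sample \<omega>) \<partial>M)"
    using eq by (intro nn_integral_cong_AE) (auto elim: eventually_mono)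
  also have "\<dots> = (\<integral>\<^sup>+x. F (H (fst x), snd x) \<partial>distr M (?S \<Otimes>\<^sub>M sample_space) (\<lambda>\<omega>. (?n \<omega>, sample \<omega>)))"
  proof -
    have "(\<lambda>\<omega>. (?n \<omega>, sample \<omega>)) \<in> measurable M (?S \<Otimes>\<^sub>M sample_space)"
      "(\<lambda>x. F (H (fst x), snd x)) \<in> borel_measurable (distr M (?S \<Otimes>\<^sub>M sample_space) (\<lambda>\<omega>. (?n \<omega>, sample \<omega>)))"
      by measurable
    from nn_integral_distr[OF this] show ?thesis by simp
  qed
  also have "\<dots> = (\<integral>\<^sup>+x. F (H (fst x), snd x) \<partial>(distr M ?S ?n \<Otimes>\<^sub>M distr M sample_space sample))"
    by (simp only: independent_distr_pair[OF noise_copies_indep])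
  also have "\<dots> = (\<integral>\<^sup>+a. \<integral>\<^sup>+b. F (H a, b) \<partial>distr M sample_space sample \<partial>distr M ?S ?n)"
  proof -
    have "sets (distr M ?S ?n \<Otimes>\<^sub>M distr M sample_space sample) = sets (?S \<Otimes>\<^sub>M sample_space)"
      by (intro sets_pair_measure_cong sets_distr)
    note eq = this
    have "(\<lambda>x. F (H (fst x), snd x)) \<in> borel_measurable (distr M ?S ?n \<Otimes>\<^sub>M distr M sample_space sample)"
      unfolding measurable_cong_sets[OF eq refl] by measurable
    from B.nn_integral_fst[OF this] show ?thesis by simp
  qed
  also have "\<dots> = (\<integral>\<^sup>+a. \<integral>\<^sup>+\<omega>. F (H a, sample \<omega>) \<partial>M \<partial>distr M ?S ?n)"
  proof (rule nn_integral_cong)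
    fix a assume "a \<in> space (distr M ?S ?n)"
    hence "(\<lambda>b. F (H a, b)) \<in> borel_measurable (distr M sample_space sample)" by measurable
    thus "(\<integral>\<^sup>+b. F (H a, b) \<partial>distr M sample_space sample) = (\<integral>\<^sup>+\<omega>. F (H a, sample \<omega>) \<partial>M)"
      by (rule nn_integral_distr[OF sample_rv])
  qed
  also have "\<dots> \<le> (\<integral>\<^sup>+a. g (H a) \<partial>distr M ?S ?n)" by (intro nn_integral_mono le)
  also have "\<dots> = (\<integral>\<^sup>+\<omega>. g (H (?n \<omega>)) \<partial>M)"
    by (rule nn_integral_distr) measurable
  also have "\<dots> = (\<integral>\<^sup>+\<omega>. g (Z \<omega>) \<partial>M)"
    using eq by (intro nn_integral_cong_AE) (auto elim: eventually_mono)
  finally show ?thesis .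
qed

end

section \<open>Fluctuations of the empirical conditional mean\<close>

lemma powr_sum_le:
  fixes a :: "'b \<Rightarrow> real"
  assumes J: "finite J" "J \<noteq> {}" and a: "\<And>j. j \<in> J \<Longrightarrow> a j \<ge> 0" and p: "p \<ge> 0"
  shows "(\<Sum>j\<in>J. a j) powr p \<le> real (card J) powr p * (\<Sum>j\<in>J. a j powr p)"
proof -
  have "Max (a ` J) \<in> a ` J" using J by (intro Max_in) auto
  then obtain i where i: "i \<in> J" "Max (a ` J) = a i" by auto
  have k: "i \<in> J" "\<And>j. j \<in> J \<Longrightarrow> a j \<le> a i"
    using i J by (auto simp flip: i(2))
  have "(\<Sum>j\<in>J. a j) \<le> real (card J) * a i" using k(2) by (rule sum_bounded_above)
  hence "(\<Sum>j\<in>J. a j) powr p \<le> (real (card J) * a i) powr p"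
    using a p by (intro powr_mono2 sum_nonneg) auto
  also have "\<dots> = real (card J) powr p * a i powr p" using a[OF k(1)] by (simp add: powr_mult)
  also have "\<dots> \<le> real (card J) powr p * (\<Sum>j\<in>J. a j powr p)"
    using k(1) J by (intro mult_left_mono member_le_sum) auto
  finally show ?thesis .
qed

lemma powr_le_exp:
  fixes x p :: real assumes "x \<ge> 0" "p > 0" shows "x powr p \<le> p powr p * exp x"
proof -
  have "x / p \<le> exp (x / p)" using exp_ge_add_one_self[of "x / p"] by linarith
  hence "(x / p) powr p \<le> exp (x / p) powr p" using assms by (intro powr_mono2) auto
  also have "\<dots> = exp x" using assms by (simp add: powr_def)
  finally have "x powr p / p powr p \<le> exp x" using assms by (simp add: powr_divide)
  thus ?thesis using assms by (simp add: field_simps)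
qed

lemma (in bounded_vector) small_ball:
  assumes r: "r > 0"
  shows "\<exists>q>0. q \<le> 1 \<and> (AE \<omega>' in P. q \<le> prob {\<omega>\<in>space P. norm (\<eta> \<omega> - \<eta> \<omega>') \<le> r})"
proof -
  have "compact (cball (0::'a) K)" by simp
  hence "\<forall>e>0. \<exists>k. finite k \<and> k \<subseteq> cball (0::'a) K \<and> cball 0 K \<subseteq> (\<Union>x\<in>k. ball x e)"
    by (intro seq_compact_imp_totally_bounded compact_imp_seq_compact)
  then obtain k where k: "finite k" "cball (0::'a) K \<subseteq> (\<Union>x\<in>k. ball x (r / 2))"
    using r half_gt_zero by metis
  define E where "E x = {\<omega>\<in>space P. \<eta> \<omega> \<in> ball x (r / 2)}" for x
  have E [measurable]: "E x \<in> events" for x unfolding E_def mem_ball by measurable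
  define q where "q = Min (insert 1 (prob ` E ` {x\<in>k. prob (E x) > 0}))"
  have fin: "finite (insert 1 (prob ` E ` {x\<in>k. prob (E x) > 0}))" using k by simp
  have "AE \<omega>' in P. \<forall>x\<in>k. prob (E x) > 0 \<or> \<omega>' \<notin> E x"
  proof (subst AE_finite_all[OF k(1)], intro ballI)
    fix x
    show "AE \<omega>' in P. prob (E x) > 0 \<or> \<omega>' \<notin> E x"
    proof (cases "prob (E x) > 0")
      case False
      hence "prob (E x) = 0" by (simp add: not_less measure_le_0_iff)
      hence "E x \<in> null_sets P" by (simp add: null_sets_def emeasure_eq_measure)
      thus ?thesis by (auto dest: AE_not_in elim: eventually_mono)
    qed simp
  qed
  hence "AE \<omega>' in P. q \<le> prob {\<omega>\<in>space P. norm (\<eta> \<omega> - \<eta> \<omega>') \<le> r}"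
    using bounded AE_space
  proof eventually_elim
    case (elim \<omega>')
    then obtain x where x: "x \<in> k" "\<eta> \<omega>' \<in> ball x (r / 2)" using k(2) by (force simp: dist_norm)
    hence pos: "prob (E x) > 0" using elim by (auto simp: E_def)
    have "q \<le> prob (E x)" unfolding q_def using fin x pos by (intro Min_le) auto
    also have "\<dots> \<le> prob {\<omega>\<in>space P. norm (\<eta> \<omega> - \<eta> \<omega>') \<le> r}"
    proof (rule finite_measure_mono)
      show "E x \<subseteq> {\<omega>\<in>space P. norm (\<eta> \<omega> - \<eta> \<omega>') \<le> r}"
      proof
        fix \<omega> assume w: "\<omega> \<in> E x"
        have "dist (\<eta> \<omega>) (\<eta> \<omega>') \<le> dist x (\<eta> \<omega>) + dist x (\<eta> \<omega>')" by (metis dist_commute dist_triangle)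
        thus "\<omega> \<in> {\<omega>\<in>space P. norm (\<eta> \<omega> - \<eta> \<omega>') \<le> r}"
          using w x by (auto simp: E_def dist_norm)
      qed
    qed measurable
    finally show ?case .
  qed
  moreover have "q > 0" "q \<le> 1" unfolding q_def using fin by (auto simp: Min_gr_iff intro: Min_le)
  ultimately show ?thesis by blast
qed

context schedule_vector
begin

lemma kern_comparison:
  assumes t: "t \<in> {0..<1}" and y: "norm y \<le> K" "norm y' \<le> K" "norm (y - y') \<le> r"
  shows "kern t x y' \<le> exp (\<beta> t * r * (norm x + \<beta> t * K) / (ell t * \<sigma> t)) * kern t x y"
proof -
  have s: "ell t * \<sigma> t > 0" by (rule ell_\<sigma>_pos[OF t])
  have b: "\<beta> t \<ge> 0" using \<beta>_range[of t] t by simp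
  define b where "b = \<beta> t"
  have "(norm (x - b *\<^sub>R y))\<^sup>2 - (norm (x - b *\<^sub>R y'))\<^sup>2 = 2 * ((b *\<^sub>R (y' - y)) \<bullet> x) + (b *\<^sub>R (y - y')) \<bullet> (b *\<^sub>R (y + y'))"
    by (simp add: power2_norm_eq_inner inner_diff inner_add inner_commute algebra_simps)
  also have "\<dots> \<le> 2 * (norm (b *\<^sub>R (y' - y)) * norm x) + norm (b *\<^sub>R (y - y')) * norm (b *\<^sub>R (y + y'))"
    by (intro add_mono mult_left_mono norm_cauchy_schwarz) auto
  also have "\<dots> = b * norm (y - y') * (2 * norm x + b * norm (y + y'))"
  proof -
    have n: "norm (b *\<^sub>R (y' - y)) = b * norm (y - y')" "norm (b *\<^sub>R (y - y')) = b * norm (y - y')"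
      "norm (b *\<^sub>R (y + y')) = b * norm (y + y')"
      using b by (simp_all add: b_def norm_minus_commute)
    show ?thesis unfolding n by (simp add: algebra_simps)
  qed
  also have "\<dots> \<le> b * r * (2 * norm x + b * (2 * K))"
    using b y norm_triangle_ineq[of y y'] by (intro mult_mono add_mono mult_left_mono) (auto simp: b_def intro!: add_nonneg_nonneg mult_nonneg_nonneg order_trans[OF norm_ge_zero y(3)])
  finally have "(norm (x - b *\<^sub>R y))\<^sup>2 - (norm (x - b *\<^sub>R y'))\<^sup>2 \<le> 2 * (b * r * (norm x + b * K))"
    by (simp add: algebra_simps)
  hence "((norm (x - b *\<^sub>R y))\<^sup>2 - (norm (x - b *\<^sub>R y'))\<^sup>2) / (2 * (ell t * \<sigma> t)) \<le> 2 * (b * r * (norm x + b * K)) / (2 * (ell t * \<sigma> t))"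
    using s by (intro divide_right_mono) auto
  hence "- (norm (x - b *\<^sub>R y'))\<^sup>2 / (2 * (ell t * \<sigma> t)) \<le> b * r * (norm x + b * K) / (ell t * \<sigma> t) + - (norm (x - b *\<^sub>R y))\<^sup>2 / (2 * (ell t * \<sigma> t))"
    by (simp add: diff_divide_distrib)
  thus ?thesis by (simp add: kern_def b_def mult.assoc flip: exp_add)
qed

definition density_bound :: "real \<Rightarrow> real \<Rightarrow> real \<Rightarrow> 'a \<Rightarrow> real" where
  "density_bound q r t x = (1 / q) * exp (\<beta> t * r * (norm x + \<beta> t * K) / (ell t * \<sigma> t))"

text \<open>The density of the conditional law of \<open>\<eta>\<close> with respect to its law. It need not be bounded
  as \<open>t\<close> tends to 1, but its exponential rate is as small as one likes: the kernel changes by a small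
  factor over a small ball, and by compactness almost every such ball has mass at least \<open>q\<close>.\<close>
lemma kern_density:
  assumes t: "t \<in> {0..<1}" and q: "q > 0" "AE \<omega>' in P. q \<le> prob {\<omega>\<in>space P. norm (\<eta> \<omega> - \<eta> \<omega>') \<le> r}"
  shows "AE \<omega>' in P. kern t x (\<eta> \<omega>') \<le> density_bound q r t x * expectation (\<lambda>\<omega>. kern t x (\<eta> \<omega>))"
  using q(2) bounded
proof eventually_elim
  case (elim \<omega>')
  define e where "e = exp (\<beta> t * r * (norm x + \<beta> t * K) / (ell t * \<sigma> t))"
  define S where "S = {\<omega>\<in>space P. norm (\<eta> \<omega> - \<eta> \<omega>') \<le> r}"
  have [measurable]: "S \<in> events" unfolding S_def by measurable
  have i: "integrable P (\<lambda>\<omega>. kern t x (\<eta> \<omega>))"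
    using weight_integrable_real[OF weight_kern[OF t], of "\<lambda>_. 1" 1 x] by simp
  have le: "kern t x (\<eta> \<omega>') * q \<le> kern t x (\<eta> \<omega>') * prob S"
    using elim kern_pos[of t x "\<eta> \<omega>'"] by (simp add: S_def)
  have iS: "integrable P (indicator S :: 'p \<Rightarrow> real)"
    by (rule integrable_real_indicator) (auto simp: less_top[symmetric])
  note le
  also have "kern t x (\<eta> \<omega>') * prob S = expectation (\<lambda>\<omega>. kern t x (\<eta> \<omega>') * indicator S \<omega>)" using iS by simp
  also have "\<dots> \<le> expectation (\<lambda>\<omega>. e * kern t x (\<eta> \<omega>))"
  proof (rule integral_mono_AE)
    show "AE \<omega> in P. kern t x (\<eta> \<omega>') * indicator S \<omega> \<le> e * kern t x (\<eta> \<omega>)"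
      using bounded
    proof eventually_elim
      case (elim \<omega>)
      show ?case
      proof (cases "\<omega> \<in> S")
        case True
        thus ?thesis using kern_comparison[OF t elim \<open>norm (\<eta> \<omega>') \<le> K\<close>, of r x] by (simp add: S_def e_def)
      qed (use kern_pos[of t x] in \<open>simp add: e_def less_imp_le\<close>)
    qed
  qed (use i iS in auto)
  also have "\<dots> = e * expectation (\<lambda>\<omega>. kern t x (\<eta> \<omega>))" by simp
  finally show ?case using q(1) by (simp add: density_bound_def e_def field_simps)
qed

text \<open>The summands whose averages control the fluctuation at \<open>x\<close>: the coordinates of the centred,
  normalized numerator, and, with index 0, the normalized denominator.\<close>
definition summand :: "real \<Rightarrow> 'a \<Rightarrow> 'a \<Rightarrow> 'a \<Rightarrow> real" where
  "summand t x j y = (let Z = expectation (\<lambda>\<omega>. kern t x (\<eta> \<omega>)) in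
     if j = 0 then 2 * K * (kern t x y / Z - 1) else kern t x y / Z * ((y - post_mean t x) \<bullet> j))"

lemma summand_rv: "summand t x j \<in> borel_measurable borel"
  unfolding summand_def Let_def kern_def by measurable

lemma summand_mean:
  assumes t: "t \<in> {0..<1}"
  shows "expectation (\<lambda>\<omega>. summand t x j (\<eta> \<omega>)) = 0"
proof -
  note w = weight_kern[OF t, of x]
  define Z where "Z = expectation (\<lambda>\<omega>. kern t x (\<eta> \<omega>))"
  have Z: "Z > 0" using weight_pos[OF w] by (simp add: Z_def)
  have i: "integrable P (\<lambda>\<omega>. kern t x (\<eta> \<omega>))" using weight_integrable_real[OF w, of "\<lambda>_. 1" 1] by simp
  show ?thesis
  proof (cases "j = 0")
    case True
    have "expectation (\<lambda>\<omega>. 2 * K * (kern t x (\<eta> \<omega>) / Z - 1)) = 2 * K * (expectation (\<lambda>\<omega>. kern t x (\<eta> \<omega>)) / Z - 1)"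
      using i by (simp add: prob_space)
    thus ?thesis using True Z by (simp add: summand_def Z_def[symmetric])
  next
    case False
    have i2: "integrable P (\<lambda>\<omega>. kern t x (\<eta> \<omega>) * (j \<bullet> \<eta> \<omega>))"
      by (rule weight_integrable_real[OF w _ inner_bound]) measurable
    have "expectation (\<lambda>\<omega>. kern t x (\<eta> \<omega>) / Z * ((\<eta> \<omega> - post_mean t x) \<bullet> j))
       = expectation (\<lambda>\<omega>. (1 / Z) * (kern t x (\<eta> \<omega>) * (j \<bullet> \<eta> \<omega>) - kern t x (\<eta> \<omega>) * (j \<bullet> post_mean t x)))"
      by (intro Bochner_Integration.integral_cong) (auto simp: inner_commute inner_diff_left algebra_simps diff_divide_distrib)
    also have "\<dots> = (1 / Z) * (Z * (j \<bullet> post_mean t x) - Z * (j \<bullet> post_mean t x))"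
      using i i2 wmean_inner[OF w, of j] by (simp add: Z_def post_mean_def)
    finally show ?thesis using False by (simp add: summand_def Z_def[symmetric])
  qed
qed

lemma summand_bound:
  assumes t: "t \<in> {0..<1}" and q: "0 < q" "q \<le> 1" "AE \<omega>' in P. q \<le> prob {\<omega>\<in>space P. norm (\<eta> \<omega> - \<eta> \<omega>') \<le> r}"
    and r: "r \<ge> 0" and j: "j \<in> insert 0 Basis"
  shows "AE \<omega> in P. \<bar>summand t x j (\<eta> \<omega>)\<bar> \<le> 2 * K * density_bound q r t x"
  using kern_density[OF t q(1,3), of x] bounded
proof eventually_elim
  case (elim \<omega>)
  define Z where "Z = expectation (\<lambda>\<omega>. kern t x (\<eta> \<omega>))"
  define B where "B = density_bound q r t x"
  have Z: "Z > 0" using weight_pos[OF weight_kern[OF t, of x]] by (simp add: Z_def)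
  have "0 \<le> \<beta> t * r * (norm x + \<beta> t * K) / (ell t * \<sigma> t)"
    using \<beta>_range[of t] t r K_nonneg ell_\<sigma>_pos[OF t] by (intro divide_nonneg_pos mult_nonneg_nonneg add_nonneg_nonneg) auto
  hence "1 * 1 \<le> B" unfolding B_def density_bound_def using q by (intro mult_mono) auto
  moreover have k: "0 \<le> kern t x (\<eta> \<omega>) / Z" "kern t x (\<eta> \<omega>) / Z \<le> B"
    using elim(1) Z kern_pos[of t x "\<eta> \<omega>"] by (simp_all add: Z_def B_def field_simps)
  ultimately have "\<bar>kern t x (\<eta> \<omega>) / Z - 1\<bar> \<le> B" by linarith
  moreover have "\<bar>kern t x (\<eta> \<omega>) / Z * ((\<eta> \<omega> - post_mean t x) \<bullet> j)\<bar> \<le> B * (2 * K)" if "j \<in> Basis"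
  proof -
    have "\<bar>(\<eta> \<omega> - post_mean t x) \<bullet> j\<bar> \<le> norm (\<eta> \<omega> - post_mean t x)" using that by (rule Basis_le_norm)
    also have "\<dots> \<le> 2 * K" using norm_triangle_ineq4[of "\<eta> \<omega>" "post_mean t x"] elim(2) norm_post_mean[OF t, of x] by linarith
    finally show ?thesis using k unfolding abs_mult by (intro mult_mono) auto
  qed
  moreover have "\<bar>2 * K * (kern t x (\<eta> \<omega>) / Z - 1)\<bar> \<le> 2 * K * B"
    using calculation K_nonneg unfolding abs_mult by (intro mult_mono) auto
  moreover have "j = 0 \<or> j \<noteq> 0 \<and> j \<in> Basis" using j nonzero_Basis by auto
  ultimately show ?case
    unfolding summand_def Let_def Z_def[symmetric] B_def[symmetric] by (auto simp: mult.commute)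
qed

text \<open>A ratio with a random denominator: on the event that the denominator is at least half of its
  mean it is harmless, and otherwise the trivial bound \<open>2 K\<close> is paid for by the deviation of the
  denominator.\<close>
lemma emp_mean_deviation:
  assumes t: "t \<in> {0..<1}" and N: "N \<ge> 1" and y: "\<And>i. i \<in> {1..N} \<Longrightarrow> norm (y i) \<le> K"
  shows "norm (emp_mean N y t x - post_mean t x)
       \<le> 2 * (\<Sum>j\<in>insert 0 Basis. \<bar>(1 / real N) * (\<Sum>i=1..N. summand t x j (y i))\<bar>)"
proof -
  define Z where "Z = expectation (\<lambda>\<omega>. kern t x (\<eta> \<omega>))"
  have Z: "Z > 0" using weight_pos[OF weight_kern[OF t, of x]] by (simp add: Z_def)
  define S where "S = (\<Sum>i=1..N. kern t x (y i))"
  have S: "S > 0" unfolding S_def using N kern_pos by (intro sum_pos) auto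
  define D where "D = S / (real N * Z)"
  have D: "D > 0" using S Z N by (simp add: D_def)
  define v where "v = emp_mean N y t x - post_mean t x"
  have sv: "(\<Sum>i=1..N. kern t x (y i) *\<^sub>R (y i - post_mean t x)) = S *\<^sub>R v"
    using S by (simp add: v_def S_def emp_mean_def scaleR_diff_right sum_subtractf scaleR_sum_left[symmetric])
  have A: "(1 / real N) * (\<Sum>i=1..N. summand t x j (y i)) = D * (v \<bullet> j)" if "j \<in> Basis" for j
  proof -
    have "j \<noteq> 0" using that nonzero_Basis by blast
    hence "(\<Sum>i=1..N. summand t x j (y i)) = (1 / Z) * ((\<Sum>i=1..N. kern t x (y i) *\<^sub>R (y i - post_mean t x)) \<bullet> j)"
      by (simp add: summand_def Z_def[symmetric] inner_sum_left sum_divide_distrib)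
    thus ?thesis unfolding sv by (simp add: D_def)
  qed
  have A0: "(1 / real N) * (\<Sum>i=1..N. summand t x 0 (y i)) = 2 * K * (D - 1)"
    using N Z by (simp add: summand_def Z_def[symmetric] D_def S_def sum_subtractf sum_distrib_left[symmetric] sum_divide_distrib[symmetric] field_simps)
  have l1: "D * norm v \<le> (\<Sum>j\<in>Basis. \<bar>(1 / real N) * (\<Sum>i=1..N. summand t x j (y i))\<bar>)"
  proof -
    have "D * norm v \<le> D * (\<Sum>j\<in>Basis. \<bar>v \<bullet> j\<bar>)" using D norm_le_l1[of v] by simp
    also have "\<dots> = (\<Sum>j\<in>Basis. D * \<bar>v \<bullet> j\<bar>)" by (rule sum_distrib_left)
    also have "\<dots> = (\<Sum>j\<in>Basis. \<bar>(1 / real N) * (\<Sum>i=1..N. summand t x j (y i))\<bar>)"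
      by (intro sum.cong refl) (simp only: A abs_mult abs_of_pos[OF D])
    finally show ?thesis .
  qed
  have split: "(\<Sum>j\<in>insert 0 Basis. \<bar>(1 / real N) * (\<Sum>i=1..N. summand t x j (y i))\<bar>)
      = \<bar>2 * K * (D - 1)\<bar> + (\<Sum>j\<in>Basis. \<bar>(1 / real N) * (\<Sum>i=1..N. summand t x j (y i))\<bar>)"
    by (subst sum.insert) (auto simp: A0 simp flip: A0)
  have "norm v \<le> 2 * (\<bar>2 * K * (D - 1)\<bar> + D * norm v)"
  proof (cases "D \<ge> 1 / 2")
    case True
    hence "1 / 2 * norm v \<le> D * norm v" by (intro mult_right_mono) auto
    hence "norm v \<le> 2 * (D * norm v)" by simp
    also have "\<dots> \<le> 2 * (\<bar>2 * K * (D - 1)\<bar> + D * norm v)" by simp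
    finally show ?thesis .
  next
    case False
    have "norm (emp_mean N y t x) \<le> K" by (rule norm_emp_mean[OF N y t])
    hence "norm v \<le> 2 * K"
      unfolding v_def using norm_triangle_ineq4[of "emp_mean N y t x" "post_mean t x"] norm_post_mean[OF t, of x] by linarith
    also have "\<dots> \<le> 2 * \<bar>2 * K * (D - 1)\<bar>"
      using False K_nonneg mult_left_mono[of "1 / 2" "\<bar>D - 1\<bar>" "4 * K"] by (simp add: abs_mult)
    also have "\<dots> \<le> 2 * (\<bar>2 * K * (D - 1)\<bar> + D * norm v)" using D by simp
    finally show ?thesis .
  qed
  also have "\<dots> \<le> 2 * (\<Sum>j\<in>insert 0 Basis. \<bar>(1 / real N) * (\<Sum>i=1..N. summand t x j (y i))\<bar>)"
    unfolding split using l1 by simp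
  finally show ?thesis by (simp only: v_def)
qed

end

section \<open>Moments of the fluctuations\<close>

definition moment_const :: "nat \<Rightarrow> real \<Rightarrow> real" where
  "moment_const d p = (2 * (real d + 1)) powr p * ((real d + 1) * (4 * p powr p))"

context bounded_coupling
begin

text \<open>Hoeffding's lemma for each summand; the factor \<open>\<surd>N / b\<close> normalizes the sum to unit scale.\<close>
lemma average_exp_moment:
  assumes f [measurable]: "f \<in> borel_measurable borel" and b: "b > 0"
    and bd: "AE \<omega> in P. \<bar>f (\<eta> \<omega>)\<bar> \<le> b" and mean: "P.expectation (\<lambda>\<omega>. f (\<eta> \<omega>)) = 0"
  shows "(\<integral>\<^sup>+\<omega>. ennreal (exp (sqrt (real N) / b * ((1 / real N) * (\<Sum>i=1..N. f (\<eta>s i \<omega>))))) \<partial>M) \<le> ennreal (exp (1 / 2))"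
proof -
  define l where "l = 1 / (b * sqrt (real N))"
  have N: "real N > 0" using N_pos by simp
  have l: "l > 0" using b N by (simp add: l_def)
  have sN: "sqrt (real N) * sqrt (real N) = real N" by simp
  define Y where "Y i \<omega> = ennreal (exp (l * f (\<eta>s i \<omega>)))" for i \<omega>
  have "indep_vars (\<lambda>_. borel) Y {1..N}"
    unfolding Y_def by (rule indep_vars_compose2[OF copies_indep]) measurable
  hence "(\<integral>\<^sup>+\<omega>. (\<Prod>i\<in>{1..N}. Y i \<omega>) \<partial>M) = (\<Prod>i\<in>{1..N}. \<integral>\<^sup>+\<omega>. Y i \<omega> \<partial>M)"
    by (intro indep_vars_nn_integral) auto
  also have "\<dots> \<le> (\<Prod>i\<in>{1..N}. ennreal (exp (l\<^sup>2 * (b - (- b))\<^sup>2 / 8)))"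
  proof (rule prod_mono_ennreal)
    fix i assume i: "i \<in> {1..N}"
    note [measurable] = \<eta>s_rv[OF i] \<eta>_rv
    interpret H: interval_bounded_random_variable M "\<lambda>\<omega>. f (\<eta>s i \<omega>)" "- b" b
    proof
      have "AE y in distr P borel \<eta>. \<bar>f y\<bar> \<le> b" using bd by (subst AE_distr_iff) auto
      hence "AE \<omega> in M. \<bar>f (\<eta>s i \<omega>)\<bar> \<le> b" unfolding copies_law[OF i, symmetric] by (subst (asm) AE_distr_iff) auto
      thus "AE \<omega> in M. f (\<eta>s i \<omega>) \<in> {- b..b}" by eventually_elim (auto simp: abs_le_iff)
    qed measurable
    have "expectation (\<lambda>\<omega>. f (\<eta>s i \<omega>)) = (\<integral>y. f y \<partial>distr M borel (\<eta>s i))" by (subst integral_distr) auto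
    also have "\<dots> = P.expectation (\<lambda>\<omega>. f (\<eta> \<omega>))" unfolding copies_law[OF i] by (subst integral_distr) auto
    finally have "expectation (\<lambda>\<omega>. f (\<eta>s i \<omega>)) = 0" using mean by simp
    from H.Hoeffdings_lemma_nn_integral_0[OF l this]
    show "(\<integral>\<^sup>+\<omega>. Y i \<omega> \<partial>M) \<le> ennreal (exp (l\<^sup>2 * (b - (- b))\<^sup>2 / 8))" by (simp add: Y_def)
  qed
  also have "\<dots> = ennreal (exp (1 / 2))"
  proof -
    have "real N * (l\<^sup>2 * (b - (- b))\<^sup>2 / 8) = 1 / 2"
      using b N sN by (simp add: l_def power_divide power_mult_distrib power2_eq_square field_simps)
    thus ?thesis by (simp add: prod_constant ennreal_power exp_of_nat_mult[symmetric])
  qed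
  finally have "(\<integral>\<^sup>+\<omega>. (\<Prod>i\<in>{1..N}. Y i \<omega>) \<partial>M) \<le> ennreal (exp (1 / 2))" .
  moreover have "(\<Prod>i\<in>{1..N}. Y i \<omega>) = ennreal (exp (sqrt (real N) / b * ((1 / real N) * (\<Sum>i=1..N. f (\<eta>s i \<omega>)))))" for \<omega>
  proof -
    have "sqrt (real N) / b * (1 / real N) = l"
      using b N sN by (simp add: l_def field_simps)
    hence "sqrt (real N) / b * ((1 / real N) * (\<Sum>i=1..N. f (\<eta>s i \<omega>))) = (\<Sum>i=1..N. l * f (\<eta>s i \<omega>))"
      by (simp only: sum_distrib_left mult.assoc[symmetric])
    thus ?thesis unfolding Y_def by (simp add: prod_ennreal exp_sum)
  qed
  ultimately show ?thesis by simp
qed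

text \<open>The exponential dominates every power, \<open>x\<^sup>p \<le> p\<^sup>p e\<^sup>x\<close>, so no integrality of \<open>p\<close> is involved.\<close>
lemma average_moment:
  assumes f [measurable]: "f \<in> borel_measurable borel" and b: "b > 0" and p: "p > 0"
    and bd: "AE \<omega> in P. \<bar>f (\<eta> \<omega>)\<bar> \<le> b" and mean: "P.expectation (\<lambda>\<omega>. f (\<eta> \<omega>)) = 0"
  shows "(\<integral>\<^sup>+\<omega>. ennreal (\<bar>(1 / real N) * (\<Sum>i=1..N. f (\<eta>s i \<omega>))\<bar> powr p) \<partial>M)
       \<le> ennreal (4 * p powr p * (b / sqrt (real N)) powr p)"
proof -
  define L where "L = sqrt (real N) / b"
  have L: "L > 0" using b N_pos by (simp add: L_def)
  define A where "A \<omega> = (1 / real N) * (\<Sum>i=1..N. f (\<eta>s i \<omega>))" for \<omega>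
  note [measurable] = \<eta>s_rv
  have [measurable]: "A \<in> borel_measurable M" unfolding A_def by measurable
  define c where "c = p powr p * (1 / L) powr p"
  have c: "c \<ge> 0" by (simp add: c_def)
  have pt: "\<bar>a\<bar> powr p \<le> c * (exp (L * a) + exp (L * (- a)))" for a
  proof -
    have "\<bar>L * a\<bar> powr p \<le> p powr p * exp \<bar>L * a\<bar>" by (rule powr_le_exp) (use p in auto)
    also have "\<dots> \<le> p powr p * (exp (L * a) + exp (L * (- a)))"
      by (intro mult_left_mono) (auto simp: abs_if)
    finally have "(1 / L) powr p * \<bar>L * a\<bar> powr p \<le> (1 / L) powr p * (p powr p * (exp (L * a) + exp (L * (- a))))"
      by (intro mult_left_mono) auto
    moreover have "(1 / L) powr p * \<bar>L * a\<bar> powr p = \<bar>a\<bar> powr p"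
      using L by (simp add: powr_mult[symmetric] abs_mult)
    ultimately show ?thesis by (simp add: c_def mult_ac)
  qed
  have "(\<integral>\<^sup>+\<omega>. ennreal (\<bar>A \<omega>\<bar> powr p) \<partial>M)
      \<le> (\<integral>\<^sup>+\<omega>. ennreal c * (ennreal (exp (L * A \<omega>)) + ennreal (exp (L * (- A \<omega>)))) \<partial>M)"
    using pt c by (intro nn_integral_mono) (simp add: ennreal_leI flip: ennreal_plus ennreal_mult)
  also have "\<dots> = ennreal c * ((\<integral>\<^sup>+\<omega>. ennreal (exp (L * A \<omega>)) \<partial>M) + (\<integral>\<^sup>+\<omega>. ennreal (exp (L * (- A \<omega>))) \<partial>M))"
    by (subst nn_integral_cmult, measurable, subst nn_integral_add) auto
  also have "\<dots> \<le> ennreal c * (ennreal (exp (1 / 2)) + ennreal (exp (1 / 2)))"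
  proof (intro mult_left_mono add_mono)
    show "(\<integral>\<^sup>+\<omega>. ennreal (exp (L * A \<omega>)) \<partial>M) \<le> ennreal (exp (1 / 2))"
      unfolding L_def A_def by (rule average_exp_moment[OF f b bd mean])
    have "- A \<omega> = (1 / real N) * (\<Sum>i=1..N. - f (\<eta>s i \<omega>))" for \<omega> by (simp add: A_def sum_negf)
    moreover have "(\<integral>\<^sup>+\<omega>. ennreal (exp (sqrt (real N) / b * ((1 / real N) * (\<Sum>i=1..N. - f (\<eta>s i \<omega>))))) \<partial>M) \<le> ennreal (exp (1 / 2))"
      using bd mean by (intro average_exp_moment[OF _ b]) auto
    ultimately show "(\<integral>\<^sup>+\<omega>. ennreal (exp (L * (- A \<omega>))) \<partial>M) \<le> ennreal (exp (1 / 2))" by (simp add: L_def)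
  qed simp
  also have "\<dots> = ennreal (c * (exp (1 / 2) + exp (1 / 2)))" using c by (simp flip: ennreal_plus ennreal_mult)
  also have "\<dots> \<le> ennreal (c * 4)" using exp_half_le2 c by (intro ennreal_leI mult_left_mono) auto
  also have "c * 4 = 4 * p powr p * (b / sqrt (real N)) powr p" by (simp add: c_def L_def)
  finally show ?thesis by (simp add: A_def)
qed

lemma emp_mean_moment:
  assumes t: "t \<in> {0..<1}" and q: "0 < q" "q \<le> 1" "AE \<omega>' in P. q \<le> P.prob {\<omega>\<in>space P. norm (\<eta> \<omega> - \<eta> \<omega>') \<le> r}"
    and r: "r \<ge> 0" and K: "K > 0" and p: "p > 0"
  shows "(\<integral>\<^sup>+\<omega>. ennreal (norm (sample_mean \<omega> t x - SV.post_mean t x) powr p) \<partial>M)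
       \<le> ennreal (moment_const DIM('a) p * (2 * K * SV.density_bound q r t x / sqrt (real N)) powr p)"
proof -
  let ?J = "insert (0::'a) Basis"
  define b where "b = 2 * K * SV.density_bound q r t x"
  define a where "a j \<omega> = \<bar>(1 / real N) * (\<Sum>i=1..N. SV.summand t x j (\<eta>s i \<omega>))\<bar>" for j \<omega>
  have card: "real (card ?J) = DIM('a) + 1" by (subst card_insert_disjoint) auto
  have b: "b > 0" using K q by (simp add: b_def SV.density_bound_def)
  note [measurable] = \<eta>s_rv SV.summand_rv
  have [measurable]: "a j \<in> borel_measurable M" for j unfolding a_def by measurable
  define c where "c = 2 powr p * real (card ?J) powr p"
  have "(\<integral>\<^sup>+\<omega>. ennreal (norm (sample_mean \<omega> t x - SV.post_mean t x) powr p) \<partial>M)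
     \<le> (\<integral>\<^sup>+\<omega>. (\<Sum>j\<in>?J. ennreal (c * a j \<omega> powr p)) \<partial>M)"
  proof (rule nn_integral_mono_AE)
    show "AE \<omega> in M. ennreal (norm (sample_mean \<omega> t x - SV.post_mean t x) powr p) \<le> (\<Sum>j\<in>?J. ennreal (c * a j \<omega> powr p))"
      using \<eta>s_bounded
    proof eventually_elim
      case (elim \<omega>)
      have "norm (sample_mean \<omega> t x - SV.post_mean t x) \<le> 2 * (\<Sum>j\<in>?J. a j \<omega>)"
        unfolding a_def by (rule SV.emp_mean_deviation[OF t N_pos]) (use elim in auto)
      hence "norm (sample_mean \<omega> t x - SV.post_mean t x) powr p \<le> (2 * (\<Sum>j\<in>?J. a j \<omega>)) powr p"
        using p by (intro powr_mono2) auto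
      also have "\<dots> = 2 powr p * (\<Sum>j\<in>?J. a j \<omega>) powr p"
        by (rule powr_mult)
      also have "\<dots> \<le> 2 powr p * (real (card ?J) powr p * (\<Sum>j\<in>?J. a j \<omega> powr p))"
        using p by (intro mult_left_mono powr_sum_le) (auto simp: a_def)
      also have "\<dots> = (\<Sum>j\<in>?J. c * a j \<omega> powr p)" unfolding c_def by (simp only: sum_distrib_left mult.assoc)
      finally have "ennreal (norm (sample_mean \<omega> t x - SV.post_mean t x) powr p) \<le> ennreal (\<Sum>j\<in>?J. c * a j \<omega> powr p)"
        by (rule ennreal_leI)
      also have "\<dots> = (\<Sum>j\<in>?J. ennreal (c * a j \<omega> powr p))"
        by (rule sum_ennreal[symmetric]) (simp add: c_def)
      finally show ?case .
    qed
  qed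
  also have "\<dots> = (\<Sum>j\<in>?J. \<integral>\<^sup>+\<omega>. ennreal (c * a j \<omega> powr p) \<partial>M)" by (rule nn_integral_sum) measurable
  also have "\<dots> \<le> (\<Sum>j\<in>?J. ennreal (c * (4 * p powr p * (b / sqrt (real N)) powr p)))"
  proof (rule sum_mono)
    fix j assume j: "j \<in> ?J"
    have "(\<integral>\<^sup>+\<omega>. ennreal (c * a j \<omega> powr p) \<partial>M) = ennreal c * (\<integral>\<^sup>+\<omega>. ennreal (a j \<omega> powr p) \<partial>M)"
      by (subst nn_integral_cmult[symmetric]) (auto simp: c_def ennreal_mult intro!: nn_integral_cong)
    also have "\<dots> \<le> ennreal c * ennreal (4 * p powr p * (b / sqrt (real N)) powr p)"
      unfolding a_def
      by (intro mult_left_mono average_moment[OF SV.summand_rv b p])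
         (use SV.summand_bound[OF t q r j, of x] SV.summand_mean[OF t] in \<open>auto simp: b_def\<close>)
    also have "\<dots> = ennreal (c * (4 * p powr p * (b / sqrt (real N)) powr p))"
      by (rule ennreal_mult[symmetric]) (auto simp: c_def)
    finally show "(\<integral>\<^sup>+\<omega>. ennreal (c * a j \<omega> powr p) \<partial>M) \<le> ennreal (c * (4 * p powr p * (b / sqrt (real N)) powr p))" .
  qed
  also have "\<dots> = ennreal (\<Sum>j\<in>?J. c * (4 * p powr p * (b / sqrt (real N)) powr p))"
    by (rule sum_ennreal) (simp add: c_def)
  also have "(\<Sum>j\<in>?J. c * (4 * p powr p * (b / sqrt (real N)) powr p)) = moment_const DIM('a) p * (b / sqrt (real N)) powr p"
  proof -
    have "moment_const DIM('a) p = c * (real (card ?J) * (4 * p powr p))"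
      unfolding moment_const_def c_def card by (subst powr_mult[symmetric]) (simp add: add.commute)
    thus ?thesis by (simp only: sum_constant mult_ac)
  qed
  finally show ?thesis by (simp only: b_def)
qed

text \<open>The variance of initial value and noise in odds time is \<open>\<gamma> + \<epsilon> odds = l / \<sigma>\<close>. By
  \<open>2 a b \<le> a\<^sup>2 + b\<^sup>2\<close> the two exponentials are estimated separately, at the price of a factor in the
  exponent. The noise itself is measurable only up to a null set, whence the version \<open>J\<close>.\<close>
lemma initial_noise_mgf:
  assumes I: "\<And>t. t \<in> {0..<1} \<Longrightarrow> wiener_integral M W SN.vol t (I t)" "AE \<omega> in M. good_path I \<omega>"
    and T: "0 \<le> T" "T < 1" and J [measurable]: "J \<in> borel_measurable M" "AE \<omega> in M. SN.noise I T \<omega> = J \<omega>"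
  shows "(\<integral>\<^sup>+\<omega>. ennreal (exp (z \<bullet> (\<xi> \<omega> + J \<omega>))) \<partial>M) \<le> ennreal (exp ((norm z)\<^sup>2 * (4 * (ell T / \<sigma> T))))"
proof -
  have [measurable]: "\<xi> \<in> borel_measurable M" using \<xi>_W_indep by (simp add: independent_def)
  have v: "ell T / \<sigma> T = \<gamma> + \<epsilon> * odds T"
    using \<sigma>_pos[OF T] by (simp add: ell_def odds_def field_simps)
  have c: "AE \<omega> in M. continuous_on {0..T} (\<lambda>t. I t \<omega>) \<and> I 0 \<omega> = 0"
    using I(2) by eventually_elim (use T in \<open>auto simp: good_path_def\<close>)
  have "(\<integral>\<^sup>+\<omega>. ennreal (exp (z \<bullet> (\<xi> \<omega> + J \<omega>))) \<partial>M)
      \<le> (\<integral>\<^sup>+\<omega>. ennreal (1/2) * (ennreal (exp ((2 *\<^sub>R z) \<bullet> \<xi> \<omega>)) + ennreal (exp ((2 *\<^sub>R z) \<bullet> J \<omega>))) \<partial>M)"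
  proof (rule nn_integral_mono)
    fix \<omega>
    define a where "a = exp (z \<bullet> \<xi> \<omega>)"
    define b where "b = exp (z \<bullet> J \<omega>)"
    have "exp (z \<bullet> (\<xi> \<omega> + J \<omega>)) = a * b" by (simp add: a_def b_def inner_add_right exp_add)
    also have "\<dots> \<le> 1/2 * (a * a + b * b)" using sum_squares_bound[of a b] by (simp add: power2_eq_square)
    also have "\<dots> = 1/2 * (exp ((2 *\<^sub>R z) \<bullet> \<xi> \<omega>) + exp ((2 *\<^sub>R z) \<bullet> J \<omega>))"
      by (simp add: a_def b_def flip: exp_add)
    finally have "ennreal (exp (z \<bullet> (\<xi> \<omega> + J \<omega>))) \<le> ennreal (1/2 * (exp ((2 *\<^sub>R z) \<bullet> \<xi> \<omega>) + exp ((2 *\<^sub>R z) \<bullet> J \<omega>)))"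
      by (rule ennreal_leI)
    also have "\<dots> = ennreal (1/2) * (ennreal (exp ((2 *\<^sub>R z) \<bullet> \<xi> \<omega>)) + ennreal (exp ((2 *\<^sub>R z) \<bullet> J \<omega>)))"
      by (subst ennreal_mult) (auto intro: add_nonneg_nonneg)
    finally show "ennreal (exp (z \<bullet> (\<xi> \<omega> + J \<omega>))) \<le> \<dots>" .
  qed
  also have "\<dots> = ennreal (1/2) * ((\<integral>\<^sup>+\<omega>. ennreal (exp ((2 *\<^sub>R z) \<bullet> \<xi> \<omega>)) \<partial>M) + (\<integral>\<^sup>+\<omega>. ennreal (exp ((2 *\<^sub>R z) \<bullet> J \<omega>)) \<partial>M))"
    by (subst nn_integral_cmult, measurable, subst nn_integral_add) auto
  also have "\<dots> \<le> ennreal (1/2) * (ennreal (exp ((norm z)\<^sup>2 * (4 * (ell T / \<sigma> T)))) + ennreal (exp ((norm z)\<^sup>2 * (4 * (ell T / \<sigma> T)))))"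
  proof (intro mult_left_mono add_mono)
    have "(\<integral>\<^sup>+\<omega>. ennreal (exp ((2 *\<^sub>R z) \<bullet> \<xi> \<omega>)) \<partial>M) = ennreal (exp ((norm (2 *\<^sub>R z))\<^sup>2 * \<gamma> / 2))"
      by (rule isotropic_gaussian_mgf[OF \<xi>_law \<gamma>_pos])
    also have "\<dots> \<le> ennreal (exp ((norm z)\<^sup>2 * (4 * (ell T / \<sigma> T))))"
    proof (rule ennreal_leI)
      have "(norm (2 *\<^sub>R z))\<^sup>2 * \<gamma> / 2 = (norm z)\<^sup>2 * (2 * \<gamma>)" by (simp add: power_mult_distrib)
      also have "\<dots> \<le> (norm z)\<^sup>2 * (4 * (ell T / \<sigma> T))"
        unfolding v using \<gamma>_pos mult_nonneg_nonneg[of \<epsilon> "odds T"] \<epsilon>_pos odds_nonneg[OF T] by (intro mult_left_mono) auto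
      finally show "exp ((norm (2 *\<^sub>R z))\<^sup>2 * \<gamma> / 2) \<le> exp ((norm z)\<^sup>2 * (4 * (ell T / \<sigma> T)))" by simp
    qed
    finally show "(\<integral>\<^sup>+\<omega>. ennreal (exp ((2 *\<^sub>R z) \<bullet> \<xi> \<omega>)) \<partial>M) \<le> ennreal (exp ((norm z)\<^sup>2 * (4 * (ell T / \<sigma> T))))" .
    have "(\<integral>\<^sup>+\<omega>. ennreal (exp ((2 *\<^sub>R z) \<bullet> J \<omega>)) \<partial>M)
        = (\<integral>\<^sup>+\<omega>. ennreal (exp ((2 *\<^sub>R z) \<bullet> SN.noise I T \<omega>)) \<partial>M)"
      using J(2) by (intro nn_integral_cong_AE) (auto elim!: eventually_mono)
    also have "\<dots> \<le> ennreal (exp ((norm (2 *\<^sub>R z))\<^sup>2 * (\<epsilon> * odds T)))"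
      by (rule SN.noise_mgf[OF T I(1) c])
    also have "\<dots> \<le> ennreal (exp ((norm z)\<^sup>2 * (4 * (ell T / \<sigma> T))))"
    proof (rule ennreal_leI)
      have "(norm (2 *\<^sub>R z))\<^sup>2 * (\<epsilon> * odds T) = (norm z)\<^sup>2 * (4 * (\<epsilon> * odds T))" by (simp add: power_mult_distrib)
      also have "\<dots> \<le> (norm z)\<^sup>2 * (4 * (ell T / \<sigma> T))" unfolding v using \<gamma>_pos by (intro mult_left_mono) auto
      finally show "exp ((norm (2 *\<^sub>R z))\<^sup>2 * (\<epsilon> * odds T)) \<le> exp ((norm z)\<^sup>2 * (4 * (ell T / \<sigma> T)))" by simp
    qed
    finally show "(\<integral>\<^sup>+\<omega>. ennreal (exp ((2 *\<^sub>R z) \<bullet> J \<omega>)) \<partial>M) \<le> ennreal (exp ((norm z)\<^sup>2 * (4 * (ell T / \<sigma> T))))" .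
  qed simp
  also have "\<dots> = ennreal (exp ((norm z)\<^sup>2 * (4 * (ell T / \<sigma> T))))"
  proof -
    have half: "ennreal (1/2) * (ennreal x + ennreal x) = ennreal x" if "x \<ge> 0" for x
    proof -
      have "ennreal x + ennreal x = ennreal (2 * x)" using ennreal_plus[of x x] that by simp
      moreover have "ennreal (1/2) * ennreal (2 * x) = ennreal (1/2 * (2 * x))"
        using that by (intro ennreal_mult[symmetric]) auto
      ultimately show ?thesis by simp
    qed
    show ?thesis by (rule half) simp
  qed
  finally show ?thesis .
qed

end

section \<open>Moments of the difference\<close>

text \<open>The growth rate of the fluctuations per unit of \<open>odds / \<epsilon>\<close>. It vanishes with the radius \<open>r\<close> of the
  balls in which the law of \<open>\<eta>\<close> is resolved.\<close>
definition fluct_rate :: "nat \<Rightarrow> real \<Rightarrow> real \<Rightarrow> real \<Rightarrow> real" where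
  "fluct_rate d K p r = 2 * r * K + 4 * p * r\<^sup>2 * (real d)\<^sup>2"

definition fluct_const :: "nat \<Rightarrow> real \<Rightarrow> real \<Rightarrow> real \<Rightarrow> real" where
  "fluct_const d K p q = moment_const d p * (2 * K / q) powr p * (2 * real d)"

context bounded_coupling
begin

lemma X_rv: "t \<in> {0..<1} \<Longrightarrow> X t \<in> borel_measurable M" and XN_rv: "t \<in> {0..<1} \<Longrightarrow> XN t \<in> borel_measurable M"
  using X_sde XN_sde by (auto simp: sde_solution_def)

lemma norm_X_le:
  assumes g: "good_path I \<omega>" and T: "0 \<le> T" "T < 1"
  shows "norm (X T \<omega>) \<le> \<sigma> T * norm (\<xi> \<omega> + SN.noise I T \<omega>) + \<beta> T * K"
proof -
  interpret smooth_clock T odds odds' by (rule smooth_clock_odds[OF T])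
  define D where "D = integral {0..T} (\<lambda>r. odds' r *\<^sub>R SV.post_mean r (X r \<omega>))"
  have s: "\<sigma> T > 0" by (rule \<sigma>_pos[OF T])
  have iK: "((\<lambda>r. odds' r * K) has_integral (odds T * K)) {0..T}"
    using has_integral_mult_left[OF integral_clock[of 0 T], of K] T by (simp add: odds_0)
  have "norm D \<le> integral {0..T} (\<lambda>r. odds' r * K)"
    unfolding D_def
  proof (rule integral_norm_bound_integral)
    show "(\<lambda>r. odds' r *\<^sub>R SV.post_mean r (X r \<omega>)) integrable_on {0..T}"
      by (intro integrable_continuous_real continuous_on_scaleR cont' good_path_cont(4)[OF g T(2)])
    show "(\<lambda>r. odds' r * K) integrable_on {0..T}" using iK by blast
    fix r assume r: "r \<in> {0..T}"
    hence "r \<in> {0..<1}" using T by auto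
    thus "norm (odds' r *\<^sub>R SV.post_mean r (X r \<omega>)) \<le> odds' r * K"
      using SV.norm_post_mean[of r "X r \<omega>"] nonneg'[OF r] by (simp add: mult_left_mono)
  qed
  hence D: "norm D \<le> odds T * K" using integral_unique[OF iK] by metis
  have "X T \<omega> = \<sigma> T *\<^sub>R ((1 / \<sigma> T) *\<^sub>R X T \<omega>)" using s by simp
  also have "(1 / \<sigma> T) *\<^sub>R X T \<omega> = (\<xi> \<omega> + SN.noise I T \<omega>) + D"
    unfolding D_def by (rule X_in_odds_time[OF g T])
  also have "norm (\<sigma> T *\<^sub>R ((\<xi> \<omega> + SN.noise I T \<omega>) + D)) \<le> \<sigma> T * (norm (\<xi> \<omega> + SN.noise I T \<omega>) + odds T * K)"
    using s norm_triangle_ineq[of "\<xi> \<omega> + SN.noise I T \<omega>" D] D by simp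
  also have "\<dots> = \<sigma> T * norm (\<xi> \<omega> + SN.noise I T \<omega>) + \<beta> T * K"
    using s by (simp add: odds_def distrib_left)
  finally show ?thesis .
qed

lemma fluct_rv: 
  assumes t: "t \<in> {0..<1}" shows "fluct t \<in> borel_measurable M"
proof -
  note [measurable] = X_rv[OF t] \<eta>s_rv borel_measurable_continuous_onI[OF SV.post_mean_cont[OF t]]
  show ?thesis unfolding fluct_def emp_mean_def kern_def by measurable
qed

text \<open>Fubini's theorem reduces the moment to that of the density bound along \<open>X\<close>, which is the
  exponential of a small multiple of the norm of a Gaussian variable.\<close>
lemma fluct_moment:
  assumes t: "t \<in> {0..<1}" and q: "0 < q" "q \<le> 1" "AE \<omega>' in P. q \<le> P.prob {\<omega>\<in>space P. norm (\<eta> \<omega> - \<eta> \<omega>') \<le> r}"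
    and r: "r \<ge> 0" and K: "K > 0" and p: "p > 0"
  shows "(\<integral>\<^sup>+\<omega>. ennreal (fluct t \<omega> powr p) \<partial>M)
       \<le> ennreal (fluct_const DIM('a) K p q * (1 / sqrt (real N)) powr p * exp (p * fluct_rate DIM('a) K p r * odds t / \<epsilon>))"
proof -
  obtain I where I: "\<And>t. t \<in> {0..<1} \<Longrightarrow> wiener_integral M W SN.vol t (I t)" "AE \<omega> in M. good_path I \<omega>"
    by (rule good_paths) (rule that)
  have T: "0 \<le> t" "t < 1" using t by auto
  have Xd: "noise_determined (X t)" by (rule noise_determined_X[OF I T])
  have Jd: "noise_determined (SN.noise I t)" by (rule noise_determined_noise[OF I T])
  obtain H where H [measurable]: "H \<in> borel_measurable (borel \<Otimes>\<^sub>M path_space)"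
    "AE \<omega> in M. SN.noise I t \<omega> = H (\<xi> \<omega>, path W \<omega>)"
    using Jd by (auto simp: noise_determined_def)
  define J where "J \<omega> = H (\<xi> \<omega>, path W \<omega>)" for \<omega>
  have [measurable]: "(\<lambda>\<omega>. (\<xi> \<omega>, path W \<omega>)) \<in> measurable M (borel \<Otimes>\<^sub>M path_space)" "\<xi> \<in> borel_measurable M"
    using noise_copies_indep \<xi>_W_indep by (simp_all add: independent_def)
  have J [measurable]: "J \<in> borel_measurable M" unfolding J_def by measurable
  have JH: "AE \<omega> in M. SN.noise I t \<omega> = J \<omega>" using H(2) by (simp add: J_def)
  define G where "G \<omega> = \<xi> \<omega> + J \<omega>" for \<omega>
  have [measurable]: "G \<in> borel_measurable M" unfolding G_def by measurable
  have pm [measurable]: "SV.post_mean t \<in> borel_measurable borel"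
    by (rule borel_measurable_continuous_onI[OF SV.post_mean_cont[OF t]])
  define F where "F = (\<lambda>(x, y). ennreal (norm (emp_mean N y t x - SV.post_mean t x) powr p))"
  define g where "g x = ennreal (moment_const DIM('a) p * (2 * K * SV.density_bound q r t x / sqrt (real N)) powr p)" for x
  have s: "\<sigma> t > 0" by (rule \<sigma>_pos[OF T])
  have l: "ell t > 0" using t by (intro ell_pos) auto
  have b: "\<beta> t \<ge> 0" using \<beta>_range[of t] t by simp
  have mc: "moment_const DIM('a) p \<ge> 0" by (simp add: moment_const_def)
  \<comment> \<open>\<open>\<beta>\<^sup>2 / (l \<sigma>)\<close> is the squared signal-to-noise ratio of the interpolant\<close>
  have snr: "\<beta> t * \<beta> t / (ell t * \<sigma> t) \<le> odds t / \<epsilon>"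
  proof -
    have "\<beta> t * \<beta> t / (ell t * \<sigma> t) = (\<beta> t / ell t) * odds t" by (simp add: odds_def)
    also have "\<dots> \<le> (1 / \<epsilon>) * odds t" by (intro mult_right_mono slope_le t odds_nonneg T)
    finally show ?thesis by simp
  qed
  define c0 where "c0 = moment_const DIM('a) p * (2 * K / q) powr p * (1 / sqrt (real N)) powr p * exp (p * (2 * r * K * (odds t / \<epsilon>)))"
  define lam where "lam = p * r * (\<beta> t / ell t)"
  have c0: "c0 \<ge> 0" using mc by (simp add: c0_def)
  have lam: "lam \<ge> 0" using p r b l by (simp add: lam_def)
  have "(\<integral>\<^sup>+\<omega>. ennreal (fluct t \<omega> powr p) \<partial>M) = (\<integral>\<^sup>+\<omega>. F (X t \<omega>, sample \<omega>) \<partial>M)"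
    by (simp add: F_def fluct_def emp_mean_def)
  also have "\<dots> \<le> (\<integral>\<^sup>+\<omega>. g (X t \<omega>) \<partial>M)"
  proof (rule nn_integral_noise_determined_le[OF Xd])
    have "(\<lambda>z. snd z i) \<in> borel_measurable (borel \<Otimes>\<^sub>M sample_space)" if "i \<in> {1..N}" for i
      using that by (intro measurable_compose[OF measurable_snd] measurable_component_singleton) auto
    note [measurable] = this
    show "F \<in> borel_measurable (borel \<Otimes>\<^sub>M sample_space)"
      unfolding F_def split_beta emp_mean_def kern_def by measurable
    show "g \<in> borel_measurable borel" unfolding g_def SV.density_bound_def by measurable
    have "(\<integral>\<^sup>+\<omega>. F (x, sample \<omega>) \<partial>M) = (\<integral>\<^sup>+\<omega>. ennreal (norm (sample_mean \<omega> t x - SV.post_mean t x) powr p) \<partial>M)" for x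
      by (simp add: F_def emp_mean_def)
    thus "(\<integral>\<^sup>+\<omega>. F (x, sample \<omega>) \<partial>M) \<le> g x" for x
      unfolding g_def using emp_mean_moment[OF t q r K p, of x] by simp
  qed
  also have "\<dots> \<le> (\<integral>\<^sup>+\<omega>. ennreal c0 * ennreal (exp (lam * norm (G \<omega>))) \<partial>M)"
  proof (rule nn_integral_mono_AE)
    show "AE \<omega> in M. g (X t \<omega>) \<le> ennreal c0 * ennreal (exp (lam * norm (G \<omega>)))"
      using I(2) JH
    proof eventually_elim
      case (elim \<omega>)
      define e where "e = \<beta> t * r * (norm (X t \<omega>) + \<beta> t * K) / (ell t * \<sigma> t)"
      have X: "norm (X t \<omega>) + \<beta> t * K \<le> \<sigma> t * norm (G \<omega>) + 2 * (\<beta> t * K)"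
        using norm_X_le[OF elim(1) T] elim(2) by (simp add: G_def mult.commute)
      have "e \<le> \<beta> t * r * (\<sigma> t * norm (G \<omega>) + 2 * (\<beta> t * K)) / (ell t * \<sigma> t)"
        unfolding e_def using X b r s l by (intro divide_right_mono mult_left_mono) auto
      also have "\<dots> = r * (\<beta> t / ell t) * norm (G \<omega>) + 2 * r * K * (\<beta> t * \<beta> t / (ell t * \<sigma> t))"
        using s l by (simp add: field_simps)
      also have "\<dots> \<le> r * (\<beta> t / ell t) * norm (G \<omega>) + 2 * r * K * (odds t / \<epsilon>)"
        using r K by (intro add_left_mono mult_left_mono snr) auto
      finally have e: "p * e \<le> lam * norm (G \<omega>) + p * (2 * r * K * (odds t / \<epsilon>))"
        using mult_left_mono[of e "r * (\<beta> t / ell t) * norm (G \<omega>) + 2 * r * K * (odds t / \<epsilon>)" p] p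
        by (simp add: lam_def algebra_simps)
      have "2 * K * SV.density_bound q r t (X t \<omega>) / sqrt (real N) = (2 * K / q) * (1 / sqrt (real N)) * exp e"
        by (simp add: SV.density_bound_def e_def)
      hence "(2 * K * SV.density_bound q r t (X t \<omega>) / sqrt (real N)) powr p = (2 * K / q) powr p * (1 / sqrt (real N)) powr p * exp (p * e)"
        by (simp only: powr_mult) (simp add: powr_def)
      also have "\<dots> \<le> (2 * K / q) powr p * (1 / sqrt (real N)) powr p * exp (lam * norm (G \<omega>) + p * (2 * r * K * (odds t / \<epsilon>)))"
        using e by (intro mult_left_mono) auto
      finally have "moment_const DIM('a) p * (2 * K * SV.density_bound q r t (X t \<omega>) / sqrt (real N)) powr p \<le> c0 * exp (lam * norm (G \<omega>))"
        using mult_left_mono[OF _ mc] by (fastforce simp: c0_def exp_add mult_ac)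
      thus ?case using c0 by (simp add: g_def ennreal_leI flip: ennreal_mult)
    qed
  qed
  also have "\<dots> = ennreal c0 * (\<integral>\<^sup>+\<omega>. ennreal (exp (lam * norm (G \<omega>))) \<partial>M)"
    by (rule nn_integral_cmult) measurable
  also have "\<dots> \<le> ennreal c0 * ennreal (2 * DIM('a) * exp ((lam * DIM('a))\<^sup>2 * (4 * (ell t / \<sigma> t))))"
    by (intro mult_left_mono exp_norm_moment lam)
       (use initial_noise_mgf[OF I T J JH] in \<open>auto simp: G_def\<close>)
  also have "\<dots> = ennreal (c0 * (2 * DIM('a) * exp ((lam * DIM('a))\<^sup>2 * (4 * (ell t / \<sigma> t)))))"
    by (rule ennreal_mult[symmetric]) (use c0 in auto)
  also have "\<dots> \<le> ennreal (fluct_const DIM('a) K p q * (1 / sqrt (real N)) powr p * exp (p * fluct_rate DIM('a) K p r * odds t / \<epsilon>))"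
  proof (rule ennreal_leI)
    have "(lam * DIM('a))\<^sup>2 * (4 * (ell t / \<sigma> t)) = 4 * p\<^sup>2 * r\<^sup>2 * (DIM('a))\<^sup>2 * (\<beta> t * \<beta> t / (ell t * \<sigma> t))"
      using s l by (simp add: lam_def power2_eq_square field_simps)
    also have "\<dots> \<le> 4 * p\<^sup>2 * r\<^sup>2 * (DIM('a))\<^sup>2 * (odds t / \<epsilon>)"
      by (intro mult_left_mono snr) auto
    finally have "p * (2 * r * K * (odds t / \<epsilon>)) + (lam * DIM('a))\<^sup>2 * (4 * (ell t / \<sigma> t)) \<le> p * fluct_rate DIM('a) K p r * odds t / \<epsilon>"
      by (simp add: fluct_rate_def power2_eq_square algebra_simps add_divide_distrib)
    hence "exp (p * (2 * r * K * (odds t / \<epsilon>))) * exp ((lam * DIM('a))\<^sup>2 * (4 * (ell t / \<sigma> t))) \<le> exp (p * fluct_rate DIM('a) K p r * odds t / \<epsilon>)"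
      by (simp flip: exp_add)
    hence "(fluct_const DIM('a) K p q * (1 / sqrt (real N)) powr p) * (exp (p * (2 * r * K * (odds t / \<epsilon>))) * exp ((lam * DIM('a))\<^sup>2 * (4 * (ell t / \<sigma> t))))
       \<le> (fluct_const DIM('a) K p q * (1 / sqrt (real N)) powr p) * exp (p * fluct_rate DIM('a) K p r * odds t / \<epsilon>)"
      using mc by (intro mult_left_mono) (auto simp: fluct_const_def)
    thus "c0 * (2 * DIM('a) * exp ((lam * DIM('a))\<^sup>2 * (4 * (ell t / \<sigma> t)))) \<le> fluct_const DIM('a) K p q * (1 / sqrt (real N)) powr p * exp (p * fluct_rate DIM('a) K p r * odds t / \<epsilon>)"
      by (simp only: c0_def fluct_const_def of_nat_mult of_nat_numeral mult_ac)
  qed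
  finally show ?thesis .
qed

text \<open>Joint measurability in time and chance is not at hand: the fluctuation is continuous in time
  only almost surely. Riemann sums and Fatou's lemma replace Fubini's theorem.\<close>
lemma fluct_time_moment:
  assumes T: "0 \<le> T" "T < 1" and p: "p > 0"
    and G: "\<And>r. r \<in> {0..T} \<Longrightarrow> (\<integral>\<^sup>+\<omega>. ennreal (fluct r \<omega> powr p) \<partial>M) \<le> ennreal G" "G \<ge> 0" and c: "c \<ge> 0"
  shows "(\<integral>\<^sup>+\<omega>. ennreal (c * integral {0..T} (\<lambda>r. odds' r * fluct r \<omega> powr p)) \<partial>M) \<le> ennreal (c * (odds T * G))"
proof -
  interpret smooth_clock T odds odds' by (rule smooth_clock_odds[OF T])
  obtain I where I: "\<And>t. t \<in> {0..<1} \<Longrightarrow> wiener_integral M W SN.vol t (I t)" "AE \<omega> in M. good_path I \<omega>"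
    by (rule good_paths) (rule that)
  define S where "S n \<omega> = (\<Sum>k<Suc n. (odds (mesh T (Suc n) (Suc k)) - odds (mesh T (Suc n) k)) * fluct (mesh T (Suc n) k) \<omega> powr p)" for n \<omega>
  have m: "mesh T (Suc n) k \<in> {0..T}" if "k \<le> Suc n" for n k using mesh_in[OF T(1) _ that] by simp
  have d: "odds (mesh T (Suc n) (Suc k)) - odds (mesh T (Suc n) k) \<ge> 0" if "k < Suc n" for n k
    using m[of k n] m[of "Suc k" n] that mesh_mono[OF T(1), of k "Suc k" "Suc n"] clock_mono by simp
  have fr [measurable]: "fluct (mesh T (Suc n) k) \<in> borel_measurable M" if "k < Suc n" for n k
    using m[of k n] that T by (intro fluct_rv) auto
  show ?thesis
  proof (rule nn_integral_le_AE_limit[where f = "\<lambda>n \<omega>. ennreal (c * S n \<omega>)"])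
    have Sm [measurable]: "S n \<in> borel_measurable M" for n
    proof -
      have "(\<lambda>\<omega>. (odds (mesh T (Suc n) (Suc k)) - odds (mesh T (Suc n) k)) * fluct (mesh T (Suc n) k) \<omega> powr p) \<in> borel_measurable M"
        if "k \<in> {..<Suc n}" for k
      proof -
        have [measurable]: "fluct (mesh T (Suc n) k) \<in> borel_measurable M" using that by (intro fr) auto
        show ?thesis by measurable
      qed
      thus ?thesis unfolding S_def by (rule borel_measurable_sum)
    qed
    show "(\<lambda>\<omega>. ennreal (c * S n \<omega>)) \<in> borel_measurable M" for n by measurable
    show "AE \<omega> in M. (\<lambda>n. ennreal (c * S n \<omega>)) \<longlonglongrightarrow> ennreal (c * integral {0..T} (\<lambda>r. odds' r * fluct r \<omega> powr p))"
      using I(2)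
    proof eventually_elim
      case (elim \<omega>)
      have cF: "continuous_on {0..T} (\<lambda>r. fluct r \<omega>)"
        unfolding fluct_def by (intro continuous_on_norm continuous_on_diff good_path_cont(4,6)[OF elim T(2)])
      have "continuous_on {0..T} (\<lambda>r. fluct r \<omega> powr p)"
        using p by (intro continuous_on_powr' cF continuous_on_const) (auto simp: fluct_def)
      from riemann_sum_tendsto[OF this, of "\<lambda>n k. mesh T n k"]
      have "(\<lambda>n. \<Sum>k<n. (odds (mesh T n (Suc k)) - odds (mesh T n k)) * fluct (mesh T n k) \<omega> powr p)
          \<longlonglongrightarrow> integral {0..T} (\<lambda>r. odds' r * fluct r \<omega> powr p)"
        using mesh_mono[OF T(1)] by simp
      hence "(\<lambda>n. S n \<omega>) \<longlonglongrightarrow> integral {0..T} (\<lambda>r. odds' r * fluct r \<omega> powr p)"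
        unfolding S_def by (rule LIMSEQ_Suc)
      thus ?case by (intro tendsto_ennrealI tendsto_mult_left)
    qed
    have "(\<integral>\<^sup>+\<omega>. ennreal (S n \<omega>) \<partial>M) \<le> ennreal (odds T * G)" for n
    proof -
      let ?d = "\<lambda>k. odds (mesh T (Suc n) (Suc k)) - odds (mesh T (Suc n) k)"
      have "(\<integral>\<^sup>+\<omega>. ennreal (S n \<omega>) \<partial>M) = (\<integral>\<^sup>+\<omega>. (\<Sum>k<Suc n. ennreal (?d k) * ennreal (fluct (mesh T (Suc n) k) \<omega> powr p)) \<partial>M)"
      proof (rule nn_integral_cong)
        fix \<omega>
        have "ennreal (S n \<omega>) = (\<Sum>k<Suc n. ennreal (?d k * fluct (mesh T (Suc n) k) \<omega> powr p))"
          unfolding S_def using d by (intro sum_ennreal[symmetric] mult_nonneg_nonneg) auto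
        also have "\<dots> = (\<Sum>k<Suc n. ennreal (?d k) * ennreal (fluct (mesh T (Suc n) k) \<omega> powr p))"
          using d by (intro sum.cong refl ennreal_mult) auto
        finally show "ennreal (S n \<omega>) = \<dots>" .
      qed
      also have "\<dots> = (\<Sum>k<Suc n. \<integral>\<^sup>+\<omega>. ennreal (?d k) * ennreal (fluct (mesh T (Suc n) k) \<omega> powr p) \<partial>M)"
        using fr by (intro nn_integral_sum) measurable
      also have "\<dots> \<le> (\<Sum>k<Suc n. ennreal (?d k * G))"
      proof (rule sum_mono)
        fix k assume k: "k \<in> {..<Suc n}"
        have "(\<integral>\<^sup>+\<omega>. ennreal (?d k) * ennreal (fluct (mesh T (Suc n) k) \<omega> powr p) \<partial>M)
            = ennreal (?d k) * (\<integral>\<^sup>+\<omega>. ennreal (fluct (mesh T (Suc n) k) \<omega> powr p) \<partial>M)"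
          using fr[of k n] k by (intro nn_integral_cmult) auto
        also have "\<dots> \<le> ennreal (?d k) * ennreal G" using m[of k n] k by (intro mult_left_mono G) auto
        also have "\<dots> = ennreal (?d k * G)" using d[of k n] k G(2) by (intro ennreal_mult[symmetric]) auto
        finally show "(\<integral>\<^sup>+\<omega>. ennreal (?d k) * ennreal (fluct (mesh T (Suc n) k) \<omega> powr p) \<partial>M) \<le> ennreal (?d k * G)" .
      qed
      also have "\<dots> = ennreal (\<Sum>k<Suc n. ?d k * G)" using d G(2) by (intro sum_ennreal mult_nonneg_nonneg) auto
      also have "(\<Sum>k<Suc n. ?d k * G) = (\<Sum>k<Suc n. ?d k) * G" by (rule sum_distrib_right[symmetric])
      also have "(\<Sum>k<Suc n. ?d k) = odds T"
        using sum_lessThan_telescope[of "\<lambda>k. odds (mesh T (Suc n) k)" "Suc n"] mesh_n[of "Suc n" T] by (simp add: odds_0)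
      finally show ?thesis .
    qed
    hence "ennreal c * (\<integral>\<^sup>+\<omega>. ennreal (S n \<omega>) \<partial>M) \<le> ennreal c * ennreal (odds T * G)" for n
      by (intro mult_left_mono) auto
    moreover have "(\<integral>\<^sup>+\<omega>. ennreal (c * S n \<omega>) \<partial>M) = ennreal c * (\<integral>\<^sup>+\<omega>. ennreal (S n \<omega>) \<partial>M)" for n
      using c by (subst nn_integral_cmult[symmetric]) (auto simp: ennreal_mult')
    ultimately show "\<forall>\<^sub>F n in sequentially. (\<integral>\<^sup>+\<omega>. ennreal (c * S n \<omega>) \<partial>M) \<le> ennreal (c * (odds T * G))"
      using c by (simp add: ennreal_mult')
  qed
qed

text \<open>Gronwall's lemma at the level of moments; the factor \<open>(\<sigma>\<^sub>T odds\<^sub>T)\<^sup>p = \<beta>\<^sub>T\<^sup>p\<close> is at most 1.\<close>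
lemma difference_moment:
  assumes T: "0 < T" "T < 1" and p: "p > 1"
    and G: "\<And>r. r \<in> {0..T} \<Longrightarrow> (\<integral>\<^sup>+\<omega>. ennreal (fluct r \<omega> powr p) \<partial>M) \<le> ennreal G" "G \<ge> 0"
  shows "(\<integral>\<^sup>+\<omega>. ennreal (norm (XN T \<omega> - X T \<omega>) powr p) \<partial>M) \<le> ennreal (exp (p * (K\<^sup>2 / \<epsilon> * odds T)) * G)"
proof -
  have T0: "0 \<le> T" using T by simp
  interpret smooth_clock T odds odds' by (rule smooth_clock_odds[OF T0 T(2)])
  obtain I where I: "\<And>t. t \<in> {0..<1} \<Longrightarrow> wiener_integral M W SN.vol t (I t)" "AE \<omega> in M. good_path I \<omega>"
    by (rule good_paths) (rule that)
  have s: "\<sigma> T > 0" by (rule \<sigma>_pos[OF T0 T(2)])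
  have b: "\<beta> T > 0" using \<beta>_strict_mono[of 0 T] T \<beta>_0 by simp
  have o: "odds T > 0" using b s by (simp add: odds_def)
  define c where "c = (\<sigma> T * exp (K\<^sup>2 / \<epsilon> * odds T)) powr p * odds T powr (p - 1)"
  have c: "c \<ge> 0" by (simp add: c_def)
  have "(\<integral>\<^sup>+\<omega>. ennreal (norm (XN T \<omega> - X T \<omega>) powr p) \<partial>M)
      \<le> (\<integral>\<^sup>+\<omega>. ennreal (c * integral {0..T} (\<lambda>r. odds' r * fluct r \<omega> powr p)) \<partial>M)"
  proof (rule nn_integral_mono_AE)
    show "AE \<omega> in M. ennreal (norm (XN T \<omega> - X T \<omega>) powr p) \<le> ennreal (c * integral {0..T} (\<lambda>r. odds' r * fluct r \<omega> powr p))"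
      using I(2)
    proof eventually_elim
      case (elim \<omega>)
      define A where "A = integral {0..T} (\<lambda>r. odds' r * fluct r \<omega>)"
      define B where "B = integral {0..T} (\<lambda>r. odds' r * fluct r \<omega> powr p)"
      have cF: "continuous_on {0..T} (\<lambda>r. fluct r \<omega>)"
        unfolding fluct_def by (intro continuous_on_norm continuous_on_diff good_path_cont(4,6)[OF elim T(2)])
      have "norm (XN T \<omega> - X T \<omega>) = \<sigma> T * norm ((1 / \<sigma> T) *\<^sub>R (XN T \<omega> - X T \<omega>))" using s by simp
      also have "\<dots> \<le> \<sigma> T * (exp (K\<^sup>2 / \<epsilon> * odds T) * A)"
        unfolding A_def using s by (intro mult_left_mono difference_gronwall[OF elim T0 T(2)]) auto
      finally have "norm (XN T \<omega> - X T \<omega>) powr p \<le> ((\<sigma> T * exp (K\<^sup>2 / \<epsilon> * odds T)) * A) powr p"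
        using p by (intro powr_mono2) (auto simp: mult.assoc)
      also have "\<dots> = (\<sigma> T * exp (K\<^sup>2 / \<epsilon> * odds T)) powr p * A powr p" by (rule powr_mult)
      also have "\<dots> \<le> (\<sigma> T * exp (K\<^sup>2 / \<epsilon> * odds T)) powr p * (odds T powr (p - 1) * B)"
        unfolding A_def B_def
        by (intro mult_left_mono integral_clock_powr_le cF p odds_0 o) (auto simp: fluct_def)
      finally have "norm (XN T \<omega> - X T \<omega>) powr p \<le> c * B" by (simp only: c_def mult_ac)
      thus ?case unfolding B_def by (rule ennreal_leI)
    qed
  qed
  also have "\<dots> \<le> ennreal (c * (odds T * G))"
    using p by (intro fluct_time_moment T0 T(2) G c) auto
  also have "\<dots> \<le> ennreal (exp (p * (K\<^sup>2 / \<epsilon> * odds T)) * G)"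
  proof (rule ennreal_leI)
    have e: "exp (K\<^sup>2 / \<epsilon> * odds T) powr p = exp (p * (K\<^sup>2 / \<epsilon> * odds T))" by (simp add: powr_def)
    have "odds T powr (p - 1) * odds T = odds T powr p" using o powr_mult_base[of "odds T" "p - 1"] by (simp add: mult.commute)
    hence "c * (odds T * G) = (\<sigma> T powr p * odds T powr p) * exp (p * (K\<^sup>2 / \<epsilon> * odds T)) * G"
      unfolding c_def powr_mult e by (simp add: mult_ac)
    also have "\<sigma> T powr p * odds T powr p = \<beta> T powr p" using s by (simp add: odds_def flip: powr_mult)
    also have "\<beta> T powr p * exp (p * (K\<^sup>2 / \<epsilon> * odds T)) * G \<le> 1 * exp (p * (K\<^sup>2 / \<epsilon> * odds T)) * G"
    proof (intro mult_right_mono)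
      have "\<beta> T powr p \<le> 1 powr p" using b \<beta>_range[of T] T p by (intro powr_mono2) auto
      thus "\<beta> T powr p \<le> 1" by simp
    qed (use G in auto)
    finally show "c * (odds T * G) \<le> exp (p * (K\<^sup>2 / \<epsilon> * odds T)) * G" by simp
  qed
  finally show ?thesis .
qed

lemma difference_moment_explicit:
  assumes t: "t \<in> {0<..<1}" and q: "0 < q" "q \<le> 1" "AE \<omega>' in P. q \<le> P.prob {\<omega>\<in>space P. norm (\<eta> \<omega> - \<eta> \<omega>') \<le> r}"
    and r: "r \<ge> 0" and K: "K > 0" and p: "p > 1"
  shows "(\<integral>\<^sup>+\<omega>. ennreal (norm (XN t \<omega> - X t \<omega>) powr p) \<partial>M)
       \<le> ennreal (fluct_const DIM('a) K p q * (1 / sqrt (real N)) powr p * exp (p * ((K\<^sup>2 + fluct_rate DIM('a) K p r) * odds t / \<epsilon>)))"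
proof -
  have T: "0 < t" "t < 1" using t by auto
  interpret smooth_clock t odds odds' by (rule smooth_clock_odds) (use T in auto)
  define A where "A = fluct_const DIM('a) K p q * (1 / sqrt (real N)) powr p"
  define \<kappa> where "\<kappa> = fluct_rate DIM('a) K p r"
  have A: "A \<ge> 0" using q K by (simp add: A_def fluct_const_def moment_const_def)
  have \<kappa>: "\<kappa> \<ge> 0" using r K p by (simp add: \<kappa>_def fluct_rate_def)
  have "(\<integral>\<^sup>+\<omega>. ennreal (norm (XN t \<omega> - X t \<omega>) powr p) \<partial>M)
      \<le> ennreal (exp (p * (K\<^sup>2 / \<epsilon> * odds t)) * (A * exp (p * \<kappa> * odds t / \<epsilon>)))"
  proof (rule difference_moment[OF T p])
    fix u assume u: "u \<in> {0..t}"
    have "(\<integral>\<^sup>+\<omega>. ennreal (fluct u \<omega> powr p) \<partial>M) \<le> ennreal (A * exp (p * \<kappa> * odds u / \<epsilon>))"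
      unfolding A_def \<kappa>_def using u T p by (intro fluct_moment q r K) auto
    also have "\<dots> \<le> ennreal (A * exp (p * \<kappa> * odds t / \<epsilon>))"
      using u clock_mono[of u t] A \<kappa> p \<epsilon>_pos
      by (intro ennreal_leI mult_left_mono) (auto intro!: divide_right_mono mult_left_mono)
    finally show "(\<integral>\<^sup>+\<omega>. ennreal (fluct u \<omega> powr p) \<partial>M) \<le> ennreal (A * exp (p * \<kappa> * odds t / \<epsilon>))" .
  qed (use A in auto)
  also have "exp (p * (K\<^sup>2 / \<epsilon> * odds t)) * (A * exp (p * \<kappa> * odds t / \<epsilon>)) = A * exp (p * ((K\<^sup>2 + \<kappa>) * odds t / \<epsilon>))"
    by (simp add: add_divide_distrib distrib_left distrib_right exp_add)
  finally show ?thesis by (simp only: A_def \<kappa>_def)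
qed

lemma difference_0:
  assumes K: "K = 0" and t: "t \<in> {0<..<1}"
  shows "AE \<omega> in M. XN t \<omega> = X t \<omega>"
proof -
  have T: "0 \<le> t" "t < 1" using t by auto
  obtain I where I: "\<And>t. t \<in> {0..<1} \<Longrightarrow> wiener_integral M W SN.vol t (I t)" "AE \<omega> in M. good_path I \<omega>"
    by (rule good_paths) (rule that)
  show ?thesis using I(2)
  proof eventually_elim
    case (elim \<omega>)
    have y: "norm (\<eta>s i \<omega>) \<le> K" if "i \<in> {1..N}" for i using elim that by (auto simp: good_path_def)
    have F: "fluct r \<omega> = 0" if r: "r \<in> {0..t}" for r
    proof -
      have r1: "r \<in> {0..<1}" using r T by auto
      have "norm (sample_mean \<omega> r (X r \<omega>)) \<le> K" by (rule norm_emp_mean[OF N_pos y r1])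
      thus ?thesis using SV.norm_post_mean[OF r1, of "X r \<omega>"] K by (simp add: fluct_def)
    qed
    have "integral {0..t} (\<lambda>r. odds' r * fluct r \<omega>) = integral {0..t} (\<lambda>r. 0)"
      by (rule integral_cong) (simp add: F)
    hence "norm ((1 / \<sigma> t) *\<^sub>R (XN t \<omega> - X t \<omega>)) \<le> 0"
      using difference_gronwall[OF elim T] by simp
    thus ?case using \<sigma>_pos[OF T] by (simp add: divide_le_0_iff)
  qed
qed

end

section \<open>Comparison of the exponents\<close>

lemma powr_inverse_le:
  fixes x b p :: real
  assumes "0 \<le> x" "x \<le> b powr p" "0 \<le> b" "p > 0"
  shows "x powr (1 / p) \<le> b"
proof -
  have "x powr (1 / p) \<le> (b powr p) powr (1 / p)" using assms by (intro powr_mono2) auto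
  also have "\<dots> = b" using assms by (simp add: powr_powr)
  finally show ?thesis .
qed

lemma Lp_norm_le:
  fixes Z :: "'w \<Rightarrow> 'a::euclidean_space"
  assumes [measurable]: "Z \<in> borel_measurable M" and p: "p > 0" and b: "b \<ge> 0"
    and le: "(\<integral>\<^sup>+\<omega>. ennreal (norm (Z \<omega>) powr p) \<partial>M) \<le> ennreal (b powr p)"
  shows "in_Lp M p Z \<and> Lp_norm M p Z \<le> b"
proof
  have "(\<lambda>\<omega>. norm (Z \<omega>) powr p) \<in> borel_measurable M" by measurable
  hence i: "integrable M (\<lambda>\<omega>. norm (Z \<omega>) powr p)"
    using le by (intro integrableI_nonneg) (auto intro: le_less_trans)
  thus "in_Lp M p Z" by (simp add: in_Lp_def)
  have "(\<integral>\<^sup>+\<omega>. ennreal (norm (Z \<omega>) powr p) \<partial>M) = ennreal (LINT \<omega>|M. norm (Z \<omega>) powr p)"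
    by (rule nn_integral_eq_integral[OF i]) simp
  hence "ennreal (LINT \<omega>|M. norm (Z \<omega>) powr p) \<le> ennreal (b powr p)" using le by simp
  hence "(LINT \<omega>|M. norm (Z \<omega>) powr p) \<le> b powr p" by (subst (asm) ennreal_le_iff) auto
  thus "Lp_norm M p Z \<le> b" unfolding Lp_norm_def
    using b p by (intro powr_inverse_le) auto
qed

lemma (in prob_space) essential_bound:
  fixes \<eta> :: "'a \<Rightarrow> 'b::euclidean_space"
  assumes [measurable]: "\<eta> \<in> borel_measurable M" and ex: "AE \<omega> in M. norm (\<eta> \<omega>) \<le> K"
  obtains k where "k \<ge> 0" "AE \<omega> in M. norm (\<eta> \<omega>) \<le> k" "\<And>K. AE \<omega> in M. norm (\<eta> \<omega>) \<le> K \<Longrightarrow> k \<le> K"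
    "\<And>d. d > 0 \<Longrightarrow> prob {\<omega>\<in>space M. norm (\<eta> \<omega>) > k - d} > 0"
proof -
  define S where "S = {K. AE \<omega> in M. norm (\<eta> \<omega>) \<le> K}"
  have nonneg: "K \<ge> 0" if "K \<in> S" for K
  proof -
    interpret bounded_vector M \<eta> K by unfold_locales (use that in \<open>auto simp: S_def\<close>)
    show ?thesis by (rule K_nonneg)
  qed
  have S: "S \<noteq> {}" "bdd_below S" using ex nonneg by (auto simp: S_def intro!: bdd_belowI[of _ 0])
  define k where "k = Inf S"
  have le: "k \<le> K" if "AE \<omega> in M. norm (\<eta> \<omega>) \<le> K" for K
    unfolding k_def using that S by (intro cInf_lower) (auto simp: S_def)
  have "AE \<omega> in M. norm (\<eta> \<omega>) \<le> k + 1 / real (Suc n)" for n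
  proof -
    have "Inf S < k + 1 / real (Suc n)" by (simp add: k_def)
    then obtain K where K: "K \<in> S" "K < k + 1 / real (Suc n)" using S by (subst (asm) cInf_less_iff) auto
    have "AE \<omega> in M. norm (\<eta> \<omega>) \<le> K" using K by (simp add: S_def)
    thus ?thesis by eventually_elim (use K in linarith)
  qed
  hence "AE \<omega> in M. \<forall>n. norm (\<eta> \<omega>) \<le> k + 1 / real (Suc n)" by (simp add: AE_all_countable)
  hence bd: "AE \<omega> in M. norm (\<eta> \<omega>) \<le> k"
  proof eventually_elim
    case (elim \<omega>)
    have "(\<lambda>n. k + 1 / real (Suc n)) \<longlonglongrightarrow> k + 0" by (intro tendsto_intros LIMSEQ_Suc[OF lim_1_over_n])
    from LIMSEQ_le_const[OF this, of "norm (\<eta> \<omega>)"] elim show ?case by auto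
  qed
  have pos: "prob {\<omega>\<in>space M. norm (\<eta> \<omega>) > k - d} > 0" if d: "d > 0" for d
  proof (rule ccontr)
    assume "\<not> prob {\<omega>\<in>space M. norm (\<eta> \<omega>) > k - d} > 0"
    hence 0: "prob {\<omega>\<in>space M. norm (\<eta> \<omega>) > k - d} = 0" by (simp add: not_less measure_le_0_iff)
    have [measurable]: "{\<omega>\<in>space M. norm (\<eta> \<omega>) > k - d} \<in> events" by measurable
    have "{\<omega>\<in>space M. norm (\<eta> \<omega>) > k - d} \<in> null_sets M"
      using 0 by (simp add: null_sets_def emeasure_eq_measure)
    hence "AE \<omega> in M. \<omega> \<notin> {\<omega>\<in>space M. norm (\<eta> \<omega>) > k - d}" by (rule AE_not_in)
    hence "AE \<omega> in M. norm (\<eta> \<omega>) \<le> k - d" using AE_space by eventually_elim auto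
    from le[OF this] d show False by simp
  qed
  have "k \<ge> 0" unfolding k_def using S nonneg by (intro cInf_greatest) auto
  from that[OF this bd le pos] show ?thesis .
qed

text \<open>As \<open>p - 1 \<ge> 1\<close>, a value of \<open>\<eta>\<close> of norm close to \<open>k\<close> contributes at least about \<open>(k\<^sup>2 + \<mu> / p) (1 + s) / (2 \<epsilon>)\<close>
  to the exponent after the \<open>p\<close>-th root. With the explicit \<open>k\<^sup>2 s / (2 \<epsilon>)\<close> this is the rate \<open>k\<^sup>2 s / \<epsilon>\<close> and
  a surplus of \<open>\<mu> (1 + s) / (2 p \<epsilon>)\<close>. One half of the surplus pays for values that only come close to
  \<open>k\<close>; in the other half the term without \<open>s\<close> compensates the factor \<open>\<surd>\<epsilon>\<close>.\<close>
lemma (in prob_space) exponential_moment_lower_bound: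
  fixes \<eta> :: "'a \<Rightarrow> 'b::euclidean_space" and p \<mu> :: real
  assumes [measurable]: "\<eta> \<in> borel_measurable M" and p: "p \<ge> 2" and \<mu>: "\<mu> > 0"
    and k: "k > 0" "AE \<omega> in M. norm (\<eta> \<omega>) \<le> k"
    and Q: "\<And>d. d > 0 \<Longrightarrow> prob {\<omega>\<in>space M. norm (\<eta> \<omega>) > k - d} > 0"
  shows "\<exists>c>0. \<forall>\<epsilon>>0. \<forall>s\<ge>0. c * exp ((k\<^sup>2 + \<mu> / (4 * p)) * s / \<epsilon>)
     \<le> sqrt \<epsilon> * exp (k\<^sup>2 * s / (2 * \<epsilon>)) * (LINT \<omega>|M. exp ((p - 1) * (p * (norm (\<eta> \<omega>))\<^sup>2 + \<mu>) * (1 + s) / (2 * \<epsilon>))) powr (1 / p)"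
proof -
  define \<kappa> where "\<kappa> = \<mu> / (4 * p)"
  have \<kappa>: "\<kappa> > 0" using \<mu> p by (simp add: \<kappa>_def)
  define d where "d = min k (\<kappa> / k)"
  have d: "d > 0" "d \<le> k" "k * d \<le> \<kappa>" using k \<kappa> by (auto simp: d_def min_def field_simps)
  define E where "E = {\<omega>\<in>space M. norm (\<eta> \<omega>) > k - d}"
  have E [measurable]: "E \<in> events" unfolding E_def by measurable
  have pE: "prob E > 0" unfolding E_def by (rule Q[OF d(1)])
  show ?thesis
  proof (intro exI[of _ "sqrt \<kappa> * prob E powr (1 / p)"] conjI allI impI)
    show "sqrt \<kappa> * prob E powr (1 / p) > 0" using \<kappa> pE by simp
    fix \<epsilon> s :: real assume e: "\<epsilon> > 0" and s: "s \<ge> 0"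
    define m where "m = (p - 1) * (p * (k - d)\<^sup>2 + \<mu>) * (1 + s) / (2 * \<epsilon>)"
    define L where "L = (LINT \<omega>|M. exp ((p - 1) * (p * (norm (\<eta> \<omega>))\<^sup>2 + \<mu>) * (1 + s) / (2 * \<epsilon>)))"
    have mono: "exp ((p - 1) * (p * a + \<mu>) * (1 + s) / (2 * \<epsilon>)) \<le> exp ((p - 1) * (p * b + \<mu>) * (1 + s) / (2 * \<epsilon>))"
      if "a \<le> b" for a b
      using that p s e by (simp add: divide_right_mono mult_left_mono mult_right_mono)
    have int: "integrable M (\<lambda>\<omega>. exp ((p - 1) * (p * (norm (\<eta> \<omega>))\<^sup>2 + \<mu>) * (1 + s) / (2 * \<epsilon>)))"
    proof (rule integrable_const_bound)
      show "AE \<omega> in M. norm (exp ((p - 1) * (p * (norm (\<eta> \<omega>))\<^sup>2 + \<mu>) * (1 + s) / (2 * \<epsilon>)))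
          \<le> exp ((p - 1) * (p * k\<^sup>2 + \<mu>) * (1 + s) / (2 * \<epsilon>))"
        using k(2)
      proof eventually_elim
        case (elim \<omega>)
        hence "(norm (\<eta> \<omega>))\<^sup>2 \<le> k\<^sup>2" by (intro power_mono) auto
        from mono[OF this] show ?case by simp
      qed
    qed measurable
    have "prob E * exp m = expectation (\<lambda>\<omega>. indicator E \<omega> * exp m)" by simp
    also have "\<dots> \<le> L"
      unfolding L_def
    proof (rule integral_mono)
      fix \<omega> assume "\<omega> \<in> space M"
      show "indicator E \<omega> * exp m \<le> exp ((p - 1) * (p * (norm (\<eta> \<omega>))\<^sup>2 + \<mu>) * (1 + s) / (2 * \<epsilon>))"
      proof (cases "\<omega> \<in> E")
        case True
        hence "(k - d)\<^sup>2 \<le> (norm (\<eta> \<omega>))\<^sup>2" using d by (intro power_mono) (auto simp: E_def)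
        from mono[OF this] True show ?thesis by (simp add: m_def)
      qed simp
    qed (use int in \<open>auto intro!: integrable_mult_left integrable_real_indicator simp: less_top[symmetric]\<close>)
    finally have L: "prob E * exp m \<le> L" .
    have "prob E powr (1 / p) * exp (m / p) = (prob E * exp m) powr (1 / p)"
      using p by (simp add: powr_mult) (simp add: powr_def)
    also have "\<dots> \<le> L powr (1 / p)" using L p by (intro powr_mono2) auto
    finally have Lp: "prob E powr (1 / p) * exp (m / p) \<le> L powr (1 / p)" .
    have expo: "(k\<^sup>2 + \<kappa>) * s / \<epsilon> + \<kappa> / \<epsilon> \<le> k\<^sup>2 * s / (2 * \<epsilon>) + m / p"
    proof -
      have "k\<^sup>2 - 2 * \<kappa> \<le> (k - d)\<^sup>2" using d(3) zero_le_power2[of d] unfolding power2_diff by linarith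
      moreover have "\<mu> / p = 4 * \<kappa>" using p by (simp add: \<kappa>_def)
      ultimately have 1: "k\<^sup>2 + 2 * \<kappa> \<le> (k - d)\<^sup>2 + \<mu> / p" by linarith
      have "1 * ((k\<^sup>2 + 2 * \<kappa>) * (1 + s)) \<le> (p - 1) * (((k - d)\<^sup>2 + \<mu> / p) * (1 + s))"
        using 1 p s \<kappa> by (intro mult_mono mult_right_mono) (auto intro!: mult_nonneg_nonneg add_nonneg_nonneg)
      also have "\<dots> = (m / p) * (2 * \<epsilon>)" using p e by (simp add: m_def field_simps)
      finally have 2: "(k\<^sup>2 + 2 * \<kappa>) * (1 + s) \<le> (m / p) * (2 * \<epsilon>)" by simp
      have "((k\<^sup>2 + \<kappa>) * s / \<epsilon> + \<kappa> / \<epsilon>) * (2 * \<epsilon>) = k\<^sup>2 * s + (k\<^sup>2 * s + 2 * \<kappa> * s + 2 * \<kappa>)"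
        using e by (simp add: field_simps)
      also have "\<dots> \<le> k\<^sup>2 * s + (k\<^sup>2 + 2 * \<kappa>) * (1 + s)" by (simp add: algebra_simps)
      also have "\<dots> \<le> k\<^sup>2 * s + (m / p) * (2 * \<epsilon>)" using 2 by simp
      also have "\<dots> = (k\<^sup>2 * s / (2 * \<epsilon>) + m / p) * (2 * \<epsilon>)" using e by (simp add: field_simps)
      finally show ?thesis using e by (subst (asm) mult_le_cancel_right) auto
    qed
    have sq: "sqrt \<kappa> \<le> sqrt \<epsilon> * exp (\<kappa> / \<epsilon>)"
    proof -
      define x where "x = \<kappa> / \<epsilon>"
      have x: "x \<ge> 0" using \<kappa> e by (simp add: x_def)
      have "sqrt x \<le> 1 + x" using x by (intro real_le_lsqrt) (auto simp: power2_eq_square algebra_simps)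
      also have "\<dots> \<le> exp x" by (rule exp_ge_add_one_self)
      finally have "sqrt \<epsilon> * sqrt x \<le> sqrt \<epsilon> * exp x" using e by (intro mult_left_mono) auto
      moreover have "sqrt \<epsilon> * sqrt x = sqrt \<kappa>" using e by (simp add: x_def flip: real_sqrt_mult)
      ultimately show ?thesis by (simp add: x_def)
    qed
    have "sqrt \<kappa> * prob E powr (1 / p) * exp ((k\<^sup>2 + \<kappa>) * s / \<epsilon>)
       \<le> (sqrt \<epsilon> * exp (\<kappa> / \<epsilon>)) * prob E powr (1 / p) * exp ((k\<^sup>2 + \<kappa>) * s / \<epsilon>)"
      using sq by (intro mult_right_mono) auto
    also have "\<dots> = sqrt \<epsilon> * prob E powr (1 / p) * exp ((k\<^sup>2 + \<kappa>) * s / \<epsilon> + \<kappa> / \<epsilon>)"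
      by (simp add: exp_add mult_ac)
    also have "\<dots> \<le> sqrt \<epsilon> * prob E powr (1 / p) * exp (k\<^sup>2 * s / (2 * \<epsilon>) + m / p)"
      using expo e by (intro mult_left_mono) auto
    also have "\<dots> = sqrt \<epsilon> * exp (k\<^sup>2 * s / (2 * \<epsilon>)) * (prob E powr (1 / p) * exp (m / p))"
      by (simp add: exp_add mult_ac)
    also have "\<dots> \<le> sqrt \<epsilon> * exp (k\<^sup>2 * s / (2 * \<epsilon>)) * L powr (1 / p)"
      using Lp e by (intro mult_left_mono) auto
    finally show "sqrt \<kappa> * prob E powr (1 / p) * exp ((k\<^sup>2 + \<mu> / (4 * p)) * s / \<epsilon>)
       \<le> sqrt \<epsilon> * exp (k\<^sup>2 * s / (2 * \<epsilon>)) * (LINT \<omega>|M. exp ((p - 1) * (p * (norm (\<eta> \<omega>))\<^sup>2 + \<mu>) * (1 + s) / (2 * \<epsilon>))) powr (1 / p)"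
      by (simp only: \<kappa>_def L_def)
  qed
qed

text \<open>The claimed bound at odds \<open>s\<close>, where \<open>1 / \<sigma>\<^sub>t = 1 + s\<close>, without its constant and the factor
  \<open>1 / \<surd>N\<close>.\<close>
definition claimed_bound :: "'p measure \<Rightarrow> ('p \<Rightarrow> 'a::euclidean_space) \<Rightarrow> real \<Rightarrow> real \<Rightarrow> real \<Rightarrow> real \<Rightarrow> real" where
  "claimed_bound P \<eta> p K \<epsilon> s = sqrt \<epsilon> * exp (K\<^sup>2 * s / (2 * \<epsilon>)) *
     (LINT \<omega>|P. exp ((p - 1) * (p * (norm (\<eta> \<omega>))\<^sup>2 + (LINT \<omega>'|P. (norm (\<eta> \<omega>'))\<^sup>2)) * (1 + s) / (2 * \<epsilon>))) powr (1 / p)"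

lemma claimed_bound_nonneg: "\<epsilon> \<ge> 0 \<Longrightarrow> claimed_bound P \<eta> p K \<epsilon> s \<ge> 0"
  by (simp add: claimed_bound_def)

text \<open>With \<open>k\<close> the essential supremum of \<open>|\<eta>|\<close> the error and its bound have the same exponential rate
  \<open>(k\<^sup>2 + \<kappa>) s / \<epsilon>\<close>, so the ratio of the prefactors serves as the constant.\<close>
lemma uniform_moment_bound:
  fixes P :: "'p measure" and \<eta> :: "'p \<Rightarrow> 'a::euclidean_space" and p :: real
  assumes "prob_space P" and \<eta> [measurable]: "\<eta> \<in> borel_measurable P" and p: "p \<ge> 2"
  shows "\<exists>C>0. \<forall>(K::real) (\<epsilon>::real) (\<gamma>::real) \<beta> \<beta>' \<sigma> \<sigma>' (M::'w measure) (N::nat) \<eta>s W \<xi> X XN.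
     (AE \<omega> in P. norm (\<eta> \<omega>) \<le> K) \<and> 0 < \<epsilon> \<and> \<epsilon> \<le> \<gamma> \<and>
     coupled_diffusions P \<eta> \<beta> \<beta>' \<sigma> \<sigma>' \<epsilon> \<gamma> M N \<eta>s W \<xi> X XN \<longrightarrow>
     (\<forall>t\<in>{0<..<1}. (\<integral>\<^sup>+\<omega>. ennreal (norm (XN t \<omega> - X t \<omega>) powr p) \<partial>M)
        \<le> ennreal ((C / sqrt (real N) * claimed_bound P \<eta> p K \<epsilon> (\<beta> t / \<sigma> t)) powr p))"
proof -
  interpret P: prob_space P by fact
  define \<mu> where "\<mu> = (LINT \<omega>'|P. (norm (\<eta> \<omega>'))\<^sup>2)"
  let ?R = "claimed_bound P \<eta> p"
  show ?thesis
proof (cases "\<exists>K. AE \<omega> in P. norm (\<eta> \<omega>) \<le> K")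
  case True
  then obtain K where K: "AE \<omega> in P. norm (\<eta> \<omega>) \<le> K" by blast
  obtain k where k: "k \<ge> 0" "AE \<omega> in P. norm (\<eta> \<omega>) \<le> k" "\<And>K. AE \<omega> in P. norm (\<eta> \<omega>) \<le> K \<Longrightarrow> k \<le> K"
    "\<And>d. d > 0 \<Longrightarrow> P.prob {\<omega>\<in>space P. norm (\<eta> \<omega>) > k - d} > 0"
    by (rule P.essential_bound[OF \<eta> K]) (rule that)
  interpret B: bounded_vector P \<eta> k by unfold_locales (use k in auto)
  have coupling: "bounded_coupling P \<eta> \<beta> \<beta>' \<sigma> \<sigma>' \<epsilon> \<gamma> M N \<eta>s W \<xi> X XN k"
    if "coupled_diffusions P \<eta> \<beta> \<beta>' \<sigma> \<sigma>' \<epsilon> \<gamma> M N \<eta>s W \<xi> X XN" "\<epsilon> \<le> \<gamma>"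
    for \<epsilon> \<gamma> \<beta> \<beta>' \<sigma> \<sigma>' and M :: "'w measure" and N \<eta>s W \<xi> X XN
    using that k(2) by (intro bounded_coupling.intro bounded_coupling_axioms.intro)
  show ?thesis
  proof (cases "k = 0")
    case True
    show ?thesis
    proof (intro exI[of _ 1] conjI allI impI ballI)
      fix K \<epsilon> \<gamma> :: real and \<beta> \<beta>' \<sigma> \<sigma>' and M :: "'w measure" and N \<eta>s W \<xi> X XN and t :: real
      assume A: "(AE \<omega> in P. norm (\<eta> \<omega>) \<le> K) \<and> 0 < \<epsilon> \<and> \<epsilon> \<le> \<gamma> \<and> coupled_diffusions P \<eta> \<beta> \<beta>' \<sigma> \<sigma>' \<epsilon> \<gamma> M N \<eta>s W \<xi> X XN"
        and t: "t \<in> {0<..<1}"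
      have "bounded_coupling P \<eta> \<beta> \<beta>' \<sigma> \<sigma>' \<epsilon> \<gamma> M N \<eta>s W \<xi> X XN k" using A by (intro coupling) auto
      from bounded_coupling.difference_0[OF this True t]
      have "(\<integral>\<^sup>+\<omega>. ennreal (norm (XN t \<omega> - X t \<omega>) powr p) \<partial>M) = (\<integral>\<^sup>+\<omega>. 0 \<partial>M)"
        by (intro nn_integral_cong_AE) (auto elim: eventually_mono)
      thus "(\<integral>\<^sup>+\<omega>. ennreal (norm (XN t \<omega> - X t \<omega>) powr p) \<partial>M) \<le> ennreal ((1 / sqrt (real N) * ?R K \<epsilon> (\<beta> t / \<sigma> t)) powr p)"
        by simp
    qed simp
  next
    case False
    hence kpos: "k > 0" using k(1) by simp
    have i2: "integrable P (\<lambda>\<omega>. (norm (\<eta> \<omega>))\<^sup>2)"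
    proof (rule P.integrable_const_bound)
      show "AE \<omega> in P. norm ((norm (\<eta> \<omega>))\<^sup>2) \<le> k\<^sup>2"
        using k(2) by eventually_elim (simp add: power_mono)
    qed measurable
    have \<mu>: "\<mu> > 0"
    proof (rule ccontr)
      assume "\<not> \<mu> > 0"
      moreover have "\<mu> \<ge> 0" unfolding \<mu>_def by (intro Bochner_Integration.integral_nonneg) simp
      ultimately have "\<mu> = 0" by simp
      hence "AE \<omega> in P. (norm (\<eta> \<omega>))\<^sup>2 = 0"
        using integral_nonneg_eq_0_iff_AE[OF i2] by (simp add: \<mu>_def)
      hence "AE \<omega> in P. norm (\<eta> \<omega>) \<le> 0" by eventually_elim simp
      from k(3)[OF this] kpos show False by simp
    qed
    define \<kappa> where "\<kappa> = \<mu> / (4 * p)"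
    have \<kappa>: "\<kappa> > 0" using \<mu> p by (simp add: \<kappa>_def)
    obtain c where c: "c > 0" "\<And>\<epsilon> s. \<epsilon> > 0 \<Longrightarrow> s \<ge> 0 \<Longrightarrow> c * exp ((k\<^sup>2 + \<kappa>) * s / \<epsilon>) \<le> ?R k \<epsilon> s"
      using P.exponential_moment_lower_bound[OF \<eta> p \<mu> kpos k(2) k(4)] unfolding claimed_bound_def \<kappa>_def \<mu>_def by blast
    \<comment> \<open>a radius for which the fluctuations cost at most \<open>\<kappa>\<close> in the exponent\<close>
    define a where "a = 2 * k + 4 * p * (real DIM('a))\<^sup>2"
    define r where "r = min 1 (\<kappa> / a)"
    have a: "a > 0" using kpos p by (simp add: a_def add_pos_nonneg)
    have r: "r > 0" "r \<le> 1" "r * a \<le> \<kappa>" using a \<kappa> by (auto simp: r_def min_def field_simps)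
    have rate: "fluct_rate DIM('a) k p r \<le> \<kappa>"
    proof -
      have "r\<^sup>2 \<le> r" using r by (simp add: power2_eq_square mult_left_le)
      hence "4 * p * r\<^sup>2 * (real DIM('a))\<^sup>2 \<le> 4 * p * r * (real DIM('a))\<^sup>2"
        using p by (intro mult_right_mono mult_left_mono) auto
      thus ?thesis using r(3) by (simp add: fluct_rate_def a_def algebra_simps)
    qed
    obtain q where q: "q > 0" "q \<le> 1" "AE \<omega>' in P. q \<le> P.prob {\<omega>\<in>space P. norm (\<eta> \<omega> - \<eta> \<omega>') \<le> r}"
      using B.small_ball[OF r(1)] by blast
    define A where "A = fluct_const DIM('a) k p q powr (1 / p)"
    have A: "A \<ge> 0" "A powr p = fluct_const DIM('a) k p q"
      using p q kpos by (simp_all add: A_def powr_powr fluct_const_def moment_const_def)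
    show ?thesis
    proof (intro exI[of _ "A / c + 1"] conjI allI impI ballI)
      show "A / c + 1 > 0" using A c by (simp add: add_nonneg_pos)
      fix K \<epsilon> \<gamma> :: real and \<beta> \<beta>' \<sigma> \<sigma>' and M :: "'w measure" and N \<eta>s W \<xi> X XN and t :: real
      assume H: "(AE \<omega> in P. norm (\<eta> \<omega>) \<le> K) \<and> 0 < \<epsilon> \<and> \<epsilon> \<le> \<gamma> \<and> coupled_diffusions P \<eta> \<beta> \<beta>' \<sigma> \<sigma>' \<epsilon> \<gamma> M N \<eta>s W \<xi> X XN"
        and t: "t \<in> {0<..<1}"
      interpret D: bounded_coupling P \<eta> \<beta> \<beta>' \<sigma> \<sigma>' \<epsilon> \<gamma> M N \<eta>s W \<xi> X XN k using H by (intro coupling) auto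
      define s where "s = \<beta> t / \<sigma> t"
      have s: "s \<ge> 0" using D.odds_nonneg[of t] t by (simp add: D.odds_def s_def)
      have e: "\<epsilon> > 0" using H by simp
      have "k \<le> K" using H k(3) by blast
      hence kK: "k\<^sup>2 \<le> K\<^sup>2" using kpos by (intro power_mono) auto
      have "?R k \<epsilon> s \<le> ?R K \<epsilon> s" unfolding claimed_bound_def
        using kK s e by (intro mult_right_mono mult_left_mono) (auto intro!: divide_right_mono mult_right_mono)
      with c(2)[OF e s] have cR: "c * exp ((k\<^sup>2 + \<kappa>) * s / \<epsilon>) \<le> ?R K \<epsilon> s" by simp
      have "(\<integral>\<^sup>+\<omega>. ennreal (norm (XN t \<omega> - X t \<omega>) powr p) \<partial>M)
         \<le> ennreal (fluct_const DIM('a) k p q * (1 / sqrt (real N)) powr p * exp (p * ((k\<^sup>2 + fluct_rate DIM('a) k p r) * D.odds t / \<epsilon>)))"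
        using r p by (intro D.difference_moment_explicit t q kpos) auto
      also have "\<dots> \<le> ennreal (A powr p * (1 / sqrt (real N)) powr p * exp (p * ((k\<^sup>2 + \<kappa>) * s / \<epsilon>)))"
        unfolding A(2) D.odds_def s_def[symmetric]
        using rate s e p A(2) by (intro ennreal_leI mult_left_mono) (auto intro!: mult_left_mono divide_right_mono mult_right_mono simp flip: A(2))
      also have "A powr p * (1 / sqrt (real N)) powr p * exp (p * ((k\<^sup>2 + \<kappa>) * s / \<epsilon>))
          = (A * (1 / sqrt (real N)) * exp ((k\<^sup>2 + \<kappa>) * s / \<epsilon>)) powr p"
        unfolding powr_mult by (simp add: powr_def)
      also have "ennreal \<dots> \<le> ennreal (((A / c + 1) / sqrt (real N) * ?R K \<epsilon> s) powr p)"
      proof (intro ennreal_leI powr_mono2)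
        have "A * exp ((k\<^sup>2 + \<kappa>) * s / \<epsilon>) = A / c * (c * exp ((k\<^sup>2 + \<kappa>) * s / \<epsilon>))" using c by simp
        also have "\<dots> \<le> A / c * ?R K \<epsilon> s" using cR A c by (intro mult_left_mono) auto
        also have "\<dots> \<le> (A / c + 1) * ?R K \<epsilon> s" using claimed_bound_nonneg[of \<epsilon> P \<eta> p K s] e by (simp add: distrib_right)
        finally have "(1 / sqrt (real N)) * (A * exp ((k\<^sup>2 + \<kappa>) * s / \<epsilon>)) \<le> (1 / sqrt (real N)) * ((A / c + 1) * ?R K \<epsilon> s)"
          by (intro mult_left_mono) auto
        thus "A * (1 / sqrt (real N)) * exp ((k\<^sup>2 + \<kappa>) * s / \<epsilon>) \<le> (A / c + 1) / sqrt (real N) * ?R K \<epsilon> s"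
          by (simp add: mult_ac)
      qed (use A p in auto)
      finally show "(\<integral>\<^sup>+\<omega>. ennreal (norm (XN t \<omega> - X t \<omega>) powr p) \<partial>M)
          \<le> ennreal (((A / c + 1) / sqrt (real N) * ?R K \<epsilon> (\<beta> t / \<sigma> t)) powr p)" by (simp only: s_def)
    qed
  qed
qed (auto intro!: exI[of _ 1])
qed

theorem theorem4p5:
  fixes P :: "'p measure" and \<eta> :: "'p \<Rightarrow> 'a::euclidean_space" and p :: real
  assumes "prob_space P" and "\<eta> \<in> borel_measurable P"
    and "(LINT \<omega>|P. \<eta> \<omega>) = 0"
    and "p \<ge> 2"
  shows "\<exists>C>0. \<forall>(K::real) (\<epsilon>::real) (\<gamma>::real) \<beta> \<beta>' \<sigma> \<sigma>' (M::'w measure) (N::nat) \<eta>s W \<xi> X XN.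
    (AE \<omega> in P. norm (\<eta> \<omega>) \<le> K) \<and> 0 < \<epsilon> \<and> \<epsilon> \<le> \<gamma> \<and>
    coupled_diffusions P \<eta> \<beta> \<beta>' \<sigma> \<sigma>' \<epsilon> \<gamma> M N \<eta>s W \<xi> X XN \<longrightarrow>
    (\<forall>t\<in>{0<..<1}.
      in_Lp M p (\<lambda>\<omega>. XN t \<omega> - X t \<omega>) \<and>
      Lp_norm M p (\<lambda>\<omega>. XN t \<omega> - X t \<omega>)
        \<le> C * (sqrt \<epsilon> / sqrt (real N)) * exp (K\<^sup>2 * \<beta> t / (2 * \<epsilon> * \<sigma> t)) *
          (LINT \<omega>|P. exp ((p - 1) * (p * (norm (\<eta> \<omega>))\<^sup>2 + (LINT \<omega>'|P. (norm (\<eta> \<omega>'))\<^sup>2))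
                            / (2 * \<epsilon> * \<sigma> t))) powr (1 / p))"
proof -
  obtain C where C: "C > 0" and bd: "\<forall>(K::real) (\<epsilon>::real) (\<gamma>::real) \<beta> \<beta>' \<sigma> \<sigma>' (M::'w measure) (N::nat) \<eta>s W \<xi> X XN.
     (AE \<omega> in P. norm (\<eta> \<omega>) \<le> K) \<and> 0 < \<epsilon> \<and> \<epsilon> \<le> \<gamma> \<and>
     coupled_diffusions P \<eta> \<beta> \<beta>' \<sigma> \<sigma>' \<epsilon> \<gamma> M N \<eta>s W \<xi> X XN \<longrightarrow>
     (\<forall>t\<in>{0<..<1}. (\<integral>\<^sup>+\<omega>. ennreal (norm (XN t \<omega> - X t \<omega>) powr p) \<partial>M)
        \<le> ennreal ((C / sqrt (real N) * claimed_bound P \<eta> p K \<epsilon> (\<beta> t / \<sigma> t)) powr p))"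
    using uniform_moment_bound[OF assms(1,2,4)] by blast
  show ?thesis
  proof (intro exI[of _ C] conjI[OF C] allI impI ballI)
    fix K \<epsilon> \<gamma> :: real and \<beta> \<beta>' \<sigma> \<sigma>' and M :: "'w measure" and N \<eta>s W \<xi> X XN and t :: real
    assume H: "(AE \<omega> in P. norm (\<eta> \<omega>) \<le> K) \<and> 0 < \<epsilon> \<and> \<epsilon> \<le> \<gamma> \<and> coupled_diffusions P \<eta> \<beta> \<beta>' \<sigma> \<sigma>' \<epsilon> \<gamma> M N \<eta>s W \<xi> X XN"
      and t: "t \<in> {0<..<1}"
    interpret D: bounded_coupling P \<eta> \<beta> \<beta>' \<sigma> \<sigma>' \<epsilon> \<gamma> M N \<eta>s W \<xi> X XN K
      using H by (intro bounded_coupling.intro bounded_coupling_axioms.intro) auto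
    have [measurable]: "XN t \<in> borel_measurable M" "X t \<in> borel_measurable M"
      using D.X_rv[of t] D.XN_rv[of t] t by auto
    have \<sigma>: "1 / \<sigma> t = 1 + \<beta> t / \<sigma> t" using D.inv_\<sigma>_eq[of t] t by (simp add: D.odds_def)
    have y: "(p - 1) * y / (2 * \<epsilon> * \<sigma> t) = (p - 1) * y * (1 + \<beta> t / \<sigma> t) / (2 * \<epsilon>)" for y
      unfolding \<sigma>[symmetric] by simp
    have e: "exp (K\<^sup>2 * \<beta> t / (2 * \<epsilon> * \<sigma> t)) = exp (K\<^sup>2 * (\<beta> t / \<sigma> t) / (2 * \<epsilon>))" by simp
    have R: "C * (sqrt \<epsilon> / sqrt (real N)) * exp (K\<^sup>2 * \<beta> t / (2 * \<epsilon> * \<sigma> t)) *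
          (LINT \<omega>|P. exp ((p - 1) * (p * (norm (\<eta> \<omega>))\<^sup>2 + (LINT \<omega>'|P. (norm (\<eta> \<omega>'))\<^sup>2)) / (2 * \<epsilon> * \<sigma> t))) powr (1 / p)
        = C / sqrt (real N) * claimed_bound P \<eta> p K \<epsilon> (\<beta> t / \<sigma> t)"
      unfolding e claimed_bound_def y by (simp add: mult.assoc)
    have "(\<integral>\<^sup>+\<omega>. ennreal (norm (XN t \<omega> - X t \<omega>) powr p) \<partial>M)
        \<le> ennreal ((C / sqrt (real N) * claimed_bound P \<eta> p K \<epsilon> (\<beta> t / \<sigma> t)) powr p)"
      using bd H t by blast
    moreover have "0 \<le> C / sqrt (real N) * claimed_bound P \<eta> p K \<epsilon> (\<beta> t / \<sigma> t)"
      using C H by (simp add: claimed_bound_nonneg)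
    ultimately show "in_Lp M p (\<lambda>\<omega>. XN t \<omega> - X t \<omega>) \<and>
      Lp_norm M p (\<lambda>\<omega>. XN t \<omega> - X t \<omega>)
        \<le> C * (sqrt \<epsilon> / sqrt (real N)) * exp (K\<^sup>2 * \<beta> t / (2 * \<epsilon> * \<sigma> t)) *
          (LINT \<omega>|P. exp ((p - 1) * (p * (norm (\<eta> \<omega>))\<^sup>2 + (LINT \<omega>'|P. (norm (\<eta> \<omega>'))\<^sup>2))
                            / (2 * \<epsilon> * \<sigma> t))) powr (1 / p)"
      unfolding R using assms(4) by (intro Lp_norm_le) auto
  qed
qed

end
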